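(* Let $\mathcal{A}$ and $\mathcal{B}$ be unital operator algebras. Assume that both $\operatorname{diag}\mathcal{A}$ and $\operatorname{diag}\mathcal{B}$ have cancellation, and furthermore assume that $K_0(\operatorname{diag}\mathcal{A})\simeq K_0(\operatorname{diag}\mathcal{B})\simeq\mathbb{Z}$ with $[1]_{K_0(\operatorname{diag}\mathcal{A})}=[1]_{K_0(\operatorname{diag}\mathcal{B})}$ (as elements of $\mathbb{Z}$). Then $\mathcal{A}\otimes\mathcal{K}$ and $\mathcal{B}\otimes\mathcal{K}$ are completely isometrically isomorphic if and only if $\mathcal{A}$ and $\mathcal{B}$ are completely isometrically isomorphic.
   Context: An operator algebra is a norm-closed (not necessarily selfadjoint) subalgebra of $B(\mathcal{H}_0)$ for some Hilbert space $\mathcal{H}_0$, acting non-degenerately. The diagonal of an operator algebra $\mathcal{A}$ is the $\mathrm{C}^*$-algebra $\operatorname{diag}\mathcal{A}:=\mathcal{A}\cap\mathcal{A}^*$. $\mathcal{K}$ denotes the compact operators on an infinite-dimensional separable Hilbert space, and $\otimes$ is the spatial tensor product: for $\mathcal{A}_i\subseteq B(\mathcal{H}_i)$, $\mathcal{A}_1\otimes\mathcal{A}_2$ is the norm-closed subalgebra of $B(\mathcal{H}_1\otimes\mathcal{H}_2)$ generated by elementary tensors. For a $\mathrm{C}^*$-algebra $\mathcal{C}$, $\widetilde{\mathcal{C}}$ denotes its unitization (containing $\mathcal{C}$ as a proper ideal), and $\mathcal{D}(\widetilde{\mathcal{C}})$ denotes the abelian semigroup of Murray-von Neumann equivalence classes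 of projections in matrix algebras over $\widetilde{\mathcal{C}}$, with addition given by direct sum; $\mathcal{C}$ has cancellation if the semigroup $\mathcal{D}(\widetilde{\mathcal{C}})$ has cancellation ($x+z=y+z$ implies $x=y$). If $\mathcal{C}$ has cancellation and $K_0(\mathcal{C})\simeq\mathbb{Z}$, then the positive cone satisfies $K_0^+(\mathcal{C})\cap(-K_0^+(\mathcal{C}))=\{0\}$, and $K_0(\mathcal{C})$ is identified with $\mathbb{Z}$ by an isomorphism that maps $K_0^+(\mathcal{C})$ into $\mathbb{Z}^+=\{0,1,2,\dots\}$; the equality $[1]_{K_0(\operatorname{diag}\mathcal{A})}=[1]_{K_0(\operatorname{diag}\mathcal{B})}$ is understood as an equality of integers under these identifications. Completely isometrically isomorphic means that there is a surjective algebra isomorphism that is completely isometric. *)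

theory Defs
  imports
    "HOL-Analysis.Analysis"
    "HOL-Algebra.Elementary_Groups"
    "Jordan_Normal_Form.Matrix"
begin

section \<open>Complex Hilbert spaces\<close>

class scaleC =
  fixes scaleC :: "complex \<Rightarrow> 'a \<Rightarrow> 'a" (infixr "*\<^sub>C" 75)

class complex_vector = real_vector + scaleC +
  assumes scaleC_add_right: "c *\<^sub>C (x + y) = c *\<^sub>C x + c *\<^sub>C y"
    and scaleC_add_left: "(c + d) *\<^sub>C x = c *\<^sub>C x + d *\<^sub>C x"
    and scaleC_scaleC: "c *\<^sub>C (d *\<^sub>C x) = (c * d) *\<^sub>C x"
    and scaleC_of_real: "complex_of_real r *\<^sub>C x = r *\<^sub>R x"

text \<open>The complex inner product is linear in its first argument. Its real part is the inner
  product of \<^class>\<open>real_inner\<close>, so norm, metric and topology are the ones of that class.\<close>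

class complex_hilbert = real_inner + complete_space + complex_vector +
  fixes cinner :: "'a \<Rightarrow> 'a \<Rightarrow> complex"
  assumes cinner_commute: "cinner x y = cnj (cinner y x)"
    and cinner_add_left: "cinner (x + y) z = cinner x z + cinner y z"
    and cinner_scaleC_left: "cinner (c *\<^sub>C x) y = c * cinner x y"
    and Re_cinner: "Re (cinner x y) = inner x y"

instantiation complex :: complex_hilbert
begin

definition scaleC_complex :: "complex \<Rightarrow> complex \<Rightarrow> complex"
  where "scaleC_complex c z = c * z"

definition cinner_complex :: "complex \<Rightarrow> complex \<Rightarrow> complex"
  where "cinner_complex z w = z * cnj w"

instance
  by standard
    (auto simp: scaleC_complex_def cinner_complex_def algebra_simps scaleR_conv_of_real
      inner_complex_def)

end

lemma scaleC_one [simp]: "1 *\<^sub>C (x :: 'a::complex_vector) = x"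
  using scaleC_of_real[of 1 x] by simp

lemma scaleC_zero_left [simp]: "0 *\<^sub>C (x :: 'a::complex_vector) = 0"
  using scaleC_of_real[of 0 x] by simp

lemma scaleC_zero_right [simp]: "c *\<^sub>C (0 :: 'a::complex_vector) = 0"
  using scaleC_add_right[of c "0 :: 'a" 0] by simp

lemma scaleC_minus_right: "c *\<^sub>C (- x :: 'a::complex_vector) = - (c *\<^sub>C x)"
  using scaleC_add_right[of c x "- x"] by (simp add: eq_neg_iff_add_eq_0 add.commute)

lemma scaleC_diff_right: "c *\<^sub>C (x - y :: 'a::complex_vector) = c *\<^sub>C x - c *\<^sub>C y"
  using scaleC_add_right[of c x "- y"] by (simp add: scaleC_minus_right)

lemma norm_scaleC: "norm (c *\<^sub>C x) = cmod c * norm (x :: 'a::complex_hilbert)"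
proof -
  have "cinner (c *\<^sub>C x) (c *\<^sub>C x) = c * cnj (cinner (c *\<^sub>C x) x)"
    by (metis cinner_commute cinner_scaleC_left)
  also have "\<dots> = (c * cnj c) * cnj (cinner x x)"
    by (simp add: cinner_scaleC_left)
  also have "\<dots> = complex_of_real ((cmod c)\<^sup>2) * cinner x x"
    by (metis cinner_commute complex_norm_square)
  finally have "inner (c *\<^sub>C x) (c *\<^sub>C x) = (cmod c)\<^sup>2 * inner x x"
    by (simp flip: Re_cinner)
  then show ?thesis
    by (simp add: norm_eq_sqrt_inner real_sqrt_mult)
qed

lemma bounded_linear_scaleC: "bounded_linear (\<lambda>x :: 'a::complex_hilbert. c *\<^sub>C x)"
proof (rule bounded_linear_intro[where K = "cmod c"])
  fix r :: real and x :: 'a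
  show "c *\<^sub>C (r *\<^sub>R x) = r *\<^sub>R c *\<^sub>C x"
    by (simp flip: scaleC_of_real add: scaleC_scaleC mult.commute)
qed (auto simp: scaleC_add_right norm_scaleC mult.commute)


section \<open>The algebra of bounded operators\<close>

text \<open>A syntactic class; the only instances are the adjoint on bounded operators and the
  involution of a unitization.\<close>

class star =
  fixes star :: "'a \<Rightarrow> 'a"

class complex_algebra = ring + complex_vector +
  assumes mult_scaleC_left: "(c *\<^sub>C x) * y = c *\<^sub>C (x * y)"
    and mult_scaleC_right: "x * (c *\<^sub>C y) = c *\<^sub>C (x * y)"

class star_algebra = complex_algebra + star

typedef (overloaded) 'a bop =
  "{T :: ('a::complex_hilbert) \<Rightarrow>\<^sub>L 'a. \<forall>c x. blinfun_apply T (c *\<^sub>C x) = c *\<^sub>C blinfun_apply T x}"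
  by (rule exI[of _ id_blinfun]) auto

setup_lifting type_definition_bop

lift_definition bop_apply :: "'a::complex_hilbert bop \<Rightarrow> 'a \<Rightarrow> 'a" is blinfun_apply .

instantiation bop :: (complex_hilbert) real_normed_vector
begin

lift_definition zero_bop :: "'a bop" is 0
  by simp

lift_definition plus_bop :: "'a bop \<Rightarrow> 'a bop \<Rightarrow> 'a bop" is "(+)"
  by (simp add: blinfun.add_left scaleC_add_right)

lift_definition minus_bop :: "'a bop \<Rightarrow> 'a bop \<Rightarrow> 'a bop" is "(-)"
  by (simp add: blinfun.diff_left scaleC_diff_right)

lift_definition uminus_bop :: "'a bop \<Rightarrow> 'a bop" is uminus
  by (simp add: blinfun.minus_left scaleC_minus_right)

lift_definition scaleR_bop :: "real \<Rightarrow> 'a bop \<Rightarrow> 'a bop" is "(*\<^sub>R)"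
  by (simp add: blinfun.scaleR_left scaleC_scaleC mult.commute flip: scaleC_of_real)

lift_definition norm_bop :: "'a bop \<Rightarrow> real" is norm .

definition dist_bop :: "'a bop \<Rightarrow> 'a bop \<Rightarrow> real"
  where "dist_bop S T = norm (S - T)"

definition sgn_bop :: "'a bop \<Rightarrow> 'a bop"
  where "sgn_bop T = inverse (norm T) *\<^sub>R T"

definition uniformity_bop :: "('a bop \<times> 'a bop) filter"
  where "uniformity_bop = (INF e\<in>{0 <..}. principal {(S, T). dist S T < e})"

definition open_bop :: "'a bop set \<Rightarrow> bool"
  where "open_bop U = (\<forall>S\<in>U. \<forall>\<^sub>F (S', T) in uniformity. S' = S \<longrightarrow> T \<in> U)"

instance
proof
  fix S T U :: "'a bop" and r s :: real
  show "S + T + U = S + (T + U)" by transfer simp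
  show "S + T = T + S" by transfer simp
  show "0 + T = T" by transfer simp
  show "- T + T = 0" by transfer simp
  show "S - T = S + - T" by transfer simp
  show "r *\<^sub>R (S + T) = r *\<^sub>R S + r *\<^sub>R T" by transfer (simp add: algebra_simps)
  show "(r + s) *\<^sub>R T = r *\<^sub>R T + s *\<^sub>R T" by transfer (simp add: algebra_simps)
  show "r *\<^sub>R s *\<^sub>R T = (r * s) *\<^sub>R T" by transfer simp
  show "1 *\<^sub>R T = T" by transfer simp
  show "norm T = 0 \<longleftrightarrow> T = 0" by transfer simp
  show "norm (S + T) \<le> norm S + norm T" by transfer (rule norm_triangle_ineq)
  show "norm (r *\<^sub>R T) = \<bar>r\<bar> * norm T" by transfer simp
qed (simp_all add: dist_bop_def sgn_bop_def uniformity_bop_def open_bop_def)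

end

instantiation bop :: (complex_hilbert) star_algebra
begin

lift_definition times_bop :: "'a bop \<Rightarrow> 'a bop \<Rightarrow> 'a bop" is "(o\<^sub>L)"
  by simp

lift_definition scaleC_bop :: "complex \<Rightarrow> 'a bop \<Rightarrow> 'a bop"
  is "\<lambda>c T. Blinfun (\<lambda>x. c *\<^sub>C x) o\<^sub>L T"
  by (simp add: bounded_linear_Blinfun_apply bounded_linear_scaleC scaleC_scaleC mult.commute)

text \<open>The Hilbert space adjoint; existence and uniqueness are the Riesz representation theorem.\<close>

definition star_bop :: "'a bop \<Rightarrow> 'a bop"
  where "star_bop T = (THE S. \<forall>x y. cinner (bop_apply T x) y = cinner x (bop_apply S y))"

instance
proof
  fix S T U :: "'a bop" and c d :: complex and r :: real
  show "S * T * U = S * (T * U)"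
    by transfer (rule blinfun_eqI, simp)
  show "(S + T) * U = S * U + T * U"
    by transfer (rule blinfun_eqI, simp add: blinfun.add_left)
  show "S * (T + U) = S * T + S * U"
    by transfer (rule blinfun_eqI, simp add: blinfun.add_left blinfun.add_right)
  show "c *\<^sub>C (S + T) = c *\<^sub>C S + c *\<^sub>C T"
    by transfer (rule blinfun_eqI, simp add: bounded_linear_Blinfun_apply bounded_linear_scaleC
        blinfun.add_left scaleC_add_right)
  show "(c + d) *\<^sub>C T = c *\<^sub>C T + d *\<^sub>C T"
    by transfer (rule blinfun_eqI, simp add: bounded_linear_Blinfun_apply bounded_linear_scaleC
        blinfun.add_left scaleC_add_left)
  show "c *\<^sub>C d *\<^sub>C T = (c * d) *\<^sub>C T"
    by transfer (rule blinfun_eqI, simp add: bounded_linear_Blinfun_apply bounded_linear_scaleC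
        scaleC_scaleC)
  show "complex_of_real r *\<^sub>C T = r *\<^sub>R T"
    by transfer (rule blinfun_eqI, simp add: bounded_linear_Blinfun_apply bounded_linear_scaleC
        scaleC_of_real blinfun.scaleR_left)
  show "(c *\<^sub>C S) * T = c *\<^sub>C (S * T)"
    by transfer (rule blinfun_eqI, simp)
  show "S * (c *\<^sub>C T) = c *\<^sub>C (S * T)"
    by transfer (rule blinfun_eqI, simp add: bounded_linear_Blinfun_apply bounded_linear_scaleC)
qed

end


section \<open>Operator algebras\<close>

definition subalgebra :: "'a::complex_algebra set \<Rightarrow> bool"
  where "subalgebra A \<longleftrightarrow> 0 \<in> A \<and> (\<forall>a\<in>A. \<forall>b\<in>A. a + b \<in> A \<and> a * b \<in> A) \<and> (\<forall>c. \<forall>a\<in>A. c *\<^sub>C a \<in> A)"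

text \<open>The real span below is a complex subspace, since the spanning set is stable under
  complex scalars.\<close>

definition nondegenerate :: "'a::complex_hilbert bop set \<Rightarrow> bool"
  where "nondegenerate A \<longleftrightarrow> closure (span {bop_apply a x |a x. a \<in> A}) = UNIV"

definition operator_algebra :: "'a::complex_hilbert bop set \<Rightarrow> bool"
  where "operator_algebra A \<longleftrightarrow> subalgebra A \<and> closed A \<and> nondegenerate A"

definition is_unit_of :: "'a::times \<Rightarrow> 'a set \<Rightarrow> bool"
  where "is_unit_of e A \<longleftrightarrow> e \<in> A \<and> (\<forall>a\<in>A. e * a = a \<and> a * e = a)"

definition unital :: "'a::times set \<Rightarrow> bool"
  where "unital A \<longleftrightarrow> (\<exists>e. is_unit_of e A)"

definition unit_of :: "'a::times set \<Rightarrow> 'a"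
  where "unit_of A = (THE e. is_unit_of e A)"

definition diag_algebra :: "'a::star set \<Rightarrow> 'a set"
  where "diag_algebra A = A \<inter> star ` A"

definition matrices_over :: "nat \<Rightarrow> nat \<Rightarrow> 'a set \<Rightarrow> 'a mat set"
  where "matrices_over m n A = {M \<in> carrier_mat m n. elements_mat M \<subseteq> A}"

text \<open>The norm of an \<open>m \<times> n\<close> matrix of operators on \<open>H\<close>, as an operator from the Hilbert
  space direct sum of \<open>n\<close> copies of \<open>H\<close> to that of \<open>m\<close> copies.\<close>

definition opmat_norm :: "'a::complex_hilbert bop mat \<Rightarrow> real"
  where "opmat_norm M =
    (SUP x \<in> {x :: nat \<Rightarrow> 'a. (\<Sum>j<dim_col M. (norm (x j))\<^sup>2) \<le> 1}.
      sqrt (\<Sum>i<dim_row M. (norm (\<Sum>j<dim_col M. bop_apply (M $$ (i, j)) (x j)))\<^sup>2))"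

definition completely_isometric_on ::
    "'a::complex_hilbert bop set \<Rightarrow> ('a bop \<Rightarrow> 'b::complex_hilbert bop) \<Rightarrow> bool"
  where "completely_isometric_on A \<phi> \<longleftrightarrow>
    (\<forall>n. \<forall>M \<in> matrices_over n n A. opmat_norm (map_mat \<phi> M) = opmat_norm M)"

definition algebra_iso ::
    "'a::complex_algebra set \<Rightarrow> 'b::complex_algebra set \<Rightarrow> ('a \<Rightarrow> 'b) \<Rightarrow> bool"
  where "algebra_iso A B \<phi> \<longleftrightarrow> bij_betw \<phi> A B \<and>
    (\<forall>a\<in>A. \<forall>b\<in>A. \<phi> (a + b) = \<phi> a + \<phi> b \<and> \<phi> (a * b) = \<phi> a * \<phi> b) \<and>
    (\<forall>c. \<forall>a\<in>A. \<phi> (c *\<^sub>C a) = c *\<^sub>C \<phi> a)"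

definition completely_isometrically_isomorphic ::
    "'a::complex_hilbert bop set \<Rightarrow> 'b::complex_hilbert bop set \<Rightarrow> bool"
  where "completely_isometrically_isomorphic A B \<longleftrightarrow>
    (\<exists>\<phi>. algebra_iso A B \<phi> \<and> completely_isometric_on A \<phi>)"


section \<open>Square-summable sequences\<close>

typedef (overloaded) 'a l2 = "{f :: nat \<Rightarrow> 'a::real_normed_vector. summable (\<lambda>n. (norm (f n))\<^sup>2)}"
  morphisms l2_nth Abs_l2
  by (rule exI[of _ "\<lambda>_. 0"]) simp

setup_lifting type_definition_l2

text \<open>For a Hilbert space \<open>H\<close>, the type \<open>H l2\<close> is the Hilbert space of square-summable sequences
  in \<open>H\<close>; in particular \<^typ>\<open>complex l2\<close> is the usual infinite-dimensional separable Hilbert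
  space. \<open>H l2\<close> serves as the Hilbert space tensor product of \<open>H\<close> and \<^typ>\<open>complex l2\<close>.\<close>

lemma summable_l2: "summable (\<lambda>n. (norm (l2_nth f n))\<^sup>2)"
  using l2_nth[of f] by simp

lemma l2_eqI: "(\<And>n. l2_nth f n = l2_nth g n) \<Longrightarrow> f = g"
  by (simp add: l2_nth_inject[symmetric] fun_eq_iff)

lemma summable_norm_prod:
  fixes f g :: "nat \<Rightarrow> 'a::real_normed_vector"
  assumes "summable (\<lambda>n. (norm (f n))\<^sup>2)" "summable (\<lambda>n. (norm (g n))\<^sup>2)"
  shows "summable (\<lambda>n. norm (f n) * norm (g n))"
proof (rule summable_comparison_test')
  show "summable (\<lambda>n. (norm (f n))\<^sup>2 + (norm (g n))\<^sup>2)"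
    using assms by (rule summable_add)
  fix n
  have "2 * (norm (f n) * norm (g n)) \<le> (norm (f n))\<^sup>2 + (norm (g n))\<^sup>2"
    using sum_squares_bound[of "norm (f n)" "norm (g n)"] by simp
  moreover have "0 \<le> norm (f n) * norm (g n)"
    by simp
  ultimately have "norm (f n) * norm (g n) \<le> (norm (f n))\<^sup>2 + (norm (g n))\<^sup>2"
    by linarith
  then show "norm (norm (f n) * norm (g n)) \<le> (norm (f n))\<^sup>2 + (norm (g n))\<^sup>2"
    by simp
qed

lemma summable_l2_add:
  fixes f g :: "nat \<Rightarrow> 'a::real_normed_vector"
  assumes "summable (\<lambda>n. (norm (f n))\<^sup>2)" "summable (\<lambda>n. (norm (g n))\<^sup>2)"
  shows "summable (\<lambda>n. (norm (f n + g n))\<^sup>2)"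
proof (rule summable_comparison_test')
  show "summable (\<lambda>n. (norm (f n))\<^sup>2 + 2 * (norm (f n) * norm (g n)) + (norm (g n))\<^sup>2)"
    using assms summable_norm_prod[OF assms] by (intro summable_add summable_mult)
  fix n
  have "(norm (f n + g n))\<^sup>2 \<le> (norm (f n) + norm (g n))\<^sup>2"
    by (intro power_mono norm_triangle_ineq norm_ge_zero)
  then show "norm ((norm (f n + g n))\<^sup>2) \<le> (norm (f n))\<^sup>2 + 2 * (norm (f n) * norm (g n)) + (norm (g n))\<^sup>2"
    by (simp add: power2_sum algebra_simps)
qed

lemma summable_l2_uminus:
  fixes f :: "nat \<Rightarrow> 'a::real_normed_vector"
  shows "summable (\<lambda>n. (norm (f n))\<^sup>2) \<Longrightarrow> summable (\<lambda>n. (norm (- f n))\<^sup>2)"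
  by simp

lemma summable_inner_l2:
  fixes f g :: "nat \<Rightarrow> 'a::complex_hilbert"
  assumes "summable (\<lambda>n. (norm (f n))\<^sup>2)" "summable (\<lambda>n. (norm (g n))\<^sup>2)"
  shows "summable (\<lambda>n. inner (f n) (g n))"
  by (rule summable_comparison_test'[OF summable_norm_prod[OF assms]])
    (simp add: Cauchy_Schwarz_ineq2)

lemma norm_cinner_le: "cmod (cinner x y) \<le> norm (x :: 'a::complex_hilbert) * norm y"
proof (cases "cinner x y = 0")
  case False
  define c where "c = cnj (cinner x y) / complex_of_real (cmod (cinner x y))"
  have c: "cmod c = 1"
    using False by (simp add: c_def norm_divide)
  have "cinner (c *\<^sub>C x) y = complex_of_real (cmod (cinner x y))"
    using False
    by (simp add: cinner_scaleC_left c_def mult.commute complex_norm_square[symmetric] power2_eq_square)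
  then have "cmod (cinner x y) = inner (c *\<^sub>C x) y"
    by (simp flip: Re_cinner)
  also have "\<dots> \<le> norm (c *\<^sub>C x) * norm y"
    by (rule norm_cauchy_schwarz)
  finally show ?thesis
    by (simp add: norm_scaleC c)
qed simp

lemma summable_cinner_l2:
  fixes f g :: "nat \<Rightarrow> 'a::complex_hilbert"
  assumes "summable (\<lambda>n. (norm (f n))\<^sup>2)" "summable (\<lambda>n. (norm (g n))\<^sup>2)"
  shows "summable (\<lambda>n. cinner (f n) (g n))"
  by (rule summable_comparison_test'[OF summable_norm_prod[OF assms]])
    (simp add: norm_cinner_le)

instantiation l2 :: (complex_hilbert) real_inner
begin

lift_definition zero_l2 :: "'a l2" is "\<lambda>_. 0"
  by simp

lift_definition plus_l2 :: "'a l2 \<Rightarrow> 'a l2 \<Rightarrow> 'a l2" is "\<lambda>f g n. f n + g n"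
  by (rule summable_l2_add)

lift_definition uminus_l2 :: "'a l2 \<Rightarrow> 'a l2" is "\<lambda>f n. - f n"
  by simp

lift_definition minus_l2 :: "'a l2 \<Rightarrow> 'a l2 \<Rightarrow> 'a l2" is "\<lambda>f g n. f n - g n"
  subgoal for f g
    using summable_l2_add[of f "\<lambda>n. - g n"] by simp
  done

lift_definition scaleR_l2 :: "real \<Rightarrow> 'a l2 \<Rightarrow> 'a l2" is "\<lambda>r f n. r *\<^sub>R f n"
  by (simp add: power_mult_distrib summable_mult)

lift_definition inner_l2 :: "'a l2 \<Rightarrow> 'a l2 \<Rightarrow> real" is "\<lambda>f g. \<Sum>n. inner (f n) (g n)" .

definition norm_l2 :: "'a l2 \<Rightarrow> real"
  where "norm_l2 f = sqrt (inner f f)"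

definition dist_l2 :: "'a l2 \<Rightarrow> 'a l2 \<Rightarrow> real"
  where "dist_l2 f g = norm (f - g)"

definition sgn_l2 :: "'a l2 \<Rightarrow> 'a l2"
  where "sgn_l2 f = inverse (norm f) *\<^sub>R f"

definition uniformity_l2 :: "('a l2 \<times> 'a l2) filter"
  where "uniformity_l2 = (INF e\<in>{0 <..}. principal {(f, g). dist f g < e})"

definition open_l2 :: "'a l2 set \<Rightarrow> bool"
  where "open_l2 U = (\<forall>f\<in>U. \<forall>\<^sub>F (f', g) in uniformity. f' = f \<longrightarrow> g \<in> U)"

instance
proof
  fix f g h :: "'a l2" and r s :: real
  show "f + g + h = f + (g + h)" by transfer (simp add: algebra_simps)
  show "f + g = g + f" by transfer (simp add: algebra_simps)
  show "0 + f = f" by transfer simp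
  show "- f + f = 0" by transfer simp
  show "f - g = f + - g" by transfer simp
  show "r *\<^sub>R (f + g) = r *\<^sub>R f + r *\<^sub>R g" by transfer (simp add: algebra_simps)
  show "(r + s) *\<^sub>R f = r *\<^sub>R f + s *\<^sub>R f" by transfer (simp add: algebra_simps)
  show "r *\<^sub>R s *\<^sub>R f = (r * s) *\<^sub>R f" by transfer simp
  show "1 *\<^sub>R f = f" by transfer simp
  show "inner f g = inner g f" by transfer (simp add: inner_commute)
  show "inner (f + g) h = inner f h + inner g h"
    by transfer (simp add: inner_add_left suminf_add summable_inner_l2)
  show "inner (r *\<^sub>R f) g = r * inner f g"
    by transfer (simp add: suminf_mult summable_inner_l2)
  show "0 \<le> inner f f"
    by transfer (simp add: suminf_nonneg summable_inner_l2)
  show "inner f f = 0 \<longleftrightarrow> f = 0"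
    by transfer (simp add: suminf_eq_zero_iff summable_inner_l2 fun_eq_iff)
qed (simp_all add: dist_l2_def sgn_l2_def uniformity_l2_def open_l2_def norm_l2_def)

end

lemma l2_nth_simps [simp]:
  "l2_nth 0 n = 0" "l2_nth (f + g) n = l2_nth f n + l2_nth g n"
  "l2_nth (f - g) n = l2_nth f n - l2_nth g n" "l2_nth (r *\<^sub>R f) n = r *\<^sub>R l2_nth f n"
  by (transfer; simp)+

lemma norm_l2_sq: "(norm f)\<^sup>2 = (\<Sum>n. (norm (l2_nth f n))\<^sup>2)" for f :: "'a::complex_hilbert l2"
  unfolding power2_norm_eq_inner by transfer simp

lemma sum_norm_l2_le: "(\<Sum>n<m. (norm (l2_nth f n))\<^sup>2) \<le> (norm f)\<^sup>2" for f :: "'a::complex_hilbert l2"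
  unfolding norm_l2_sq by (rule sum_le_suminf) (auto simp: summable_l2)

lemma norm_l2_nth_le: "norm (l2_nth f n) \<le> norm f" for f :: "'a::complex_hilbert l2"
proof -
  have "(norm (l2_nth f n))\<^sup>2 \<le> (\<Sum>k<Suc n. (norm (l2_nth f k))\<^sup>2)"
    by (simp add: sum_nonneg)
  then have "(norm (l2_nth f n))\<^sup>2 \<le> (norm f)\<^sup>2"
    using sum_norm_l2_le[of f "Suc n"] by linarith
  then show ?thesis
    by (rule power2_le_imp_le) simp
qed

instance l2 :: (complex_hilbert) complete_space
proof
  fix X :: "nat \<Rightarrow> 'a l2"
  assume X: "Cauchy X"
  have "Cauchy (\<lambda>k. l2_nth (X k) n)" for n
  proof (rule metric_CauchyI)
    fix e :: real assume "0 < e"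
    then obtain M where M: "\<And>j k. j \<ge> M \<Longrightarrow> k \<ge> M \<Longrightarrow> dist (X j) (X k) < e"
      using X by (meson metric_CauchyD)
    have "dist (l2_nth (X j) n) (l2_nth (X k) n) \<le> dist (X j) (X k)" for j k
      using norm_l2_nth_le[of "X j - X k" n] by (simp add: dist_norm)
    then show "\<exists>M. \<forall>j\<ge>M. \<forall>k\<ge>M. dist (l2_nth (X j) n) (l2_nth (X k) n) < e"
      using M by (meson le_less_trans)
  qed
  then have "\<forall>n. \<exists>y. (\<lambda>k. l2_nth (X k) n) \<longlonglongrightarrow> y"
    by (simp add: Cauchy_convergent_iff convergent_def)
  then obtain f where f: "\<And>n. (\<lambda>k. l2_nth (X k) n) \<longlonglongrightarrow> f n"
    by metis
  have tail: "\<exists>M. \<forall>j\<ge>M. \<forall>m. (\<Sum>n<m. (norm (l2_nth (X j) n - f n))\<^sup>2) \<le> e\<^sup>2" if e: "0 < e" for e :: real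
  proof -
    obtain M where M: "\<And>j k. j \<ge> M \<Longrightarrow> k \<ge> M \<Longrightarrow> dist (X j) (X k) < e"
      using X e by (meson metric_CauchyD)
    have "(\<Sum>n<m. (norm (l2_nth (X j) n - f n))\<^sup>2) \<le> e\<^sup>2" if j: "j \<ge> M" for j m
    proof (rule tendsto_upperbound)
      show "(\<lambda>k. \<Sum>n<m. (norm (l2_nth (X j) n - l2_nth (X k) n))\<^sup>2)
          \<longlonglongrightarrow> (\<Sum>n<m. (norm (l2_nth (X j) n - f n))\<^sup>2)"
        by (intro tendsto_sum tendsto_power tendsto_norm tendsto_diff tendsto_const f)
      show "\<forall>\<^sub>F k in sequentially. (\<Sum>n<m. (norm (l2_nth (X j) n - l2_nth (X k) n))\<^sup>2) \<le> e\<^sup>2"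
      proof (rule eventually_sequentiallyI[of M])
        fix k assume "M \<le> k"
        then have "(norm (X j - X k))\<^sup>2 \<le> e\<^sup>2"
          using M[OF j, of k] by (intro power_mono) (auto simp: dist_norm)
        then show "(\<Sum>n<m. (norm (l2_nth (X j) n - l2_nth (X k) n))\<^sup>2) \<le> e\<^sup>2"
          using sum_norm_l2_le[of "X j - X k" m] by simp
      qed
    qed simp
    then show ?thesis by blast
  qed
  have summable_diff: "summable (\<lambda>n. (norm (l2_nth (X j) n - f n))\<^sup>2)"
    if "\<forall>m. (\<Sum>n<m. (norm (l2_nth (X j) n - f n))\<^sup>2) \<le> e\<^sup>2" for j and e :: real
    by (rule summableI_nonneg_bounded[OF _ that[rule_format]]) simp
  have "0 < (1 :: real)" by simp
  from tail[OF this] obtain M0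
    where M0: "\<And>m. (\<Sum>n<m. (norm (l2_nth (X M0) n - f n))\<^sup>2) \<le> 1\<^sup>2"
    by blast
  have "summable (\<lambda>n. (norm (- (l2_nth (X M0) n - f n)))\<^sup>2)"
    by (intro summable_l2_uminus summable_diff[of M0 1] allI M0)
  then have "summable (\<lambda>n. (norm (l2_nth (X M0) n + - (l2_nth (X M0) n - f n)))\<^sup>2)"
    by (rule summable_l2_add[OF summable_l2])
  then have Lf: "l2_nth (Abs_l2 f) = f"
    by (simp add: Abs_l2_inverse)
  have "X \<longlonglongrightarrow> Abs_l2 f"
  proof (rule metric_LIMSEQ_I)
    fix e :: real assume e: "0 < e"
    then obtain M where M: "\<And>j m. j \<ge> M \<Longrightarrow> (\<Sum>n<m. (norm (l2_nth (X j) n - f n))\<^sup>2) \<le> (e / 2)\<^sup>2"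
      using tail[of "e / 2"] half_gt_zero[OF e] by blast
    have "dist (X j) (Abs_l2 f) < e" if j: "j \<ge> M" for j
    proof -
      have "(norm (X j - Abs_l2 f))\<^sup>2 \<le> (e / 2)\<^sup>2"
        unfolding norm_l2_sq l2_nth_simps Lf
        by (intro suminf_le_const summable_diff[of j "e / 2"] allI M j)
      then have "norm (X j - Abs_l2 f) \<le> e / 2"
        by (rule power2_le_imp_le) (use e in simp)
      then show ?thesis
        using e by (simp add: dist_norm)
    qed
    then show "\<exists>M. \<forall>j\<ge>M. dist (X j) (Abs_l2 f) < e"
      by blast
  qed
  then show "convergent X"
    by (rule convergentI)
qed

instantiation l2 :: (complex_hilbert) complex_hilbert
begin

lift_definition scaleC_l2 :: "complex \<Rightarrow> 'a l2 \<Rightarrow> 'a l2" is "\<lambda>c f n. c *\<^sub>C f n"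
  by (simp add: norm_scaleC power_mult_distrib summable_mult)

lift_definition cinner_l2 :: "'a l2 \<Rightarrow> 'a l2 \<Rightarrow> complex" is "\<lambda>f g. \<Sum>n. cinner (f n) (g n)" .

instance
proof
  fix f g h :: "'a l2" and c d :: complex and r :: real
  show "c *\<^sub>C (f + g) = c *\<^sub>C f + c *\<^sub>C g" by transfer (simp add: scaleC_add_right)
  show "(c + d) *\<^sub>C f = c *\<^sub>C f + d *\<^sub>C f" by transfer (simp add: scaleC_add_left)
  show "c *\<^sub>C d *\<^sub>C f = (c * d) *\<^sub>C f" by transfer (simp add: scaleC_scaleC)
  show "complex_of_real r *\<^sub>C f = r *\<^sub>R f" by transfer (simp add: scaleC_of_real)
  show "cinner f g = cnj (cinner g f)"
  proof transfer
    fix f g :: "nat \<Rightarrow> 'a"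
    assume "summable (\<lambda>n. (norm (f n))\<^sup>2)" "summable (\<lambda>n. (norm (g n))\<^sup>2)"
    then have "(\<lambda>n. cnj (cinner (g n) (f n))) sums cnj (\<Sum>n. cinner (g n) (f n))"
      by (simp add: sums_cnj summable_sums summable_cinner_l2)
    then show "(\<Sum>n. cinner (f n) (g n)) = cnj (\<Sum>n. cinner (g n) (f n))"
      by (simp add: sums_iff flip: cinner_commute)
  qed
  show "cinner (f + g) h = cinner f h + cinner g h"
    by transfer (simp add: cinner_add_left suminf_add summable_cinner_l2)
  show "cinner (c *\<^sub>C f) g = c * cinner f g"
    by transfer (simp add: cinner_scaleC_left suminf_mult summable_cinner_l2)
  show "Re (cinner f g) = inner f g"
    by transfer (simp add: Re_suminf summable_cinner_l2 Re_cinner)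
qed

end


section \<open>Stabilization\<close>

text \<open>The elementary tensor of vectors is the sequence whose \<open>n\<close>-th entry is the \<open>n\<close>-th
  coordinate of \<open>\<xi>\<close> times \<open>x\<close>. The two lemmas \<open>cinner_tensor_vec\<close> and \<open>tensor_vec_total\<close> say
  that this makes \<open>H l2\<close> the Hilbert space tensor product of \<open>H\<close> and \<^typ>\<open>complex l2\<close>.\<close>

lift_definition tensor_vec :: "'a::complex_hilbert \<Rightarrow> complex l2 \<Rightarrow> 'a l2"
  is "\<lambda>x \<xi> n. \<xi> n *\<^sub>C x"
  by (simp add: norm_scaleC power_mult_distrib summable_mult2)

lemma cinner_tensor_vec:
  "cinner (tensor_vec x \<xi>) (tensor_vec y \<eta>) = cinner x y * cinner \<xi> \<eta>"
proof transfer
  fix x y :: 'a and \<xi> \<eta> :: "nat \<Rightarrow> complex"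
  assume "summable (\<lambda>n. (norm (\<xi> n))\<^sup>2)" "summable (\<lambda>n. (norm (\<eta> n))\<^sup>2)"
  moreover have "cinner (\<xi> n *\<^sub>C x) (\<eta> n *\<^sub>C y) = cinner x y * cinner (\<xi> n) (\<eta> n)" for n
  proof -
    have "cinner x (\<eta> n *\<^sub>C y) = cnj (\<eta> n) * cinner x y"
      by (metis cinner_commute cinner_scaleC_left complex_cnj_mult)
    then show ?thesis
      by (simp add: cinner_scaleC_left cinner_complex_def)
  qed
  ultimately show "(\<Sum>n. cinner (\<xi> n *\<^sub>C x) (\<eta> n *\<^sub>C y)) = cinner x y * (\<Sum>n. cinner (\<xi> n) (\<eta> n))"
    by (simp add: suminf_mult summable_cinner_l2)
qed

lemma tensor_vec_total:
  "closure (span {tensor_vec x \<xi> |x \<xi>. True}) = (UNIV :: 'a::complex_hilbert l2 set)"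
proof -
  let ?S = "span {tensor_vec x \<xi> |x \<xi>. True} :: 'a l2 set"
  define e :: "nat \<Rightarrow> complex l2" where "e k = Abs_l2 (\<lambda>n. if n = k then 1 else 0)" for k
  have e: "l2_nth (e k) n = (if n = k then 1 else 0)" for k n
  proof -
    have "summable (\<lambda>n. (norm (if n = k then 1 else 0 :: complex))\<^sup>2)"
      by (rule summable_finite[of "{k}"]) auto
    then show ?thesis
      by (simp add: e_def Abs_l2_inverse)
  qed
  have nth: "l2_nth (tensor_vec x \<xi>) n = l2_nth \<xi> n *\<^sub>C x" for x :: 'a and \<xi> n
    by transfer simp
  have "f \<in> closure ?S" for f
  proof -
    define p where "p m = (\<Sum>k<m. tensor_vec (l2_nth f k) (e k))" for m
    have nth_p: "l2_nth (p m) n = (if n < m then l2_nth f n else 0)" for m n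
      unfolding p_def by (induction m) (auto simp: nth e less_Suc_eq)
    have "p m \<in> ?S" for m
      unfolding p_def by (rule span_sum, rule span_base) blast
    moreover have "p \<longlonglongrightarrow> f"
    proof -
      let ?a = "\<lambda>n. (norm (l2_nth f n))\<^sup>2"
      have "(norm (f - p m))\<^sup>2 = (\<Sum>n. ?a n) - (\<Sum>n<m. ?a n)" for m
      proof -
        have "(\<lambda>n. if n \<in> {..<m} then ?a n else 0) sums (\<Sum>n<m. ?a n)"
          by (rule sums_If_finite_set) simp
        then have "(\<lambda>n. ?a n - (if n \<in> {..<m} then ?a n else 0)) sums ((\<Sum>n. ?a n) - (\<Sum>n<m. ?a n))"
          by (rule sums_diff[OF summable_sums[OF summable_l2]])
        also have "(\<lambda>n. ?a n - (if n \<in> {..<m} then ?a n else 0)) = (\<lambda>n. (norm (l2_nth (f - p m) n))\<^sup>2)"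
          by (rule ext) (simp add: nth_p)
        finally show ?thesis
          unfolding norm_l2_sq by (rule sums_unique[symmetric])
      qed
      moreover have "(\<lambda>m. (\<Sum>n. ?a n) - (\<Sum>n<m. ?a n)) \<longlonglongrightarrow> (\<Sum>n. ?a n) - (\<Sum>n. ?a n)"
        by (intro tendsto_diff tendsto_const summable_LIMSEQ summable_l2)
      ultimately have "(\<lambda>m. (norm (f - p m))\<^sup>2) \<longlonglongrightarrow> 0"
        by simp
      then have "(\<lambda>m. sqrt ((norm (f - p m))\<^sup>2)) \<longlonglongrightarrow> sqrt 0"
        by (rule tendsto_real_sqrt)
      then have "(\<lambda>m. dist (p m) f) \<longlonglongrightarrow> 0"
        by (simp only: dist_norm norm_minus_commute[of _ f] real_sqrt_abs abs_norm_cancel real_sqrt_zero)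
      then show ?thesis
        by (simp only: tendsto_dist_iff[of p])
    qed
    ultimately have "\<exists>q. (\<forall>m. q m \<in> ?S) \<and> q \<longlonglongrightarrow> f"
      by (intro exI[of _ p] conjI allI)
    then show ?thesis
      by (simp only: closure_sequential)
  qed
  then have "UNIV \<subseteq> closure ?S"
    by (intro subsetI)
  then show ?thesis
    by (simp only: top.extremum_unique)
qed

text \<open>The elementary tensor of operators is the unique bounded operator acting as expected on
  elementary tensors of vectors.\<close>

definition tensor_op :: "'a::complex_hilbert bop \<Rightarrow> complex l2 bop \<Rightarrow> 'a l2 bop"
  where "tensor_op S T =
    (THE R. \<forall>x \<xi>. bop_apply R (tensor_vec x \<xi>) = tensor_vec (bop_apply S x) (bop_apply T \<xi>))"

definition closed_algebra_generated :: "'a::complex_hilbert bop set \<Rightarrow> 'a bop set"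
  where "closed_algebra_generated G = \<Inter> {B. G \<subseteq> B \<and> subalgebra B \<and> closed B}"

definition spatial_tensor ::
    "'a::complex_hilbert bop set \<Rightarrow> complex l2 bop set \<Rightarrow> 'a l2 bop set" (infixl "\<otimes>\<^sub>s\<^sub>p" 70)
  where "A \<otimes>\<^sub>s\<^sub>p B = closed_algebra_generated {tensor_op a b |a b. a \<in> A \<and> b \<in> B}"

definition compact_operators :: "complex l2 bop set" ("\<K>")
  where "\<K> = {T. compact (closure (bop_apply T ` cball 0 1))}"


section \<open>Unitization\<close>

text \<open>The algebra of pairs \<open>a + \<lambda>1\<close> with the unit adjoined formally, also if there is one already.
  Only its \<open>*\<close>-algebra structure is recorded: the \<open>C*\<close>-norm is determined by it, and it does not
  enter into Murray-von Neumann equivalence.\<close>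

datatype 'a unitized = Unitized (alg_part: 'a) (scalar_part: complex)

instantiation unitized :: (star_algebra) star_algebra
begin

definition zero_unitized :: "'a unitized"
  where "zero_unitized = Unitized 0 0"

fun plus_unitized :: "'a unitized \<Rightarrow> 'a unitized \<Rightarrow> 'a unitized"
  where "plus_unitized (Unitized a s) (Unitized b t) = Unitized (a + b) (s + t)"

fun minus_unitized :: "'a unitized \<Rightarrow> 'a unitized \<Rightarrow> 'a unitized"
  where "minus_unitized (Unitized a s) (Unitized b t) = Unitized (a - b) (s - t)"

fun uminus_unitized :: "'a unitized \<Rightarrow> 'a unitized"
  where "uminus_unitized (Unitized a s) = Unitized (- a) (- s)"

fun times_unitized :: "'a unitized \<Rightarrow> 'a unitized \<Rightarrow> 'a unitized"
  where "times_unitized (Unitized a s) (Unitized b t) =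
    Unitized (a * b + s *\<^sub>C b + t *\<^sub>C a) (s * t)"

fun scaleR_unitized :: "real \<Rightarrow> 'a unitized \<Rightarrow> 'a unitized"
  where "scaleR_unitized r (Unitized a s) = Unitized (r *\<^sub>R a) (r *\<^sub>R s)"

fun scaleC_unitized :: "complex \<Rightarrow> 'a unitized \<Rightarrow> 'a unitized"
  where "scaleC_unitized c (Unitized a s) = Unitized (c *\<^sub>C a) (c * s)"

fun star_unitized :: "'a unitized \<Rightarrow> 'a unitized"
  where "star_unitized (Unitized a s) = Unitized (star a) (cnj s)"

instance
proof
  fix x y z :: "'a unitized" and c d :: complex and r s :: real
  show "x + y + z = x + (y + z)"
    by (cases x; cases y; cases z) (simp add: algebra_simps)
  show "x + y = y + x"
    by (cases x; cases y) (simp add: algebra_simps)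
  show "0 + x = x" "- x + x = 0"
    by (cases x; simp add: zero_unitized_def)+
  show "x - y = x + - y"
    by (cases x; cases y) simp
  show "x * y * z = x * (y * z)"
    by (cases x; cases y; cases z)
      (simp add: algebra_simps scaleC_add_right scaleC_scaleC mult_scaleC_left mult_scaleC_right)
  show "(x + y) * z = x * z + y * z" "x * (y + z) = x * y + x * z"
    by (cases x; cases y; cases z; simp add: algebra_simps scaleC_add_left scaleC_add_right)+
  show "r *\<^sub>R (x + y) = r *\<^sub>R x + r *\<^sub>R y"
    by (cases x; cases y) (simp add: algebra_simps)
  show "(r + s) *\<^sub>R x = r *\<^sub>R x + s *\<^sub>R x" "r *\<^sub>R s *\<^sub>R x = (r * s) *\<^sub>R x" "1 *\<^sub>R x = x"
    by (cases x; simp add: algebra_simps)+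
  show "c *\<^sub>C (x + y) = c *\<^sub>C x + c *\<^sub>C y"
    by (cases x; cases y) (simp add: algebra_simps scaleC_add_right)
  show "(c + d) *\<^sub>C x = c *\<^sub>C x + d *\<^sub>C x" "c *\<^sub>C d *\<^sub>C x = (c * d) *\<^sub>C x"
    "complex_of_real r *\<^sub>C x = r *\<^sub>R x"
    by (cases x; simp add: algebra_simps scaleC_add_left scaleC_scaleC scaleC_of_real
        scaleR_conv_of_real)+
  show "(c *\<^sub>C x) * y = c *\<^sub>C (x * y)" "x * (c *\<^sub>C y) = c *\<^sub>C (x * y)"
    by (cases x; cases y; simp add: algebra_simps scaleC_add_right scaleC_scaleC
        mult_scaleC_left mult_scaleC_right)+
qed

end

definition unitization :: "'a::star_algebra set \<Rightarrow> 'a unitized set"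
  where "unitization C = {x. alg_part x \<in> C}"


section \<open>The semigroup of projections and \<open>K\<^sub>0\<close>\<close>

definition mat_star :: "'a::star mat \<Rightarrow> 'a mat"
  where "mat_star M = map_mat star (transpose_mat M)"

text \<open>The \<open>0 \<times> 0\<close> matrix is admitted; it is equivalent to every zero matrix.\<close>

definition mat_projections :: "'a::star_algebra set \<Rightarrow> 'a mat set"
  where "mat_projections C =
    {p. \<exists>n. p \<in> matrices_over n n C \<and> mat_star p = p \<and> p * p = p}"

definition murray_von_neumann :: "'a::star_algebra set \<Rightarrow> 'a mat rel"
  where "murray_von_neumann C =
    {(p, q). p \<in> mat_projections C \<and> q \<in> mat_projections C \<and>
      (\<exists>v \<in> matrices_over (dim_row q) (dim_row p) C. mat_star v * v = p \<and> v * mat_star v = q)}"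

definition direct_sum_mat :: "'a::zero mat \<Rightarrow> 'a mat \<Rightarrow> 'a mat" (infixl "\<oplus>\<^sub>m" 65)
  where "p \<oplus>\<^sub>m q =
    four_block_mat p (0\<^sub>m (dim_row p) (dim_col q)) (0\<^sub>m (dim_row q) (dim_col p)) q"

definition projection_class :: "'a::star_algebra set \<Rightarrow> 'a mat \<Rightarrow> 'a mat set"
  where "projection_class C p = murray_von_neumann C `` {p}"

definition projection_semigroup :: "'a::star_algebra set \<Rightarrow> 'a mat set monoid"
  where "projection_semigroup C = \<lparr>
    carrier = mat_projections C // murray_von_neumann C,
    mult = (\<lambda>X Y. \<Union>p\<in>X. \<Union>q\<in>Y. projection_class C (p \<oplus>\<^sub>m q)),
    one = projection_class C (0\<^sub>m 0 0)\<rparr>"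

definition has_cancellation :: "'a::star_algebra set \<Rightarrow> bool"
  where "has_cancellation C \<longleftrightarrow>
    (let D = projection_semigroup (unitization C) in
      \<forall>x\<in>carrier D. \<forall>y\<in>carrier D. \<forall>z\<in>carrier D. x \<otimes>\<^bsub>D\<^esub> z = y \<otimes>\<^bsub>D\<^esub> z \<longrightarrow> x = y)"

text \<open>The Grothendieck group of a commutative monoid, as formal differences of its elements.\<close>

definition grothendieck_rel :: "('a, 'm) monoid_scheme \<Rightarrow> ('a \<times> 'a) rel"
  where "grothendieck_rel D =
    {((x, y), (x', y')). x \<in> carrier D \<and> y \<in> carrier D \<and> x' \<in> carrier D \<and> y' \<in> carrier D \<and>
      (\<exists>z\<in>carrier D. x \<otimes>\<^bsub>D\<^esub> y' \<otimes>\<^bsub>D\<^esub> z = x' \<otimes>\<^bsub>D\<^esub> y \<otimes>\<^bsub>D\<^esub> z)}"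

definition grothendieck_group :: "('a, 'm) monoid_scheme \<Rightarrow> ('a \<times> 'a) set monoid"
  where "grothendieck_group D = \<lparr>
    carrier = (carrier D \<times> carrier D) // grothendieck_rel D,
    mult = (\<lambda>X Y. \<Union>(x, y)\<in>X. \<Union>(x', y')\<in>Y. grothendieck_rel D `` {(x \<otimes>\<^bsub>D\<^esub> x', y \<otimes>\<^bsub>D\<^esub> y')}),
    one = grothendieck_rel D `` {(\<one>\<^bsub>D\<^esub>, \<one>\<^bsub>D\<^esub>)}\<rparr>"

definition grothendieck_map :: "('a, 'm) monoid_scheme \<Rightarrow> 'a \<Rightarrow> ('a \<times> 'a) set"
  where "grothendieck_map D x = grothendieck_rel D `` {(x, \<one>\<^bsub>D\<^esub>)}"

text \<open>\<open>K\<^sub>0\<close> is only used for unital \<open>C\<close>, where it is the Grothendieck group of the semigroup of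
  projections in matrix algebras over \<open>C\<close> itself.\<close>

definition K0 :: "'a::star_algebra set \<Rightarrow> ('a mat set \<times> 'a mat set) set monoid"
  where "K0 C = grothendieck_group (projection_semigroup C)"

definition K0_class :: "'a::star_algebra set \<Rightarrow> 'a mat \<Rightarrow> ('a mat set \<times> 'a mat set) set"
  where "K0_class C p = grothendieck_map (projection_semigroup C) (projection_class C p)"

definition K0_pos :: "'a::star_algebra set \<Rightarrow> ('a mat set \<times> 'a mat set) set set"
  where "K0_pos C = K0_class C ` mat_projections C"

definition K0_unit :: "'a::star_algebra set \<Rightarrow> ('a mat set \<times> 'a mat set) set"
  where "K0_unit C = K0_class C (mat 1 1 (\<lambda>_. unit_of C))"

text \<open>The isomorphisms of \<open>K\<^sub>0\<close> with the integers that map the positive cone into the nonnegative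
  integers.\<close>

definition K0_identifications ::
    "'a::star_algebra set \<Rightarrow> (('a mat set \<times> 'a mat set) set \<Rightarrow> int) set"
  where "K0_identifications C = {\<theta> \<in> iso (K0 C) integer_group. \<theta> ` K0_pos C \<subseteq> {0..}}"

end

theory Submission
  imports Defs
begin

text \<open>
  The stabilization of \<open>A\<close> is an algebra of infinite operator matrices: \<open>A \<otimes>\<^sub>s\<^sub>p \<K>\<close> consists of
  the operators on square-summable sequences whose entries lie in \<open>A\<close> and which are the norm limit of
  their upper left corners (\<open>spatial_tensor_compact\<close>). In this picture a complete isometry of \<open>A\<close>
  onto \<open>B\<close> can be applied entry by entry: on finite corners this preserves norms because the map is
  completely isometric, and limits of corners are then preserved as well (\<open>amplify_iso\<close>).

  For the converse let \<open>\<phi>\<close> be a completely isometric isomorphism of the stabilizations. The unit of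
  \<open>A\<close>, placed in the corner \<open>(0, 0)\<close>, is a projection \<open>e\<close>. If \<open>\<phi> e\<close> is Murray-von Neumann equivalent
  in the stabilization of \<open>B\<close> to the projection that arises in the same way from the unit of \<open>B\<close>, then
  a partial isometry that implements the equivalence carries the corner of \<open>\<phi> e\<close> onto a copy of \<open>B\<close>,
  and \<open>A\<close> and \<open>B\<close> are completely isometrically isomorphic (\<open>corner_isomorphism\<close>).

  That equivalence is a statement about \<open>K\<^sub>0\<close> of the diagonals. First, \<open>\<phi>\<close> respects projections and
  partial isometries together with their adjoints, because a contractive idempotent is selfadjoint and
  contractions that are inverse to each other between ranges of projections are adjoint to each other
  (\<open>contractive_idempotent\<close>, \<open>contractive_inverse_adjoint\<close>). Secondly, a projection \<open>p\<close> of the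
  stabilized diagonal is equivalent to a projection in a matrix algebra over the diagonal: cut \<open>p\<close> off by
  a large corner and take the polar part, which requires only the binomial series of an inverse square
  root (\<open>stab_projection_equiv_matrix\<close>). Hence \<open>\<phi>\<close> induces an additive bijection between the classes of
  projections in matrix algebras over the two diagonals.

  An identification of \<open>K\<^sub>0\<close> with the integers is a nonnegative additive dimension function on
  projections. By cancellation it separates equivalence classes (\<open>K0_dimension\<close>), so that any other
  invariant additive function is proportional to it, and the dimension functions of the two diagonals
  correspond to each other up to a rational factor. As both of them generate the integers and
  neither takes negative values, the factor is one (\<open>dimension_preserved\<close>). So if the two units have
  equal dimension then \<open>\<phi> e\<close> has the dimension of the unit of \<open>B\<close>, and by cancellation the two
  projections are equivalent.
\<close>

section \<open>Inner products and bounded operators\<close>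

lemma convergent_of_tail_bound:
  fixes X :: "nat \<Rightarrow> 'a::banach"
  assumes le: "\<And>m n. m \<le> n \<Longrightarrow> norm (X n - X m) \<le> g m" and g: "g \<longlonglongrightarrow> 0"
  shows "convergent X"
proof -
  have "Cauchy X"
  proof (rule metric_CauchyI)
    fix e :: real assume "e > 0"
    then have "\<forall>\<^sub>F m in sequentially. g m < e / 2"
      by (intro order_tendstoD(2)[OF g]) simp
    then obtain M where M: "g M < e / 2"
      by (auto dest: eventually_happens)
    have "dist (X i) (X M) < e / 2" if "i \<ge> M" for i
      using le[OF that] M by (simp add: dist_norm)
    then have "dist (X i) (X j) < e" if "i \<ge> M" "j \<ge> M" for i j
      using that dist_triangle_half_r by (metis dist_commute)
    then show "\<exists>M. \<forall>i\<ge>M. \<forall>j\<ge>M. dist (X i) (X j) < e" by blast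
  qed
  then show ?thesis
    by (simp add: Cauchy_convergent_iff)
qed

instance complex_hilbert \<subseteq> banach ..

lemma cinner_add_right: "cinner x (y + z) = cinner x y + cinner x z"
  for x :: "'a::complex_hilbert"
  by (metis cinner_add_left cinner_commute complex_cnj_add)

lemma cinner_scaleC_right: "cinner x (c *\<^sub>C y) = cnj c * cinner x y"
  for x :: "'a::complex_hilbert"
  by (metis cinner_commute cinner_scaleC_left complex_cnj_mult)

lemma cinner_zero_left [simp]: "cinner 0 x = 0" for x :: "'a::complex_hilbert"
  using cinner_add_left[of 0 0 x] by simp

lemma cinner_zero_right [simp]: "cinner x 0 = 0" for x :: "'a::complex_hilbert"
  using cinner_add_right[of x 0 0] by simp

lemma cinner_minus_left: "cinner (- x) y = - cinner x y" for x :: "'a::complex_hilbert"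
  using cinner_add_left[of x "- x" y] by (simp add: eq_neg_iff_add_eq_0 add.commute)

lemma cinner_minus_right: "cinner x (- y) = - cinner x y" for x :: "'a::complex_hilbert"
  using cinner_add_right[of x y "- y"] by (simp add: eq_neg_iff_add_eq_0 add.commute)

lemma cinner_diff_left: "cinner (x - y) z = cinner x z - cinner y z" for x :: "'a::complex_hilbert"
  using cinner_add_left[of x "- y" z] by (simp add: cinner_minus_left)

lemma cinner_diff_right: "cinner x (y - z) = cinner x y - cinner x z" for x :: "'a::complex_hilbert"
  using cinner_add_right[of x y "- z"] by (simp add: cinner_minus_right)

lemma cinner_sum_left: "cinner (sum f I) y = (\<Sum>i\<in>I. cinner (f i) y)"
  for f :: "'i \<Rightarrow> 'a::complex_hilbert"
  by (induction I rule: infinite_finite_induct) (auto simp: cinner_add_left)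

lemma cinner_sum_right: "cinner y (sum f I) = (\<Sum>i\<in>I. cinner y (f i))"
  for f :: "'i \<Rightarrow> 'a::complex_hilbert"
  by (induction I rule: infinite_finite_induct) (auto simp: cinner_add_right)

lemma cinner_self: "cinner x x = complex_of_real ((norm x)\<^sup>2)" for x :: "'a::complex_hilbert"
proof (rule complex_eqI)
  show "Re (cinner x x) = Re (complex_of_real ((norm x)\<^sup>2))"
    by (simp add: Re_cinner power2_norm_eq_inner)
  have "Im (cinner x x) = - Im (cinner x x)"
    using cinner_commute[of x x] by (metis cnj.simps(2))
  then show "Im (cinner x x) = Im (complex_of_real ((norm x)\<^sup>2))"
    by simp
qed

lemma cinner_right_eqI:
  fixes y :: "'a::complex_hilbert"
  assumes "\<And>x. cinner x y = cinner x z"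
  shows "y = z"
proof -
  have "cinner (y - z) (y - z) = 0"
    by (simp add: cinner_diff_right[of _ y z] assms)
  then show ?thesis
    by (simp add: cinner_self)
qed

text \<open>Imaginary parts of inner products are real parts after multiplication by \<open>\<i>\<close>.\<close>

lemma cinner_eq_of_inner:
  fixes x y :: "'a::complex_hilbert" and u v :: "'b::complex_hilbert"
  assumes "inner x y = inner u v" and "inner (\<i> *\<^sub>C x) y = inner (\<i> *\<^sub>C u) v"
  shows "cinner x y = cinner u v"
proof (rule complex_eqI)
  show "Re (cinner x y) = Re (cinner u v)"
    using assms(1) by (simp add: Re_cinner)
  have "Re (\<i> * cinner x y) = Re (\<i> * cinner u v)"
    using assms(2) by (simp add: cinner_scaleC_left flip: Re_cinner)
  then show "Im (cinner x y) = Im (cinner u v)"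
    by simp
qed

lemma scaleC_sum_right: "c *\<^sub>C sum f I = (\<Sum>i\<in>I. c *\<^sub>C f i)"
  for f :: "'i \<Rightarrow> 'a::complex_vector"
  by (induction I rule: infinite_finite_induct) (auto simp: scaleC_add_right)

lemma scaleC_sum_left: "sum f I *\<^sub>C x = (\<Sum>i\<in>I. f i *\<^sub>C x)"
  for x :: "'a::complex_vector"
  by (induction I rule: infinite_finite_induct) (auto simp: scaleC_add_left)

lemma scaleC_minus_one: "(- 1) *\<^sub>C x = - (x :: 'a::complex_vector)"
  using scaleC_of_real[of "- 1" x] by simp

lemma bop_eqI: "(\<And>x. bop_apply S x = bop_apply T x) \<Longrightarrow> S = T"
  by transfer (auto intro: blinfun_eqI)

lemma bop_apply_add [simp]: "bop_apply (S + T) x = bop_apply S x + bop_apply T x"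
  by transfer (simp add: blinfun.add_left)

lemma bop_apply_diff [simp]: "bop_apply (S - T) x = bop_apply S x - bop_apply T x"
  by transfer (simp add: blinfun.diff_left)

lemma bop_apply_zero [simp]: "bop_apply 0 x = 0"
  by transfer simp

lemma bop_apply_mult [simp]: "bop_apply (S * T) x = bop_apply S (bop_apply T x)"
  by transfer simp

lemma bop_apply_scaleC [simp]: "bop_apply (c *\<^sub>C T) x = c *\<^sub>C bop_apply T x"
  by transfer (simp add: bounded_linear_Blinfun_apply bounded_linear_scaleC)

lemma bop_apply_scaleR [simp]: "bop_apply (r *\<^sub>R T) x = r *\<^sub>R bop_apply T x"
  by transfer (simp add: blinfun.scaleR_left)

lemma bop_apply_sum [simp]: "bop_apply (sum f I) x = (\<Sum>i\<in>I. bop_apply (f i) x)"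
  by (induction I rule: infinite_finite_induct) auto

lemma bop_apply_add_right: "bop_apply T (x + y) = bop_apply T x + bop_apply T y"
  by transfer (simp add: blinfun.add_right)

lemma bop_apply_diff_right: "bop_apply T (x - y) = bop_apply T x - bop_apply T y"
  by transfer (simp add: blinfun.diff_right)

lemma bop_apply_zero_right [simp]: "bop_apply T 0 = 0"
  by transfer (simp add: blinfun.zero_right)

lemma bop_apply_scaleC_right: "bop_apply T (c *\<^sub>C x) = c *\<^sub>C bop_apply T x"
  by transfer simp

lemma bop_apply_scaleR_right: "bop_apply T (r *\<^sub>R x) = r *\<^sub>R bop_apply T x"
  by (metis bop_apply_scaleC_right scaleC_of_real)

lemma bop_apply_sum_right: "bop_apply T (sum f I) = (\<Sum>i\<in>I. bop_apply T (f i))"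
  by (induction I rule: infinite_finite_induct) (auto simp: bop_apply_add_right)

lemma norm_bop_apply: "norm (bop_apply T x) \<le> norm T * norm x"
  by transfer (rule norm_blinfun)

lemma norm_bop_bound: "(\<And>x. norm (bop_apply T x) \<le> c * norm x) \<Longrightarrow> 0 \<le> c \<Longrightarrow> norm T \<le> c"
  by transfer (rule norm_blinfun_bound)

lemma bounded_linear_bop_apply: "bounded_linear (bop_apply T)"
  by (rule bounded_linear_intro[where K = "norm T"])
    (use norm_bop_apply[of T] in \<open>simp_all add: bop_apply_add_right bop_apply_scaleR_right mult.commute\<close>)

text \<open>Intended for bounded complex linear functions; the value at other functions is arbitrary.\<close>

definition mk_bop :: "('a::complex_hilbert \<Rightarrow> 'a) \<Rightarrow> 'a bop"
  where "mk_bop f = Abs_bop (Blinfun f)"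

lemma mk_bop_apply:
  assumes add: "\<And>x y. f (x + y) = f x + f y" and scaleC: "\<And>c x. f (c *\<^sub>C x) = c *\<^sub>C f x"
    and le: "\<And>x. norm (f x) \<le> K * norm x"
  shows "bop_apply (mk_bop f) x = f x"
proof -
  have "f (r *\<^sub>R x) = r *\<^sub>R f x" for r x
    by (metis scaleC scaleC_of_real)
  then have "bounded_linear f"
    by (intro bounded_linear_intro[where K = K]) (auto simp: add le mult.commute)
  then show ?thesis
    by (simp add: mk_bop_def bop_apply.rep_eq Abs_bop_inverse bounded_linear_Blinfun_apply scaleC)
qed

instantiation bop :: (complex_hilbert) one
begin

lift_definition one_bop :: "'a bop" is id_blinfun
  by simp

instance ..

end

lemma bop_apply_one [simp]: "bop_apply 1 x = x"
  by transfer simp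

instance bop :: (complex_hilbert) monoid_mult
  by standard (auto intro: bop_eqI)

lemma norm_bop_one_le: "norm (1 :: 'a::complex_hilbert bop) \<le> 1"
  by (rule norm_bop_bound) auto

instance bop :: (complex_hilbert) real_normed_algebra
proof
  fix S T :: "'a bop" and r :: real
  show "r *\<^sub>R S * T = r *\<^sub>R (S * T)"
    by (rule bop_eqI) simp
  show "S * r *\<^sub>R T = r *\<^sub>R (S * T)"
    by (rule bop_eqI) (simp add: bop_apply_scaleR_right)
  show "norm (S * T) \<le> norm S * norm T"
  proof (rule norm_bop_bound)
    fix x
    have "norm (bop_apply S (bop_apply T x)) \<le> norm S * norm (bop_apply T x)"
      by (rule norm_bop_apply)
    also have "\<dots> \<le> norm S * (norm T * norm x)"
      by (intro mult_left_mono norm_bop_apply norm_ge_zero)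
    finally show "norm (bop_apply (S * T) x) \<le> norm S * norm T * norm x"
      by (simp add: mult.assoc)
  qed simp
qed

lemma bounded_linear_apply_bop: "bounded_linear (\<lambda>T. bop_apply T x)"
  by (rule bounded_linear_intro[where K = "norm x"]) (auto simp: norm_bop_apply)

lemma tendsto_bop_apply [tendsto_intros]:
  "(F \<longlongrightarrow> T) G \<Longrightarrow> ((\<lambda>n. bop_apply (F n) x) \<longlongrightarrow> bop_apply T x) G"
  by (rule bounded_linear.tendsto[OF bounded_linear_apply_bop])

instance bop :: (complex_hilbert) banach
proof
  fix X :: "nat \<Rightarrow> 'a bop"
  assume X: "Cauchy X"
  have "dist (Rep_bop S) (Rep_bop T) = dist S T" for S T :: "'a bop"
    by (simp add: dist_norm norm_bop.rep_eq minus_bop.rep_eq)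
  with X have "Cauchy (\<lambda>n. Rep_bop (X n))"
    by (simp add: Cauchy_def)
  then obtain L where L: "(\<lambda>n. Rep_bop (X n)) \<longlonglongrightarrow> L"
    by (auto simp: Cauchy_convergent_iff convergent_def)
  have pt: "(\<lambda>n. blinfun_apply (Rep_bop (X n)) x) \<longlonglongrightarrow> blinfun_apply L x" for x
    by (intro tendsto_intros L)
  have "blinfun_apply L (c *\<^sub>C x) = c *\<^sub>C blinfun_apply L x" for c x
  proof (rule LIMSEQ_unique[OF pt])
    have "(\<lambda>n. c *\<^sub>C blinfun_apply (Rep_bop (X n)) x) \<longlonglongrightarrow> c *\<^sub>C blinfun_apply L x"
      by (rule bounded_linear.tendsto[OF bounded_linear_scaleC pt])
    then show "(\<lambda>n. blinfun_apply (Rep_bop (X n)) (c *\<^sub>C x)) \<longlonglongrightarrow> c *\<^sub>C blinfun_apply L x"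
      by (simp add: Rep_bop[simplified])
  qed
  then have "Rep_bop (Abs_bop L) = L"
    by (simp add: Abs_bop_inverse)
  moreover have "dist (X n) (Abs_bop L) = dist (Rep_bop (X n)) (Rep_bop (Abs_bop L))" for n
    by (simp add: dist_norm norm_bop.rep_eq minus_bop.rep_eq)
  ultimately have "(\<lambda>n. dist (X n) (Abs_bop L)) \<longlonglongrightarrow> 0"
    using L by (simp add: tendsto_dist_iff[of "\<lambda>n. Rep_bop (X n)"])
  then have "X \<longlonglongrightarrow> Abs_bop L"
    by (simp add: tendsto_dist_iff[of X])
  then show "convergent X"
    by (rule convergentI)
qed

lemma bounded_linear_scaleC_bop: "bounded_linear (\<lambda>T :: 'a::complex_hilbert bop. c *\<^sub>C T)"
proof (rule bounded_linear_intro[where K = "cmod c"])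
  fix r :: real and S T :: "'a bop"
  show "c *\<^sub>C (r *\<^sub>R T) = r *\<^sub>R c *\<^sub>C T"
    by (simp flip: scaleC_of_real add: scaleC_scaleC mult.commute)
  have "norm (c *\<^sub>C bop_apply T x) \<le> norm T * cmod c * norm x" for x
    using mult_left_mono[OF norm_bop_apply[of T x], of "cmod c"] by (simp add: norm_scaleC mult_ac)
  then show "norm (c *\<^sub>C T) \<le> norm T * cmod c"
    by (intro norm_bop_bound) auto
qed (auto simp: scaleC_add_right)

section \<open>The adjoint\<close>

text \<open>The representing vector of a bounded functional \<open>f\<close> is the minimizer of
  \<open>\<parallel>x\<parallel>\<^sup>2 - 2 f x\<close>: by the parallelogram law minimizing sequences are Cauchy, and the first
  order condition at the minimum is the asserted equation.\<close>

lemma riesz_representation: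
  fixes f :: "'a::{real_inner,complete_space} \<Rightarrow> real"
  assumes f: "bounded_linear f"
  shows "\<exists>z. \<forall>x. f x = inner x z"
proof -
  interpret f: bounded_linear f by (rule f)
  obtain K where K: "\<And>x. norm (f x) \<le> norm x * K"
    using f.bounded by blast
  define g where "g x = (norm x)\<^sup>2 - 2 * f x" for x
  have g_ge: "g x \<ge> - (K\<^sup>2)" for x
  proof -
    have "2 * f x \<le> 2 * (norm x * K)"
      using K[of x] by simp
    also have "\<dots> \<le> (norm x)\<^sup>2 + K\<^sup>2"
      using sum_squares_bound[of "norm x" K] by simp
    finally show ?thesis by (simp add: g_def)
  qed
  define m where "m = Inf (range g)"
  have bdd: "bdd_below (range g)"
    using g_ge by (auto intro!: bdd_belowI[of _ "- (K\<^sup>2)"])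
  have m_le: "m \<le> g x" for x
    unfolding m_def by (rule cInf_lower[OF _ bdd]) simp
  have "\<exists>x. g x < m + e" if "e > 0" for e
    using cInf_lessD[of "range g" "m + e"] that by (auto simp: m_def)
  then have "\<forall>n. \<exists>x. g x < m + inverse (real (Suc n))"
    by (metis inverse_positive_iff_positive of_nat_0_less_iff zero_less_Suc)
  then obtain X where X: "\<And>n. g (X n) < m + inverse (real (Suc n))"
    by metis
  have para: "(norm (x - y))\<^sup>2 \<le> 2 * ((g x - m) + (g y - m))" for x y
  proof -
    have "g ((1/2) *\<^sub>R (x + y)) = (norm (x + y))\<^sup>2 / 4 - (f x + f y)"
      by (simp add: g_def f.scaleR f.add power_divide add_divide_distrib)
    moreover have "(norm (x - y))\<^sup>2 + (norm (x + y))\<^sup>2 = 2 * (norm x)\<^sup>2 + 2 * (norm y)\<^sup>2"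
      by (simp add: power2_norm_eq_inner inner_add_left inner_add_right inner_diff_left inner_diff_right
          inner_commute)
    moreover note m_le[of "(1/2) *\<^sub>R (x + y)"]
    ultimately have "4 * m \<le> (norm (x + y))\<^sup>2 - 4 * f x - 4 * f y"
      and "(norm (x + y))\<^sup>2 = 2 * (norm x)\<^sup>2 + 2 * (norm y)\<^sup>2 - (norm (x - y))\<^sup>2"
      by linarith+
    then show ?thesis
      by (simp add: g_def algebra_simps)
  qed
  have "Cauchy X"
  proof (rule metric_CauchyI)
    fix e :: real assume e: "0 < e"
    then obtain M where M: "inverse (real (Suc M)) < e\<^sup>2 / 4"
      using reals_Archimedean[of "e\<^sup>2 / 4"] by auto
    have small: "g (X n) - m < e\<^sup>2 / 4" if "n \<ge> M" for n
    proof -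
      have "inverse (real (Suc n)) \<le> inverse (real (Suc M))"
        using that by (simp add: field_simps)
      then show ?thesis using X[of n] M by linarith
    qed
    have "dist (X i) (X j) < e" if "i \<ge> M" "j \<ge> M" for i j
    proof -
      have "(norm (X i - X j))\<^sup>2 < e\<^sup>2"
        using para[of "X i" "X j"] small[OF that(1)] small[OF that(2)] by argo
      then show ?thesis
        using e by (simp add: dist_norm power_less_imp_less_base)
    qed
    then show "\<exists>M. \<forall>i\<ge>M. \<forall>j\<ge>M. dist (X i) (X j) < e" by blast
  qed
  then obtain z where z: "X \<longlonglongrightarrow> z"
    by (auto simp: Cauchy_convergent_iff convergent_def)
  have "(\<lambda>n. g (X n)) \<longlonglongrightarrow> g z"
    unfolding g_def by (intro tendsto_intros z f.tendsto)
  moreover have "(\<lambda>n. m + inverse (real (Suc n))) \<longlonglongrightarrow> m + 0"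
    by (intro tendsto_intros LIMSEQ_inverse_real_of_nat)
  ultimately have "g z \<le> m + 0"
    by (rule LIMSEQ_le) (use X in \<open>auto intro: less_imp_le\<close>)
  then have min: "g z \<le> g x" for x
    using m_le[of x] by simp
  have "f x = inner x z" for x
  proof (cases "x = 0")
    case False
    define a where "a = inner x z - f x"
    define n where "n = (norm x)\<^sup>2"
    have n: "n > 0" using False by (simp add: n_def)
    have "g (z + t *\<^sub>R x) = g z + (2 * t * a + t\<^sup>2 * n)" for t
      unfolding g_def a_def n_def power2_norm_eq_inner
      by (simp add: f.add f.scaleR inner_add_left inner_add_right inner_commute
          algebra_simps power2_eq_square)
    then have "0 \<le> 2 * t * a + t\<^sup>2 * n" for t
      using min[of "z + t *\<^sub>R x"] by simp
    \<comment> \<open>The quadratic in \<open>t\<close> has its minimum at this point.\<close>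
    from this[of "- a / n"] have "0 \<le> - (a\<^sup>2 / n)"
      using n by (simp add: power2_eq_square field_simps)
    then have "a = 0"
      using n by (simp add: divide_le_0_iff)
    then show ?thesis by (simp add: a_def)
  qed (simp add: f.zero)
  then show ?thesis by blast
qed

text \<open>The vector that represents the functional \<open>x \<mapsto> Re \<langle>T x, y\<rangle>\<close> is unique, hence it depends
  linearly on \<open>y\<close>; it also represents the complex functional, which is determined by its real part.\<close>

lemma adjoint_exists:
  fixes T :: "'a::complex_hilbert bop"
  shows "\<exists>S. \<forall>x y. cinner (bop_apply T x) y = cinner x (bop_apply S y)"
proof -
  have "bounded_linear (\<lambda>x. inner (bop_apply T x) y)" for y
    by (rule bounded_linear_compose[OF bounded_linear_inner_left bounded_linear_bop_apply])
  from riesz_representation[OF this]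
  obtain s where s: "\<And>x y. inner (bop_apply T x) y = inner x (s y)"
    by metis
  have cs: "cinner (bop_apply T x) y = cinner x (s y)" for x y
    by (rule cinner_eq_of_inner) (simp_all add: s flip: bop_apply_scaleC_right)
  have "bop_apply (mk_bop s) y = s y" for y
  proof (rule mk_bop_apply)
    show "s (x + y) = s x + s y" for x y
      by (rule cinner_right_eqI) (simp add: cinner_add_right flip: cs)
    show "s (c *\<^sub>C x) = c *\<^sub>C s x" for c x
      by (rule cinner_right_eqI) (simp add: cinner_scaleC_right flip: cs)
    show "norm (s y) \<le> norm T * norm y" for y
    proof (cases "s y = 0")
      case False
      have "(norm (s y))\<^sup>2 = inner (bop_apply T (s y)) y"
        by (simp add: s power2_norm_eq_inner)
      also have "\<dots> \<le> norm (bop_apply T (s y)) * norm y"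
        by (rule norm_cauchy_schwarz)
      also have "\<dots> \<le> norm T * norm (s y) * norm y"
        by (intro mult_right_mono norm_bop_apply norm_ge_zero)
      finally have "norm (s y) * norm (s y) \<le> norm (s y) * (norm T * norm y)"
        by (simp add: power2_eq_square mult_ac)
      then show ?thesis
        using False by simp
    qed simp
  qed
  then show ?thesis using cs by metis
qed

lemma star_eqI:
  fixes T :: "'a::complex_hilbert bop"
  assumes "\<And>x y. cinner (bop_apply T x) y = cinner x (bop_apply S y)"
  shows "star T = S"
  unfolding star_bop_def
proof (rule the_equality)
  fix S' assume "\<forall>x y. cinner (bop_apply T x) y = cinner x (bop_apply S' y)"
  then show "S' = S"
    by - (rule bop_eqI, rule cinner_right_eqI, simp flip: assms)
qed (use assms in simp)

lemma cinner_star: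
  fixes T :: "'a::complex_hilbert bop"
  shows "cinner (bop_apply T x) y = cinner x (bop_apply (star T) y)"
  using adjoint_exists[of T] star_eqI by metis

lemma cinner_star':
  fixes T :: "'a::complex_hilbert bop"
  shows "cinner x (bop_apply T y) = cinner (bop_apply (star T) x) y"
  by (metis cinner_star cinner_commute)

text \<open>Matrices over bounded operators and over their unitizations are treated uniformly by means of
  the laws that the two involutions share.\<close>

class involutive_algebra = star_algebra +
  assumes star_star [simp]: "star (star x) = x"
    and star_add: "star (x + y) = star x + star y"
    and star_mult: "star (x * y) = star y * star x"
    and star_scaleC: "star (c *\<^sub>C x) = cnj c *\<^sub>C star x"
begin

lemma star_zero [simp]: "star 0 = 0"
  using star_add[of 0 0] by simp

lemma star_minus: "star (- x) = - star x"
  using star_add[of x "- x"] by (simp add: eq_neg_iff_add_eq_0 add.commute)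

lemma star_diff: "star (x - y) = star x - star y"
  using star_add[of x "- y"] by (simp add: star_minus)

lemma star_sum: "star (sum f I) = (\<Sum>i\<in>I. star (f i))"
  by (induction I rule: infinite_finite_induct) (auto simp: star_add)

end

instance bop :: (complex_hilbert) involutive_algebra
proof
  fix S T :: "'a bop" and c
  show "star (star T) = T"
    by (rule star_eqI) (simp add: cinner_star')
  show "star (S + T) = star S + star T"
    by (rule star_eqI) (simp add: cinner_star cinner_add_left cinner_add_right)
  show "star (S * T) = star T * star S"
    by (rule star_eqI) (simp add: cinner_star)
  show "star (c *\<^sub>C T) = cnj c *\<^sub>C star T"
    by (rule star_eqI) (simp add: cinner_star cinner_scaleC_left cinner_scaleC_right)
qed

instance unitized :: (involutive_algebra) involutive_algebra
proof
  fix x y :: "'a unitized" and c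
  show "star (star x) = x"
    by (cases x) simp
  show "star (x + y) = star x + star y"
    by (cases x; cases y) (simp add: star_add)
  show "star (x * y) = star y * star x"
    by (cases x; cases y) (simp add: star_add star_mult star_scaleC add_ac)
  show "star (c *\<^sub>C x) = cnj c *\<^sub>C star x"
    by (cases x) (simp add: star_scaleC)
qed

lemma star_one [simp]: "star (1 :: 'a::complex_hilbert bop) = 1"
  by (rule star_eqI) simp

lemma norm_star_le: "norm (star T) \<le> norm T" for T :: "'a::complex_hilbert bop"
proof (rule norm_bop_bound)
  fix y
  show "norm (bop_apply (star T) y) \<le> norm T * norm y"
  proof (cases "bop_apply (star T) y = 0")
    case False
    let ?s = "bop_apply (star T) y"
    have "(norm ?s)\<^sup>2 = cmod (cinner ?s ?s)"
      by (simp add: cinner_self norm_power)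
    also have "\<dots> = cmod (cinner (bop_apply T ?s) y)"
      by (simp add: cinner_star)
    also have "\<dots> \<le> norm (bop_apply T ?s) * norm y"
      by (rule norm_cinner_le)
    also have "\<dots> \<le> norm T * norm ?s * norm y"
      by (intro mult_right_mono norm_bop_apply norm_ge_zero)
    finally have "norm ?s * norm ?s \<le> norm ?s * (norm T * norm y)"
      by (simp add: power2_eq_square mult_ac)
    then show ?thesis
      using False by simp
  qed simp
qed simp

lemma norm_star [simp]: "norm (star T) = norm T" for T :: "'a::complex_hilbert bop"
  using norm_star_le[of T] norm_star_le[of "star T"] by simp

lemma bounded_linear_star: "bounded_linear (star :: 'a::complex_hilbert bop \<Rightarrow> 'a bop)"
proof (rule bounded_linear_intro[where K = 1])
  fix r :: real and T :: "'a bop"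
  show "star (r *\<^sub>R T) = r *\<^sub>R star T"
    by (metis complex_cnj_complex_of_real scaleC_of_real star_scaleC)
qed (auto simp: star_add)

lemma norm_apply_sq: "complex_of_real ((norm (bop_apply T x))\<^sup>2) = cinner x (bop_apply (star T * T) x)"
  for T :: "'a::complex_hilbert bop"
  unfolding cinner_self[symmetric] by (simp add: cinner_star)

lemma star_mult_self_eq_0: "star T * T = 0 \<Longrightarrow> T = 0" for T :: "'a::complex_hilbert bop"
proof (rule bop_eqI)
  fix x assume "star T * T = 0"
  then have "complex_of_real ((norm (bop_apply T x))\<^sup>2) = 0"
    unfolding norm_apply_sq by simp
  then show "bop_apply T x = bop_apply 0 x"
    by simp
qed

text \<open>By polarization the norms determine the inner products \<open>\<langle>S x, S y\<rangle>\<close>.\<close>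

lemma star_mult_self_eqI:
  fixes S T :: "'a::complex_hilbert bop"
  assumes "\<And>x. norm (bop_apply S x) = norm (bop_apply T x)"
  shows "star S * S = star T * T"
proof -
  have nsq: "inner (bop_apply S x) (bop_apply S x) = inner (bop_apply T x) (bop_apply T x)" for x
    using assms[of x] by (simp flip: power2_norm_eq_inner)
  have re: "inner (bop_apply S x) (bop_apply S y) = inner (bop_apply T x) (bop_apply T y)" for x y
    using nsq[of "x + y"] nsq[of x] nsq[of y]
    by (simp add: bop_apply_add_right inner_add_left inner_add_right inner_commute)
  have "cinner (bop_apply S x) (bop_apply S y) = cinner (bop_apply T x) (bop_apply T y)" for x y
    by (rule cinner_eq_of_inner) (simp_all add: re flip: bop_apply_scaleC_right)
  then show ?thesis
    by - (rule bop_eqI, rule cinner_right_eqI, simp add: cinner_star)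
qed

section \<open>Projections in matrix algebras\<close>

definition star_subalgebra :: "'a::involutive_algebra set \<Rightarrow> bool"
  where "star_subalgebra C \<longleftrightarrow> subalgebra C \<and> (\<forall>a\<in>C. star a \<in> C)"

lemma subalgebraD:
  assumes "subalgebra A"
  shows "0 \<in> A" "a \<in> A \<Longrightarrow> b \<in> A \<Longrightarrow> a + b \<in> A" "a \<in> A \<Longrightarrow> b \<in> A \<Longrightarrow> a * b \<in> A"
    "a \<in> A \<Longrightarrow> c *\<^sub>C a \<in> A"
  using assms by (auto simp: subalgebra_def)

lemma subalgebra_minus: "subalgebra A \<Longrightarrow> a \<in> A \<Longrightarrow> - a \<in> A"
  using subalgebraD(4)[of A a "- 1"] by (simp add: scaleC_minus_one)

lemma subalgebra_diff: "subalgebra A \<Longrightarrow> a \<in> A \<Longrightarrow> b \<in> A \<Longrightarrow> a - b \<in> A"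
  using subalgebraD(2)[of A a "- b"] subalgebra_minus[of A b] by simp

lemma subalgebra_sum: "subalgebra A \<Longrightarrow> (\<And>i. i \<in> I \<Longrightarrow> f i \<in> A) \<Longrightarrow> sum f I \<in> A"
  by (induction I rule: infinite_finite_induct) (auto simp: subalgebraD)

lemma matrices_over_iff:
  "M \<in> matrices_over m n A \<longleftrightarrow> M \<in> carrier_mat m n \<and> (\<forall>i<m. \<forall>j<n. M $$ (i, j) \<in> A)"
proof
  assume "M \<in> matrices_over m n A"
  then show "M \<in> carrier_mat m n \<and> (\<forall>i<m. \<forall>j<n. M $$ (i, j) \<in> A)"
    unfolding matrices_over_def by blast
next
  assume "M \<in> carrier_mat m n \<and> (\<forall>i<m. \<forall>j<n. M $$ (i, j) \<in> A)"
  then show "M \<in> matrices_over m n A"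
    unfolding matrices_over_def by fastforce
qed

lemma matrices_over_carrier: "M \<in> matrices_over m n A \<Longrightarrow> M \<in> carrier_mat m n"
  by (simp add: matrices_over_def)

lemma mult_mat_index:
  fixes M N :: "'a::semiring_0 mat"
  assumes "M \<in> carrier_mat m n" "N \<in> carrier_mat n l" "i < m" "j < l"
  shows "(M * N) $$ (i, j) = (\<Sum>k<n. M $$ (i, k) * N $$ (k, j))"
  using assms by (simp add: scalar_prod_def atLeast0LessThan)

lemma matrices_over_mult:
  assumes "subalgebra A" "M \<in> matrices_over m n A" "N \<in> matrices_over n l A"
  shows "M * N \<in> matrices_over m l A"
proof -
  have "(M * N) $$ (i, j) \<in> A" if "i < m" "j < l" for i j
  proof -
    have "(M * N) $$ (i, j) = (\<Sum>k<n. M $$ (i, k) * N $$ (k, j))"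
      using assms that by (intro mult_mat_index[of M m n N l] matrices_over_carrier)
    also have "\<dots> \<in> A"
      using assms that by (intro subalgebra_sum subalgebraD(3)) (auto simp: matrices_over_iff)
    finally show ?thesis .
  qed
  then show ?thesis
    using assms by (auto simp: matrices_over_iff)
qed

lemma matrices_over_zero: "subalgebra A \<Longrightarrow> 0\<^sub>m m n \<in> matrices_over m n A"
  by (simp add: matrices_over_iff subalgebraD(1))

lemma mat_star_dim [simp]: "dim_row (mat_star M) = dim_col M" "dim_col (mat_star M) = dim_row M"
  by (simp_all add: mat_star_def)

lemma mat_star_carrier: "M \<in> carrier_mat m n \<Longrightarrow> mat_star M \<in> carrier_mat n m"
  by (intro carrier_matI) auto

lemma mat_star_index [simp]:
  "i < dim_col M \<Longrightarrow> j < dim_row M \<Longrightarrow> mat_star M $$ (i, j) = star (M $$ (j, i))"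
  by (simp add: mat_star_def)

lemma mat_star_star [simp]: "mat_star (mat_star M) = M" for M :: "'a::involutive_algebra mat"
  by (rule eq_matI) auto

lemma mat_star_mult:
  fixes M N :: "'a::involutive_algebra mat"
  assumes M: "M \<in> carrier_mat m n" and N: "N \<in> carrier_mat n l"
  shows "mat_star (M * N) = mat_star N * mat_star M"
proof (rule eq_matI)
  fix i j assume "i < dim_row (mat_star N * mat_star M)" "j < dim_col (mat_star N * mat_star M)"
  then have ij: "i < l" "j < m" using M N by auto
  have "mat_star (M * N) $$ (i, j) = star ((M * N) $$ (j, i))"
    using ij M N by (intro mat_star_index) auto
  also have "\<dots> = (\<Sum>k<n. star (N $$ (k, i)) * star (M $$ (j, k)))"
    by (simp add: mult_mat_index[OF M N ij(2,1)] star_sum star_mult del: index_mult_mat)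
  also have "\<dots> = (mat_star N * mat_star M) $$ (i, j)"
    using ij M N
    by (simp add: mult_mat_index[OF mat_star_carrier[OF N] mat_star_carrier[OF M] ij] del: index_mult_mat)
  finally show "mat_star (M * N) $$ (i, j) = (mat_star N * mat_star M) $$ (i, j)" .
qed (use M N in auto)

lemma matrices_over_star:
  "star_subalgebra C \<Longrightarrow> M \<in> matrices_over m n C \<Longrightarrow> mat_star M \<in> matrices_over n m C"
  by (auto simp: matrices_over_iff star_subalgebra_def)

lemma direct_sum_dim [simp]:
  "dim_row (p \<oplus>\<^sub>m q) = dim_row p + dim_row q" "dim_col (p \<oplus>\<^sub>m q) = dim_col p + dim_col q"
  by (simp_all add: direct_sum_mat_def)

lemma direct_sum_index:
  "i < dim_row p + dim_row q \<Longrightarrow> j < dim_col p + dim_col q \<Longrightarrow>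
   (p \<oplus>\<^sub>m q) $$ (i, j) = (if i < dim_row p then if j < dim_col p then p $$ (i, j) else 0
     else if j < dim_col p then 0 else q $$ (i - dim_row p, j - dim_col p))"
  by (auto simp: direct_sum_mat_def)

lemma matrices_over_direct_sum:
  assumes "subalgebra A" "p \<in> matrices_over m n A" "q \<in> matrices_over k l A"
  shows "p \<oplus>\<^sub>m q \<in> matrices_over (m + k) (n + l) A"
  using assms by (auto simp: matrices_over_iff direct_sum_index subalgebraD(1))

lemma direct_sum_star:
  fixes p q :: "'a::involutive_algebra mat"
  shows "mat_star (p \<oplus>\<^sub>m q) = mat_star p \<oplus>\<^sub>m mat_star q"
  by (rule eq_matI) (auto simp: direct_sum_index)

lemma direct_sum_mult:
  fixes M N :: "'a::semiring_0 mat"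
  assumes "M \<in> carrier_mat a b" "N \<in> carrier_mat c d" "M' \<in> carrier_mat b e" "N' \<in> carrier_mat d f"
  shows "(M \<oplus>\<^sub>m N) * (M' \<oplus>\<^sub>m N') = (M * M') \<oplus>\<^sub>m (N * N')"
  unfolding direct_sum_mat_def
  by (subst mult_four_block_mat[of _ a b _ d _ c _ _ e _ f]) (use assms in auto)

lemma direct_sum_assoc: "(p \<oplus>\<^sub>m q) \<oplus>\<^sub>m r = p \<oplus>\<^sub>m (q \<oplus>\<^sub>m r)"
  unfolding direct_sum_mat_def by (rule assoc_four_block_mat[symmetric])

lemma direct_sum_empty [simp]: "p \<oplus>\<^sub>m 0\<^sub>m 0 0 = p" "0\<^sub>m 0 0 \<oplus>\<^sub>m p = p"
  by (rule eq_matI; auto simp: direct_sum_index)+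

lemma mat_projectionsD:
  assumes "p \<in> mat_projections C"
  shows "mat_star p = p" "p * p = p"
  using assms by (auto simp: mat_projections_def)

lemma mat_projectionsE:
  assumes "p \<in> mat_projections C"
  obtains n where "p \<in> matrices_over n n C" "p \<in> carrier_mat n n"
  using assms by (auto simp: mat_projections_def matrices_over_def)

lemma mvnI:
  assumes "p \<in> mat_projections C" "q \<in> mat_projections C" "v \<in> matrices_over m n C"
    "mat_star v * v = p" "v * mat_star v = q"
  shows "(p, q) \<in> murray_von_neumann C"
proof -
  have "dim_row q = m" "dim_row p = n"
    using assms(3-5) by (auto simp: matrices_over_def)
  then show ?thesis
    using assms by (auto simp: murray_von_neumann_def)
qed

lemma mvnE:
  assumes "(p, q) \<in> murray_von_neumann C"
  obtains m n v where "p \<in> mat_projections C" "q \<in> mat_projections C"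
    "p \<in> carrier_mat n n" "q \<in> carrier_mat m m" "v \<in> matrices_over m n C"
    "mat_star v * v = p" "v * mat_star v = q"
proof -
  obtain v where v: "p \<in> mat_projections C" "q \<in> mat_projections C"
    "v \<in> matrices_over (dim_row q) (dim_row p) C" "mat_star v * v = p" "v * mat_star v = q"
    using assms by (auto simp: murray_von_neumann_def)
  obtain n where n: "p \<in> carrier_mat n n"
    using v(1) by (rule mat_projectionsE)
  obtain m where m: "q \<in> carrier_mat m m"
    using v(2) by (rule mat_projectionsE)
  show ?thesis
    using that[OF v(1,2) n m _ v(4,5)] v(3) n m by simp
qed

lemma equiv_mvn:
  assumes C: "star_subalgebra (C :: 'a::involutive_algebra set)"
  shows "equiv (mat_projections C) (murray_von_neumann C)"
proof (rule equivI)
  have sC: "subalgebra C" using C by (simp add: star_subalgebra_def)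
  show "murray_von_neumann C \<subseteq> mat_projections C \<times> mat_projections C"
    by (auto simp: murray_von_neumann_def)
  show "refl_on (mat_projections C) (murray_von_neumann C)"
  proof (rule refl_onI)
    fix p assume p: "p \<in> mat_projections C"
    from p obtain n where n: "p \<in> matrices_over n n C"
      by (rule mat_projectionsE)
    show "(p, p) \<in> murray_von_neumann C"
      by (rule mvnI[OF p p n]) (simp_all add: mat_projectionsD[OF p])
  qed
  show "sym (murray_von_neumann C)"
  proof (rule symI)
    fix p q assume "(p, q) \<in> murray_von_neumann C"
    then obtain m n v where "p \<in> mat_projections C" "q \<in> mat_projections C"
      "v \<in> matrices_over m n C" "mat_star v * v = p" "v * mat_star v = q"
      by (rule mvnE)
    then show "(q, p) \<in> murray_von_neumann C"
      by (intro mvnI[where v = "mat_star v"] matrices_over_star[OF C]) auto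
  qed
  show "trans (murray_von_neumann C)"
  proof (rule transI)
    fix p q r assume pq: "(p, q) \<in> murray_von_neumann C" and qr: "(q, r) \<in> murray_von_neumann C"
    obtain k l v where p: "p \<in> mat_projections C"
      and cq: "q \<in> carrier_mat l l"
      and v: "v \<in> matrices_over l k C" "mat_star v * v = p" "v * mat_star v = q"
      using pq by (rule mvnE)
    obtain m l' w where r: "r \<in> mat_projections C" and cq': "q \<in> carrier_mat l' l'"
      and w': "w \<in> matrices_over m l' C" "mat_star w * w = q" "w * mat_star w = r"
      using qr by (rule mvnE)
    have "l' = l" using cq cq' by auto
    with w' have w: "w \<in> matrices_over m l C" "mat_star w * w = q" "w * mat_star w = r"
      by auto
    note cv = matrices_over_carrier[OF v(1)] and cw = matrices_over_carrier[OF w(1)]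
    note cv' = mat_star_carrier[OF cv] and cw' = mat_star_carrier[OF cw]
    have "mat_star (w * v) * (w * v) = mat_star v * (mat_star w * w * v)"
      using cv cw cv' cw' by (simp add: mat_star_mult[OF cw cv] assoc_mult_mat[of _ k l _ m _ k]
          assoc_mult_mat[of _ l m _ l _ k])
    also have "\<dots> = mat_star v * (v * mat_star v * v)"
      by (simp only: w(2) v(3))
    also have "\<dots> = mat_star v * v * (mat_star v * v)"
      using cv cv' by (simp add: assoc_mult_mat[of _ k l _ k _ k] assoc_mult_mat[of _ l k _ l _ k])
    finally have 1: "mat_star (w * v) * (w * v) = p"
      by (simp add: v(2) mat_projectionsD(2)[OF p])
    have "w * v * mat_star (w * v) = w * (v * mat_star v * mat_star w)"
      using cv cw cv' cw' by (simp add: mat_star_mult[OF cw cv] assoc_mult_mat[of _ m l _ k _ m]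
          assoc_mult_mat[of _ l k _ l _ m])
    also have "\<dots> = w * (mat_star w * w * mat_star w)"
      by (simp only: w(2) v(3))
    also have "\<dots> = w * mat_star w * (w * mat_star w)"
      using cw cw' by (simp add: assoc_mult_mat[of _ m l _ m _ m] assoc_mult_mat[of _ l m _ l _ m])
    finally have 2: "w * v * mat_star (w * v) = r"
      by (simp add: w(3) mat_projectionsD(2)[OF r])
    show "(p, r) \<in> murray_von_neumann C"
      by (rule mvnI[OF p r matrices_over_mult[OF sC w(1) v(1)] 1 2])
  qed
qed

lemma direct_sum_projection:
  assumes C: "subalgebra (C :: 'a::involutive_algebra set)"
    and p: "p \<in> mat_projections C" and q: "q \<in> mat_projections C"
  shows "p \<oplus>\<^sub>m q \<in> mat_projections C"
proof -
  obtain n where n: "p \<in> matrices_over n n C" "p \<in> carrier_mat n n"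
    using p by (rule mat_projectionsE)
  obtain m where m: "q \<in> matrices_over m m C" "q \<in> carrier_mat m m"
    using q by (rule mat_projectionsE)
  show ?thesis
    unfolding mat_projections_def using matrices_over_direct_sum[OF C n(1) m(1)]
    by (auto simp: direct_sum_star mat_projectionsD[OF p] mat_projectionsD[OF q]
        direct_sum_mult[OF n(2) m(2) n(2) m(2)])
qed

lemma mvn_direct_sum:
  assumes C: "subalgebra (C :: 'a::involutive_algebra set)"
    and pp: "(p, p') \<in> murray_von_neumann C" and qq: "(q, q') \<in> murray_von_neumann C"
  shows "(p \<oplus>\<^sub>m q, p' \<oplus>\<^sub>m q') \<in> murray_von_neumann C"
proof -
  obtain k l v where p: "p \<in> mat_projections C" "p' \<in> mat_projections C"
    and v: "v \<in> matrices_over k l C" "mat_star v * v = p" "v * mat_star v = p'"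
    using pp by (rule mvnE)
  obtain m n w where q: "q \<in> mat_projections C" "q' \<in> mat_projections C"
    and w: "w \<in> matrices_over m n C" "mat_star w * w = q" "w * mat_star w = q'"
    using qq by (rule mvnE)
  note cv = matrices_over_carrier[OF v(1)] and cw = matrices_over_carrier[OF w(1)]
  note cv' = mat_star_carrier[OF cv] and cw' = mat_star_carrier[OF cw]
  show ?thesis
    by (rule mvnI[OF direct_sum_projection[OF C p(1) q(1)] direct_sum_projection[OF C p(2) q(2)]
          matrices_over_direct_sum[OF C v(1) w(1)]])
      (simp_all add: direct_sum_star direct_sum_mult[OF cv' cw' cv cw] direct_sum_mult[OF cv cw cv' cw'] v w)
qed

text \<open>The partial isometry is the flip of the two summands, cut down to the projections.\<close>

lemma mvn_direct_sum_commute: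
  assumes C: "subalgebra (C :: 'a::involutive_algebra set)"
    and p: "p \<in> mat_projections C" and q: "q \<in> mat_projections C"
  shows "(p \<oplus>\<^sub>m q, q \<oplus>\<^sub>m p) \<in> murray_von_neumann C"
proof -
  obtain n where np: "p \<in> matrices_over n n C" and cp: "p \<in> carrier_mat n n"
    using p by (rule mat_projectionsE)
  obtain m where mq: "q \<in> matrices_over m m C" and cq: "q \<in> carrier_mat m m"
    using q by (rule mat_projectionsE)
  have ps: "i < n \<Longrightarrow> j < n \<Longrightarrow> star (p $$ (i, j)) = p $$ (j, i)" for i j
    using mat_star_index[of j p i] cp by (simp add: mat_projectionsD(1)[OF p])
  have qs: "i < m \<Longrightarrow> j < m \<Longrightarrow> star (q $$ (i, j)) = q $$ (j, i)" for i j
    using mat_star_index[of j q i] cq by (simp add: mat_projectionsD(1)[OF q])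
  define v where "v = four_block_mat (0\<^sub>m m n) q p (0\<^sub>m n m)"
  define w where "w = four_block_mat (0\<^sub>m n m) p q (0\<^sub>m m n)"
  have "v \<in> matrices_over (m + n) (n + m) C"
    using matrices_over_zero[OF C, of n m] matrices_over_zero[OF C, of m n] np mq
      subalgebraD(1)[OF C]
    by (auto simp: v_def matrices_over_iff)
  moreover have "mat_star v = w"
    using cp cq by (intro eq_matI) (auto simp: v_def w_def ps qs)
  moreover have "w * v = p \<oplus>\<^sub>m q"
    unfolding v_def w_def direct_sum_mat_def
    by (subst mult_four_block_mat[of _ n m _ n _ m _ _ n _ m])
      (use cp cq mat_projectionsD(2)[OF p] mat_projectionsD(2)[OF q] in auto)
  moreover have "v * w = q \<oplus>\<^sub>m p"
    unfolding v_def w_def direct_sum_mat_def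
    by (subst mult_four_block_mat[of _ m n _ m _ n _ _ m _ n])
      (use cp cq mat_projectionsD(2)[OF p] mat_projectionsD(2)[OF q] in auto)
  ultimately show ?thesis
    by (intro mvnI[OF direct_sum_projection[OF C p q] direct_sum_projection[OF C q p]]) auto
qed

lemma zero_projection: "subalgebra C \<Longrightarrow> 0\<^sub>m n n \<in> mat_projections (C :: 'a::involutive_algebra set)"
  by (auto simp: mat_projections_def intro!: exI[of _ n] matrices_over_zero eq_matI)

text \<open>The implementing matrix has \<open>n\<close> columns and no rows.\<close>

lemma mvn_zero:
  assumes C: "subalgebra (C :: 'a::involutive_algebra set)"
  shows "(0\<^sub>m n n, 0\<^sub>m 0 0) \<in> murray_von_neumann C"
  by (rule mvnI[OF zero_projection[OF C] zero_projection[OF C] matrices_over_zero[OF C, of 0 n]])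
    (auto intro!: eq_matI simp: scalar_prod_def)

lemma mvn_direct_sum_zero:
  assumes C: "star_subalgebra (C :: 'a::involutive_algebra set)" and p: "p \<in> mat_projections C"
  shows "(p \<oplus>\<^sub>m 0\<^sub>m n n, p) \<in> murray_von_neumann C" "(0\<^sub>m n n \<oplus>\<^sub>m p, p) \<in> murray_von_neumann C"
proof -
  have sC: "subalgebra C" using C by (simp add: star_subalgebra_def)
  have pp: "(p, p) \<in> murray_von_neumann C"
    using equiv_mvn[OF C] p by (meson equiv_def refl_onD)
  show "(p \<oplus>\<^sub>m 0\<^sub>m n n, p) \<in> murray_von_neumann C"
    using mvn_direct_sum[OF sC pp mvn_zero[OF sC, of n]] by simp
  show "(0\<^sub>m n n \<oplus>\<^sub>m p, p) \<in> murray_von_neumann C"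
    using mvn_direct_sum[OF sC mvn_zero[OF sC, of n] pp] by simp
qed

section \<open>The semigroup of projections and its Grothendieck group\<close>

lemma projection_class_eq_iff:
  assumes "star_subalgebra (C :: 'a::involutive_algebra set)"
    and "p \<in> mat_projections C" "q \<in> mat_projections C"
  shows "projection_class C p = projection_class C q \<longleftrightarrow> (p, q) \<in> murray_von_neumann C"
  unfolding projection_class_def using eq_equiv_class_iff[OF equiv_mvn[OF assms(1)] assms(2,3)] .

lemma projection_class_carrier:
  "p \<in> mat_projections C \<Longrightarrow> projection_class C p \<in> carrier (projection_semigroup C)"
  by (simp add: projection_semigroup_def projection_class_def quotientI)

lemma projection_semigroup_carrierE:
  assumes "X \<in> carrier (projection_semigroup C)"
  obtains p where "p \<in> mat_projections C" "X = projection_class C p"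
  using assms by (auto simp: projection_semigroup_def projection_class_def elim: quotientE)

text \<open>The union in the definition of the product ranges over classes that all coincide, because
  direct sums respect equivalence.\<close>

lemma projection_class_mult:
  assumes C: "star_subalgebra (C :: 'a::involutive_algebra set)"
    and p: "p \<in> mat_projections C" and q: "q \<in> mat_projections C"
  shows "projection_class C p \<otimes>\<^bsub>projection_semigroup C\<^esub> projection_class C q
    = projection_class C (p \<oplus>\<^sub>m q)"
proof -
  have sC: "subalgebra C" using C by (simp add: star_subalgebra_def)
  have eq: "projection_class C (p' \<oplus>\<^sub>m q') = projection_class C (p \<oplus>\<^sub>m q)"
    if "p' \<in> projection_class C p" "q' \<in> projection_class C q" for p' q'
  proof -
    have "(p, p') \<in> murray_von_neumann C" "(q, q') \<in> murray_von_neumann C"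
      using that by (auto simp: projection_class_def)
    from mvn_direct_sum[OF sC this] show ?thesis
      unfolding projection_class_def using equiv_class_eq[OF equiv_mvn[OF C]] by metis
  qed
  have "p \<in> projection_class C p" "q \<in> projection_class C q"
    unfolding projection_class_def using equiv_class_self[OF equiv_mvn[OF C]] p q by auto
  then have "(\<Union>p'\<in>projection_class C p. \<Union>q'\<in>projection_class C q. projection_class C (p' \<oplus>\<^sub>m q'))
      = projection_class C (p \<oplus>\<^sub>m q)"
    using eq by blast
  then show ?thesis
    by (simp add: projection_semigroup_def)
qed

lemma projection_semigroup_comm_monoid:
  assumes C: "star_subalgebra (C :: 'a::involutive_algebra set)"
  shows "comm_monoid (projection_semigroup C)"
proof -
  have sC: "subalgebra C" using C by (simp add: star_subalgebra_def)
  have one: "\<one>\<^bsub>projection_semigroup C\<^esub> = projection_class C (0\<^sub>m 0 0)"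
    by (simp add: projection_semigroup_def)
  note mult = projection_class_mult[OF C] and proj = direct_sum_projection[OF sC]
    and zero = zero_projection[OF sC]
  show ?thesis
  proof (rule comm_monoidI)
    fix X Y assume "X \<in> carrier (projection_semigroup C)" "Y \<in> carrier (projection_semigroup C)"
    then obtain p q where p: "p \<in> mat_projections C" "X = projection_class C p"
      and q: "q \<in> mat_projections C" "Y = projection_class C q"
      by (metis projection_semigroup_carrierE)
    show "X \<otimes>\<^bsub>projection_semigroup C\<^esub> Y \<in> carrier (projection_semigroup C)"
      by (simp add: p q mult proj projection_class_carrier)
    show "X \<otimes>\<^bsub>projection_semigroup C\<^esub> Y = Y \<otimes>\<^bsub>projection_semigroup C\<^esub> X"
      by (simp add: p q mult proj projection_class_eq_iff[OF C] mvn_direct_sum_commute[OF sC])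
    show "\<one>\<^bsub>projection_semigroup C\<^esub> \<otimes>\<^bsub>projection_semigroup C\<^esub> X = X"
      by (simp add: p one mult zero)
    fix Z assume "Z \<in> carrier (projection_semigroup C)"
    then obtain r where r: "r \<in> mat_projections C" "Z = projection_class C r"
      by (metis projection_semigroup_carrierE)
    show "X \<otimes>\<^bsub>projection_semigroup C\<^esub> Y \<otimes>\<^bsub>projection_semigroup C\<^esub> Z
        = X \<otimes>\<^bsub>projection_semigroup C\<^esub> (Y \<otimes>\<^bsub>projection_semigroup C\<^esub> Z)"
      by (simp add: p q r mult proj direct_sum_assoc)
  qed (simp add: one zero projection_class_carrier)
qed

context comm_monoid
begin

lemma grothendieck_equiv: "equiv (carrier G \<times> carrier G) (grothendieck_rel G)"
proof (rule equivI)
  show "grothendieck_rel G \<subseteq> (carrier G \<times> carrier G) \<times> (carrier G \<times> carrier G)"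
    by (auto simp: grothendieck_rel_def)
  show "refl_on (carrier G \<times> carrier G) (grothendieck_rel G)"
    by (auto simp: refl_on_def grothendieck_rel_def)
  show "sym (grothendieck_rel G)"
    by (rule symI) (auto simp: grothendieck_rel_def intro: sym)
  show "trans (grothendieck_rel G)"
  proof (rule transI, clarify)
    fix x y x' y' x'' y''
    assume "((x, y), (x', y')) \<in> grothendieck_rel G" "((x', y'), (x'', y'')) \<in> grothendieck_rel G"
    then obtain z w where c: "x \<in> carrier G" "y \<in> carrier G" "x' \<in> carrier G" "y' \<in> carrier G"
        "x'' \<in> carrier G" "y'' \<in> carrier G" "z \<in> carrier G" "w \<in> carrier G"
      and z: "x \<otimes> y' \<otimes> z = x' \<otimes> y \<otimes> z" and w: "x' \<otimes> y'' \<otimes> w = x'' \<otimes> y' \<otimes> w"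
      by (auto simp: grothendieck_rel_def)
    \<comment> \<open>The elements \<open>z\<close> and \<open>w\<close> come from the two relations; \<open>y'\<close> occurs on both sides after
      multiplying these, and need not be cancellable.\<close>
    have "x \<otimes> y'' \<otimes> (z \<otimes> w \<otimes> y') = (x \<otimes> y' \<otimes> z) \<otimes> (y'' \<otimes> w)"
      using c by (simp add: m_ac)
    also have "\<dots> = (x' \<otimes> y'' \<otimes> w) \<otimes> (y \<otimes> z)"
      unfolding z using c by (simp add: m_ac)
    also have "\<dots> = x'' \<otimes> y \<otimes> (z \<otimes> w \<otimes> y')"
      unfolding w using c by (simp add: m_ac)
    finally show "((x, y), (x'', y'')) \<in> grothendieck_rel G"
      using c by (auto simp: grothendieck_rel_def intro!: bexI[of _ "z \<otimes> w \<otimes> y'"])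
  qed
qed

lemma grothendieck_mult:
  assumes c: "x \<in> carrier G" "y \<in> carrier G" "x' \<in> carrier G" "y' \<in> carrier G"
  shows "grothendieck_rel G `` {(x, y)} \<otimes>\<^bsub>grothendieck_group G\<^esub> grothendieck_rel G `` {(x', y')}
    = grothendieck_rel G `` {(x \<otimes> x', y \<otimes> y')}"
proof -
  let ?R = "grothendieck_rel G"
  have eq: "?R `` {(a \<otimes> a', b \<otimes> b')} = ?R `` {(x \<otimes> x', y \<otimes> y')}"
    if "((x, y), (a, b)) \<in> ?R" "((x', y'), (a', b')) \<in> ?R" for a b a' b'
  proof -
    obtain z w where d: "a \<in> carrier G" "b \<in> carrier G" "a' \<in> carrier G" "b' \<in> carrier G"
        "z \<in> carrier G" "w \<in> carrier G"
      and z: "x \<otimes> b \<otimes> z = a \<otimes> y \<otimes> z" and w: "x' \<otimes> b' \<otimes> w = a' \<otimes> y' \<otimes> w"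
      using \<open>((x, y), (a, b)) \<in> ?R\<close> \<open>((x', y'), (a', b')) \<in> ?R\<close> by (auto simp: grothendieck_rel_def)
    have "x \<otimes> x' \<otimes> (b \<otimes> b') \<otimes> (z \<otimes> w) = (x \<otimes> b \<otimes> z) \<otimes> (x' \<otimes> b' \<otimes> w)"
      using c d by (simp add: m_ac)
    also have "\<dots> = a \<otimes> a' \<otimes> (y \<otimes> y') \<otimes> (z \<otimes> w)"
      unfolding z w using c d by (simp add: m_ac)
    finally have "((x \<otimes> x', y \<otimes> y'), (a \<otimes> a', b \<otimes> b')) \<in> ?R"
      using c d by (auto simp: grothendieck_rel_def intro!: bexI[of _ "z \<otimes> w"])
    from equiv_class_eq[OF grothendieck_equiv this] show ?thesis by simp
  qed
  have self: "((x, y), (x, y)) \<in> ?R" "((x', y'), (x', y')) \<in> ?R"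
    using c by (auto simp: grothendieck_rel_def)
  have "(\<Union>(a, b)\<in>?R `` {(x, y)}. \<Union>(a', b')\<in>?R `` {(x', y')}. ?R `` {(a \<otimes> a', b \<otimes> b')})
      = ?R `` {(x \<otimes> x', y \<otimes> y')}" (is "?L = ?T")
  proof
    show "?L \<subseteq> ?T" using eq by blast
    show "?T \<subseteq> ?L" using self by blast
  qed
  then show ?thesis
    by (simp add: grothendieck_group_def)
qed

lemma grothendieck_map_carrier: "x \<in> carrier G \<Longrightarrow> grothendieck_map G x \<in> carrier (grothendieck_group G)"
  by (simp add: grothendieck_map_def grothendieck_group_def quotientI)

lemma grothendieck_map_mult:
  "x \<in> carrier G \<Longrightarrow> y \<in> carrier G \<Longrightarrow>
    grothendieck_map G (x \<otimes> y) = grothendieck_map G x \<otimes>\<^bsub>grothendieck_group G\<^esub> grothendieck_map G y"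
  by (simp add: grothendieck_map_def grothendieck_mult)

lemma grothendieck_map_eqD:
  assumes "x \<in> carrier G" "y \<in> carrier G" "grothendieck_map G x = grothendieck_map G y"
  shows "\<exists>z\<in>carrier G. x \<otimes> z = y \<otimes> z"
proof -
  have "((x, \<one>), (y, \<one>)) \<in> grothendieck_rel G"
    using assms eq_equiv_class_iff[OF grothendieck_equiv, of "(x, \<one>)" "(y, \<one>)"]
    by (simp add: grothendieck_map_def)
  then show ?thesis
    using assms by (auto simp: grothendieck_rel_def)
qed

lemma grothendieck_difference:
  assumes "X \<in> carrier (grothendieck_group G)"
  obtains x y where "x \<in> carrier G" "y \<in> carrier G"
    "X \<otimes>\<^bsub>grothendieck_group G\<^esub> grothendieck_map G y = grothendieck_map G x"
proof -
  obtain x y where X: "X = grothendieck_rel G `` {(x, y)}" and c: "x \<in> carrier G" "y \<in> carrier G"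
    using assms by (auto simp: grothendieck_group_def elim!: quotientE)
  have "((x \<otimes> y, y), (x, \<one>)) \<in> grothendieck_rel G"
    using c by (auto simp: grothendieck_rel_def)
  then have "grothendieck_rel G `` {(x \<otimes> y, y)} = grothendieck_rel G `` {(x, \<one>)}"
    by (rule equiv_class_eq[OF grothendieck_equiv])
  then have "X \<otimes>\<^bsub>grothendieck_group G\<^esub> grothendieck_map G y = grothendieck_map G x"
    using c by (simp add: X grothendieck_map_def grothendieck_mult)
  with c that show ?thesis by blast
qed

end

section \<open>Cancellation and the integer-valued dimension\<close>

lemma star_subalgebra_unitization:
  assumes "star_subalgebra (C :: 'a::involutive_algebra set)"
  shows "star_subalgebra (unitization C)"
proof -
  have "subalgebra C" "\<And>a. a \<in> C \<Longrightarrow> star a \<in> C"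
    using assms by (auto simp: star_subalgebra_def)
  note C = subalgebraD[OF this(1)] this(2)
  have 1: "x + y \<in> unitization C \<and> x * y \<in> unitization C" if "x \<in> unitization C" "y \<in> unitization C" for x y
    using that by (cases x; cases y) (auto simp: unitization_def C)
  have 2: "c *\<^sub>C x \<in> unitization C \<and> star x \<in> unitization C" if "x \<in> unitization C" for c x
    using that by (cases x) (auto simp: unitization_def C)
  show ?thesis
    using 1 2 by (auto simp: star_subalgebra_def subalgebra_def) (auto simp: unitization_def zero_unitized_def C)
qed

abbreviation unitize :: "'a::involutive_algebra \<Rightarrow> 'a unitized"
  where "unitize a \<equiv> Unitized a 0"

lemma unitize_sum: "(\<Sum>i\<in>I. unitize (f i)) = unitize (sum f I)"
  by (induction I rule: infinite_finite_induct) (auto simp: zero_unitized_def)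

lemma map_unitize_mult:
  fixes M N :: "'a::involutive_algebra mat"
  assumes M: "M \<in> carrier_mat m n" and N: "N \<in> carrier_mat n l"
  shows "map_mat unitize M * map_mat unitize N = map_mat unitize (M * N)"
proof (rule eq_matI)
  fix i j assume "i < dim_row (map_mat unitize (M * N))" "j < dim_col (map_mat unitize (M * N))"
  then have ij: "i < m" "j < l" using M N by auto
  have cM: "map_mat unitize M \<in> carrier_mat m n" and cN: "map_mat unitize N \<in> carrier_mat n l"
    using M N by auto
  have "(map_mat unitize M * map_mat unitize N) $$ (i, j)
      = (\<Sum>k<n. map_mat unitize M $$ (i, k) * map_mat unitize N $$ (k, j))"
    by (rule mult_mat_index[OF cM cN ij])
  also have "\<dots> = (\<Sum>k<n. unitize (M $$ (i, k) * N $$ (k, j)))"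
    using M N ij by (intro sum.cong) auto
  also have "\<dots> = unitize ((M * N) $$ (i, j))"
    by (simp add: unitize_sum mult_mat_index[OF M N ij] del: index_mult_mat)
  finally show "(map_mat unitize M * map_mat unitize N) $$ (i, j) = map_mat unitize (M * N) $$ (i, j)"
    using M N ij by simp
qed auto

lemma map_unitize_star: "mat_star (map_mat unitize M) = map_mat unitize (mat_star M)"
  by (rule eq_matI) auto

lemma map_unitize_direct_sum: "map_mat unitize (M \<oplus>\<^sub>m N) = map_mat unitize M \<oplus>\<^sub>m map_mat unitize N"
  by (rule eq_matI) (auto simp: direct_sum_index zero_unitized_def)

lemma map_unitize_inject: "map_mat unitize M = map_mat unitize N \<Longrightarrow> M = N"
proof (rule eq_matI)
  assume eq: "map_mat unitize M = map_mat unitize N"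
  show d: "dim_row M = dim_row N" "dim_col M = dim_col N"
    using arg_cong[OF eq, of dim_row] arg_cong[OF eq, of dim_col] by auto
  fix i j assume "i < dim_row N" "j < dim_col N"
  then show "M $$ (i, j) = N $$ (i, j)"
    using arg_cong[OF eq, of "\<lambda>A. A $$ (i, j)"] d by simp
qed

lemma map_unitize_projection:
  assumes "p \<in> mat_projections C"
  shows "map_mat unitize p \<in> mat_projections (unitization C)"
proof -
  obtain n where n: "p \<in> matrices_over n n C" and cp: "p \<in> carrier_mat n n"
    using assms by (rule mat_projectionsE)
  have "map_mat unitize p \<in> matrices_over n n (unitization C)"
    using n by (auto simp: matrices_over_iff unitization_def)
  then show ?thesis
    using mat_projectionsD[OF assms] map_unitize_mult[OF cp cp]
    by (auto simp: mat_projections_def map_unitize_star)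
qed

lemma scalar_part_hom [simp]:
  "scalar_part (x + y) = scalar_part x + scalar_part y" "scalar_part (x * y) = scalar_part x * scalar_part y"
  "scalar_part (star x) = cnj (scalar_part x)" "scalar_part 0 = 0"
  by (cases x; cases y; simp add: zero_unitized_def)+

lemma scalar_part_sum: "scalar_part (sum f I) = (\<Sum>i\<in>I. scalar_part (f i))"
  by (induction I rule: infinite_finite_induct) auto

text \<open>Scalar parts form a \<open>*\<close>-homomorphism to the complex numbers. If \<open>star v * v\<close> has entries
  in \<open>C\<close>, then the sums of squares of the scalar parts in the columns of \<open>v\<close> vanish, so \<open>v\<close>
  has entries in \<open>C\<close>, too.\<close>

lemma mvn_unitization_iff:
  assumes C: "star_subalgebra (C :: 'a::involutive_algebra set)"
    and p: "p \<in> mat_projections C" and q: "q \<in> mat_projections C"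
  shows "(map_mat unitize p, map_mat unitize q) \<in> murray_von_neumann (unitization C)
    \<longleftrightarrow> (p, q) \<in> murray_von_neumann C"
proof
  assume "(map_mat unitize p, map_mat unitize q) \<in> murray_von_neumann (unitization C)"
  then obtain m n v where cp: "map_mat unitize p \<in> carrier_mat n n"
    and v: "v \<in> matrices_over m n (unitization C)"
      "mat_star v * v = map_mat unitize p" "v * mat_star v = map_mat unitize q"
    by (rule mvnE)
  note cv = matrices_over_carrier[OF v(1)]
  have sc: "scalar_part (v $$ (i, j)) = 0" if ij: "i < m" "j < n" for i j
  proof -
    have "complex_of_real (\<Sum>k<m. (cmod (scalar_part (v $$ (k, j))))\<^sup>2)
        = (\<Sum>k<m. cnj (scalar_part (v $$ (k, j))) * scalar_part (v $$ (k, j)))"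
      unfolding of_real_sum complex_norm_square by (simp add: mult.commute)
    also have "\<dots> = scalar_part ((mat_star v * v) $$ (j, j))"
      unfolding mult_mat_index[OF mat_star_carrier[OF cv] cv ij(2) ij(2)] scalar_part_sum
      using cv ij by (intro sum.cong) auto
    also have "\<dots> = 0"
      unfolding v(2) using cp ij by simp
    finally have "(\<Sum>k<m. (cmod (scalar_part (v $$ (k, j))))\<^sup>2) = 0"
      unfolding of_real_eq_0_iff .
    then show ?thesis
      using ij by (simp add: sum_nonneg_eq_0_iff)
  qed
  define w where "w = map_mat alg_part v"
  have w: "w \<in> matrices_over m n C"
    using v(1) by (auto simp: matrices_over_iff w_def unitization_def)
  note cw = matrices_over_carrier[OF w]
  have vw: "v = map_mat unitize w"
  proof (rule eq_matI)
    fix i j assume "i < dim_row (map_mat unitize w)" "j < dim_col (map_mat unitize w)"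
    then have "i < m" "j < n" using cw by auto
    then show "v $$ (i, j) = map_mat unitize w $$ (i, j)"
      using sc[of i j] cv cw by (cases "v $$ (i, j)") (simp add: w_def)
  qed (use cv cw in auto)
  have "mat_star w * w = p"
    using v(2) unfolding vw map_unitize_star map_unitize_mult[OF mat_star_carrier[OF cw] cw]
    by (rule map_unitize_inject)
  moreover have "w * mat_star w = q"
    using v(3) unfolding vw map_unitize_star map_unitize_mult[OF cw mat_star_carrier[OF cw]]
    by (rule map_unitize_inject)
  ultimately show "(p, q) \<in> murray_von_neumann C"
    by (rule mvnI[OF p q w])
next
  assume "(p, q) \<in> murray_von_neumann C"
  then obtain m n v where v: "v \<in> matrices_over m n C" "mat_star v * v = p" "v * mat_star v = q"
    by (rule mvnE)
  note cv = matrices_over_carrier[OF v(1)]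
  show "(map_mat unitize p, map_mat unitize q) \<in> murray_von_neumann (unitization C)"
  proof (rule mvnI[OF map_unitize_projection[OF p] map_unitize_projection[OF q]])
    show "map_mat unitize v \<in> matrices_over m n (unitization C)"
      using v(1) by (auto simp: matrices_over_iff unitization_def)
  qed (simp_all add: map_unitize_star map_unitize_mult[OF mat_star_carrier[OF cv] cv]
      map_unitize_mult[OF cv mat_star_carrier[OF cv]] v)
qed

text \<open>Cancellation refers to matrices over the unitization, but equivalences of projections over
  \<open>C\<close> are the same in \<open>C\<close> and in its unitization.\<close>

lemma cancellation_mvn:
  assumes C: "star_subalgebra (C :: 'a::involutive_algebra set)" and canc: "has_cancellation C"
    and pqr: "p \<in> mat_projections C" "q \<in> mat_projections C" "r \<in> mat_projections C"
    and "(p \<oplus>\<^sub>m r, q \<oplus>\<^sub>m r) \<in> murray_von_neumann C"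
  shows "(p, q) \<in> murray_von_neumann C"
proof -
  let ?U = "unitization C" and ?j = "map_mat unitize"
  have sC: "subalgebra C" using C by (simp add: star_subalgebra_def)
  note U = star_subalgebra_unitization[OF C]
  have sU: "subalgebra ?U" using U by (simp add: star_subalgebra_def)
  note proj = map_unitize_projection[OF pqr(1)] map_unitize_projection[OF pqr(2)] map_unitize_projection[OF pqr(3)]
  have "(?j p \<oplus>\<^sub>m ?j r, ?j q \<oplus>\<^sub>m ?j r) \<in> murray_von_neumann ?U"
    using assms(6) mvn_unitization_iff[OF C direct_sum_projection[OF sC pqr(1,3)] direct_sum_projection[OF sC pqr(2,3)]]
    by (simp add: map_unitize_direct_sum)
  then have "projection_class ?U (?j p \<oplus>\<^sub>m ?j r) = projection_class ?U (?j q \<oplus>\<^sub>m ?j r)"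
    using projection_class_eq_iff[OF U] direct_sum_projection[OF sU] proj by blast
  then have "projection_class ?U (?j p) \<otimes>\<^bsub>projection_semigroup ?U\<^esub> projection_class ?U (?j r)
      = projection_class ?U (?j q) \<otimes>\<^bsub>projection_semigroup ?U\<^esub> projection_class ?U (?j r)"
    by (simp add: projection_class_mult[OF U] proj)
  then have "projection_class ?U (?j p) = projection_class ?U (?j q)"
    using canc projection_class_carrier proj unfolding has_cancellation_def Let_def by blast
  then have "(?j p, ?j q) \<in> murray_von_neumann ?U"
    by (simp add: projection_class_eq_iff[OF U] proj)
  then show ?thesis
    by (simp add: mvn_unitization_iff[OF C pqr(1,2)])
qed

text \<open>An identification of \<open>K\<^sub>0(C)\<close> with the integers turns into a dimension function on
  projections; by cancellation it is a complete invariant for Murray-von Neumann equivalence.\<close>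

lemma K0_dimension:
  fixes C :: "'a::involutive_algebra set"
  assumes C: "star_subalgebra C" and canc: "has_cancellation C" and \<theta>: "\<theta> \<in> K0_identifications C"
  shows dimension_add: "p \<in> mat_projections C \<Longrightarrow> q \<in> mat_projections C \<Longrightarrow>
      \<theta> (K0_class C (p \<oplus>\<^sub>m q)) = \<theta> (K0_class C p) + \<theta> (K0_class C q)"
    and dimension_nonneg: "p \<in> mat_projections C \<Longrightarrow> 0 \<le> \<theta> (K0_class C p)"
    and dimension_eq_iff: "p \<in> mat_projections C \<Longrightarrow> q \<in> mat_projections C \<Longrightarrow>
      \<theta> (K0_class C p) = \<theta> (K0_class C q) \<longleftrightarrow> (p, q) \<in> murray_von_neumann C"
    and dimension_generates: "\<exists>p\<in>mat_projections C. \<exists>q\<in>mat_projections C.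
      \<theta> (K0_class C p) - \<theta> (K0_class C q) = 1"
proof -
  let ?D = "projection_semigroup C"
  have sC: "subalgebra C" using C by (simp add: star_subalgebra_def)
  interpret D: comm_monoid ?D
    by (rule projection_semigroup_comm_monoid[OF C])
  have hom: "\<theta> (X \<otimes>\<^bsub>K0 C\<^esub> Y) = \<theta> X + \<theta> Y" if "X \<in> carrier (K0 C)" "Y \<in> carrier (K0 C)" for X Y
    using \<theta> that by (auto simp: K0_identifications_def iso_def hom_def)
  have bij: "bij_betw \<theta> (carrier (K0 C)) UNIV"
    using \<theta> by (auto simp: K0_identifications_def iso_def)
  have car: "K0_class C p \<in> carrier (K0 C)" if "p \<in> mat_projections C" for p
    unfolding K0_class_def K0_def by (intro D.grothendieck_map_carrier projection_class_carrier that)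
  show add: "\<theta> (K0_class C (p \<oplus>\<^sub>m q)) = \<theta> (K0_class C p) + \<theta> (K0_class C q)"
    if pq: "p \<in> mat_projections C" "q \<in> mat_projections C" for p q
  proof -
    have "K0_class C (p \<oplus>\<^sub>m q) = K0_class C p \<otimes>\<^bsub>K0 C\<^esub> K0_class C q"
      unfolding K0_class_def K0_def projection_class_mult[OF C pq, symmetric]
      by (intro D.grothendieck_map_mult projection_class_carrier pq)
    then show ?thesis
      by (simp add: hom car pq)
  qed
  show "0 \<le> \<theta> (K0_class C p)" if "p \<in> mat_projections C" for p
    using \<theta> that by (auto simp: K0_identifications_def K0_pos_def)
  show "\<theta> (K0_class C p) = \<theta> (K0_class C q) \<longleftrightarrow> (p, q) \<in> murray_von_neumann C"
    if pq: "p \<in> mat_projections C" "q \<in> mat_projections C" for p q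
  proof
    assume "\<theta> (K0_class C p) = \<theta> (K0_class C q)"
    then have "K0_class C p = K0_class C q"
      using bij car pq by (auto simp: bij_betw_def inj_on_def)
    then obtain Z where Z: "Z \<in> carrier ?D"
      and eq: "projection_class C p \<otimes>\<^bsub>?D\<^esub> Z = projection_class C q \<otimes>\<^bsub>?D\<^esub> Z"
      unfolding K0_class_def using D.grothendieck_map_eqD projection_class_carrier pq by meson
    obtain r where r: "r \<in> mat_projections C" and Zr: "Z = projection_class C r"
      using Z by (rule projection_semigroup_carrierE)
    have "projection_class C (p \<oplus>\<^sub>m r) = projection_class C (q \<oplus>\<^sub>m r)"
      using eq by (simp add: Zr projection_class_mult[OF C] pq r)
    then have "(p \<oplus>\<^sub>m r, q \<oplus>\<^sub>m r) \<in> murray_von_neumann C"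
      by (simp add: projection_class_eq_iff[OF C] direct_sum_projection[OF sC] pq r)
    then show "(p, q) \<in> murray_von_neumann C"
      by (rule cancellation_mvn[OF C canc pq r])
  next
    assume "(p, q) \<in> murray_von_neumann C"
    then have "projection_class C p = projection_class C q"
      by (simp add: projection_class_eq_iff[OF C] pq)
    then show "\<theta> (K0_class C p) = \<theta> (K0_class C q)"
      by (simp add: K0_class_def)
  qed
  obtain X where X: "X \<in> carrier (K0 C)" "\<theta> X = 1"
    using bij by (metis UNIV_I bij_betw_def imageE)
  obtain x y where xy: "x \<in> carrier ?D" "y \<in> carrier ?D"
    and diff: "X \<otimes>\<^bsub>K0 C\<^esub> grothendieck_map ?D y = grothendieck_map ?D x"
    using X(1) unfolding K0_def by (rule D.grothendieck_difference)
  obtain p q where pq: "p \<in> mat_projections C" "q \<in> mat_projections C"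
    "x = projection_class C p" "y = projection_class C q"
    using xy by (metis projection_semigroup_carrierE)
  have "X \<otimes>\<^bsub>K0 C\<^esub> K0_class C q = K0_class C p"
    using diff by (simp add: K0_class_def pq)
  then have "1 + \<theta> (K0_class C q) = \<theta> (K0_class C p)"
    using hom[OF X(1) car[OF pq(2)]] X(2) by simp
  then show "\<exists>p\<in>mat_projections C. \<exists>q\<in>mat_projections C. \<theta> (K0_class C p) - \<theta> (K0_class C q) = 1"
    using pq by (intro bexI[of _ p] bexI[of _ q]) auto
qed

lemma unit_of_eq: "is_unit_of e A \<Longrightarrow> unit_of A = e"
  unfolding unit_of_def by (rule the_equality) (auto simp: is_unit_of_def)

section \<open>Operator matrices on square-summable sequences\<close>

lift_definition l2_single :: "nat \<Rightarrow> 'a::complex_hilbert \<Rightarrow> 'a l2"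
  is "\<lambda>n x k. if k = n then x else 0"
  subgoal for n x
    by (rule summable_finite[of "{n}"]) auto
  done

lemma l2_nth_single [simp]: "l2_nth (l2_single n x) k = (if k = n then x else 0)"
  by transfer simp

lemma l2_nth_scaleC [simp]: "l2_nth (c *\<^sub>C f) n = c *\<^sub>C l2_nth f n"
  by transfer simp

lemma l2_nth_sum [simp]: "l2_nth (sum f I) n = (\<Sum>i\<in>I. l2_nth (f i) n)"
  by (induction I rule: infinite_finite_induct) auto

lemma l2_single_add: "l2_single n (x + y) = l2_single n x + l2_single n y"
  by (rule l2_eqI) simp

lemma l2_single_scaleC: "l2_single n (c *\<^sub>C x) = c *\<^sub>C l2_single n x"
  by (rule l2_eqI) simp

lemma l2_single_zero [simp]: "l2_single n 0 = 0"
  by (rule l2_eqI) simp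

lemma norm_l2_finite:
  fixes f :: "'a::complex_hilbert l2"
  assumes "\<And>k. k \<ge> n \<Longrightarrow> l2_nth f k = 0"
  shows "(norm f)\<^sup>2 = (\<Sum>k<n. (norm (l2_nth f k))\<^sup>2)"
  unfolding norm_l2_sq by (rule suminf_finite) (auto simp: assms)

lemma norm_l2_single [simp]: "norm (l2_single n x) = norm (x :: 'a::complex_hilbert)"
proof -
  have "(norm (l2_single n x))\<^sup>2 = (\<Sum>k\<in>{n}. (norm (l2_nth (l2_single n x) k))\<^sup>2)"
    unfolding norm_l2_sq by (rule suminf_finite) auto
  then show ?thesis by simp
qed

lemma cinner_l2: "cinner f g = (\<Sum>n. cinner (l2_nth f n) (l2_nth g n))"
  by transfer simp

lemma cinner_single_left: "cinner (l2_single n x) f = cinner x (l2_nth f n)"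
proof -
  have "cinner (l2_single n x) f = (\<Sum>k\<in>{n}. cinner (l2_nth (l2_single n x) k) (l2_nth f k))"
    unfolding cinner_l2 by (rule suminf_finite) auto
  then show ?thesis by simp
qed

lemma cinner_single_right: "cinner f (l2_single n x) = cinner (l2_nth f n) x"
  by (metis cinner_commute cinner_single_left)

definition entry :: "'a::complex_hilbert l2 bop \<Rightarrow> nat \<Rightarrow> nat \<Rightarrow> 'a bop"
  where "entry T i j = mk_bop (\<lambda>x. l2_nth (bop_apply T (l2_single j x)) i)"

lemma entry_apply [simp]: "bop_apply (entry T i j) x = l2_nth (bop_apply T (l2_single j x)) i"
  unfolding entry_def
proof (rule mk_bop_apply[where K = "norm T"])
  fix x
  have "norm (l2_nth (bop_apply T (l2_single j x)) i) \<le> norm (bop_apply T (l2_single j x))"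
    by (rule norm_l2_nth_le)
  also have "\<dots> \<le> norm T * norm x"
    using norm_bop_apply[of T "l2_single j x"] by simp
  finally show "norm (l2_nth (bop_apply T (l2_single j x)) i) \<le> norm T * norm x" .
qed (simp_all add: l2_single_add l2_single_scaleC bop_apply_add_right bop_apply_scaleC_right)

text \<open>The elementary tensor of \<open>a\<close> with the matrix unit at position \<open>(i, j)\<close>.\<close>

definition embed :: "'a::complex_hilbert bop \<Rightarrow> nat \<Rightarrow> nat \<Rightarrow> 'a l2 bop"
  where "embed a i j = mk_bop (\<lambda>f. l2_single i (bop_apply a (l2_nth f j)))"

lemma embed_apply [simp]: "bop_apply (embed a i j) f = l2_single i (bop_apply a (l2_nth f j))"
  unfolding embed_def
proof (rule mk_bop_apply[where K = "norm a"])
  fix f :: "'a l2"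
  have "norm (bop_apply a (l2_nth f j)) \<le> norm a * norm (l2_nth f j)"
    by (rule norm_bop_apply)
  also have "\<dots> \<le> norm a * norm f"
    by (intro mult_left_mono norm_l2_nth_le norm_ge_zero)
  finally show "norm (l2_single i (bop_apply a (l2_nth f j))) \<le> norm a * norm f"
    by simp
qed (simp_all add: l2_single_add l2_single_scaleC bop_apply_add_right bop_apply_scaleC_right)

lemma entry_add [simp]: "entry (S + T) i j = entry S i j + entry T i j"
  by (rule bop_eqI) simp

lemma entry_diff [simp]: "entry (S - T) i j = entry S i j - entry T i j"
  by (rule bop_eqI) simp

lemma entry_zero [simp]: "entry 0 i j = 0"
  by (rule bop_eqI) simp

lemma entry_scaleC [simp]: "entry (c *\<^sub>C T) i j = c *\<^sub>C entry T i j"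
  by (rule bop_eqI) simp

lemma entry_sum [simp]: "entry (sum f I) i j = (\<Sum>k\<in>I. entry (f k) i j)"
  by (induction I rule: infinite_finite_induct) auto

lemma norm_entry_le: "norm (entry T i j) \<le> norm T"
proof (rule norm_bop_bound)
  fix x
  have "norm (l2_nth (bop_apply T (l2_single j x)) i) \<le> norm (bop_apply T (l2_single j x))"
    by (rule norm_l2_nth_le)
  also have "\<dots> \<le> norm T * norm x"
    using norm_bop_apply[of T "l2_single j x"] by simp
  finally show "norm (bop_apply (entry T i j) x) \<le> norm T * norm x" by simp
qed simp

lemma bounded_linear_entry: "bounded_linear (\<lambda>T. entry T i j)"
proof (rule bounded_linear_intro[where K = 1])
  show "entry (r *\<^sub>R T) i j = r *\<^sub>R entry T i j" for r T
    by (simp flip: scaleC_of_real)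
qed (simp_all add: norm_entry_le)

lemma tendsto_entry [tendsto_intros]:
  "(F \<longlongrightarrow> T) G \<Longrightarrow> ((\<lambda>n. entry (F n) i j) \<longlongrightarrow> entry T i j) G"
  by (rule bounded_linear.tendsto[OF bounded_linear_entry])

lemma entry_star: "entry (star T) i j = star (entry T j i)"
proof (rule star_eqI[symmetric])
  fix x y
  have "cinner (bop_apply (entry T j i) x) y = cinner (bop_apply T (l2_single i x)) (l2_single j y)"
    by (simp add: cinner_single_right)
  also have "\<dots> = cinner x (bop_apply (entry (star T) i j) y)"
    by (simp add: cinner_star cinner_single_left)
  finally show "cinner (bop_apply (entry T j i) x) y = cinner x (bop_apply (entry (star T) i j) y)" .
qed

lemma embed_add: "embed (a + b) i j = embed a i j + embed b i j"
  by (rule bop_eqI) (simp add: l2_single_add)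

lemma embed_scaleC: "embed (c *\<^sub>C a) i j = c *\<^sub>C embed a i j"
  by (rule bop_eqI) (simp add: l2_single_scaleC)

lemma embed_zero [simp]: "embed 0 i j = 0"
  by (rule bop_eqI) simp

lemma embed_mult: "embed a i j * embed b k l = (if j = k then embed (a * b) i l else 0)"
  by (rule bop_eqI) simp

lemma embed_star: "star (embed a i j) = embed (star a) j i"
  by (rule star_eqI) (simp add: cinner_single_left cinner_single_right cinner_star)

lemma entry_embed [simp]: "entry (embed a i j) k l = (if k = i \<and> l = j then a else 0)"
  by (rule bop_eqI) simp

definition coord_proj :: "nat \<Rightarrow> 'a::complex_hilbert l2 bop" ("E")
  where "E n = (\<Sum>i<n. embed 1 i i)"

lemma coord_proj_nth [simp]: "l2_nth (bop_apply (E n) f) k = (if k < n then l2_nth f k else 0)"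
  by (simp add: coord_proj_def)

lemma coord_proj_apply: "bop_apply (E n) f = (\<Sum>j<n. l2_single j (l2_nth f j))"
  by (rule l2_eqI) simp

lemma coord_proj_mult: "E m * E n = E (min m n)"
  by (rule bop_eqI, rule l2_eqI) simp

lemma coord_proj_idem [simp]: "E n * E n = E n" "E n * (E n * T) = E n * T"
  by (simp_all add: coord_proj_mult flip: mult.assoc)

lemma coord_proj_star [simp]: "star (E n) = E n"
  by (simp add: coord_proj_def star_sum embed_star)

lemma norm_coord_proj_apply: "norm (bop_apply (E n) f) \<le> norm f"
proof (rule power2_le_imp_le)
  have "(norm (bop_apply (E n) f))\<^sup>2 = (\<Sum>k<n. (norm (l2_nth f k))\<^sup>2)"
    by (subst norm_l2_finite[of n]) auto
  also have "\<dots> \<le> (norm f)\<^sup>2"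
    by (rule sum_norm_l2_le)
  finally show "(norm (bop_apply (E n) f))\<^sup>2 \<le> (norm f)\<^sup>2" .
qed simp

lemma norm_coord_proj_le: "norm (E n) \<le> 1"
  by (rule norm_bop_bound) (auto simp: norm_coord_proj_apply)

lemma norm_coord_proj_mult_le:
  fixes T :: "'a::complex_hilbert l2 bop"
  shows "norm (E n * T) \<le> norm T" "norm (T * E n) \<le> norm T"
  using norm_mult_ineq[of "E n" T] norm_mult_ineq[of T "E n"]
    mult_right_mono[OF norm_coord_proj_le[where 'a = 'a, of n], of "norm T"]
    mult_left_mono[OF norm_coord_proj_le[where 'a = 'a, of n], of "norm T"]
  unfolding mult_1_left mult_1_right by auto

lemma tendsto_coord_proj: "(\<lambda>n. bop_apply (E n) f) \<longlonglongrightarrow> f"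
proof -
  let ?a = "\<lambda>n. (norm (l2_nth f n))\<^sup>2"
  have "(norm (f - bop_apply (E m) f))\<^sup>2 = (\<Sum>n. ?a n) - (\<Sum>n<m. ?a n)" for m
  proof -
    have "(\<lambda>n. if n \<in> {..<m} then ?a n else 0) sums (\<Sum>n<m. ?a n)"
      by (rule sums_If_finite_set) simp
    then have "(\<lambda>n. ?a n - (if n \<in> {..<m} then ?a n else 0)) sums ((\<Sum>n. ?a n) - (\<Sum>n<m. ?a n))"
      by (rule sums_diff[OF summable_sums[OF summable_l2]])
    also have "(\<lambda>n. ?a n - (if n \<in> {..<m} then ?a n else 0))
        = (\<lambda>n. (norm (l2_nth (f - bop_apply (E m) f) n))\<^sup>2)"
      by (rule ext) simp
    finally show ?thesis
      unfolding norm_l2_sq by (rule sums_unique[symmetric])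
  qed
  moreover have "(\<lambda>m. (\<Sum>n. ?a n) - (\<Sum>n<m. ?a n)) \<longlonglongrightarrow> (\<Sum>n. ?a n) - (\<Sum>n. ?a n)"
    by (intro tendsto_diff tendsto_const summable_LIMSEQ summable_l2)
  ultimately have "(\<lambda>m. (norm (f - bop_apply (E m) f))\<^sup>2) \<longlonglongrightarrow> 0"
    by simp
  then have "(\<lambda>m. sqrt ((norm (f - bop_apply (E m) f))\<^sup>2)) \<longlonglongrightarrow> sqrt 0"
    by (rule tendsto_real_sqrt)
  then have "(\<lambda>m. dist (bop_apply (E m) f) f) \<longlonglongrightarrow> 0"
    by (simp add: dist_norm norm_minus_commute)
  then show ?thesis
    by (subst tendsto_dist_iff)
qed

lemma entry_eqI:
  fixes S T :: "'a::complex_hilbert l2 bop"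
  assumes "\<And>i j. entry S i j = entry T i j"
  shows "S = T"
proof (rule bop_eqI)
  fix f
  have "bop_apply S (l2_single j x) = bop_apply T (l2_single j x)" for j x
  proof (rule l2_eqI)
    fix i
    show "l2_nth (bop_apply S (l2_single j x)) i = l2_nth (bop_apply T (l2_single j x)) i"
      using arg_cong[OF assms[of i j], of "\<lambda>a. bop_apply a x"] by simp
  qed
  then have eq: "bop_apply S (bop_apply (E n) f) = bop_apply T (bop_apply (E n) f)" for n
    by (simp add: coord_proj_apply bop_apply_sum_right)
  have "(\<lambda>n. bop_apply R (bop_apply (E n) f)) \<longlonglongrightarrow> bop_apply R f" for R
    by (rule bounded_linear.tendsto[OF bounded_linear_bop_apply tendsto_coord_proj])
  from this[of S] this[of T] show "bop_apply S f = bop_apply T f"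
    unfolding eq by (rule LIMSEQ_unique)
qed

lemma entry_coord_proj_left: "entry (E n * T) i j = (if i < n then entry T i j else 0)"
  by (rule bop_eqI) simp

lemma entry_coord_proj_right:
  fixes T :: "'a::complex_hilbert l2 bop"
  shows "entry (T * E n) i j = (if j < n then entry T i j else 0)"
proof (rule bop_eqI)
  fix x :: 'a
  have "bop_apply (E n) (l2_single j x) = (if j < n then l2_single j x else 0)"
    by (rule l2_eqI) auto
  then show "bop_apply (entry (T * E n) i j) x = bop_apply (if j < n then entry T i j else 0) x"
    by simp
qed

lemma entry_mult_embed:
  "entry (S * embed a i j * T) k l = entry S k i * a * entry T j l"
  by (rule bop_eqI) simp

text \<open>The cut-off makes the product of infinite matrices a finite sum; the entries of \<open>S * T\<close> are
  limits of such sums as soon as \<open>S * E n\<close> converges to \<open>S\<close>.\<close>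

lemma entry_mult_coord_proj: "entry (S * E n * T) i j = (\<Sum>k<n. entry S i k * entry T k j)"
proof -
  have "S * E n * T = (\<Sum>k<n. S * embed 1 k k * T)"
    by (simp add: coord_proj_def sum_distrib_left sum_distrib_right)
  then show ?thesis
    by (simp add: entry_mult_embed)
qed

definition opmat :: "'a::complex_hilbert bop mat \<Rightarrow> 'a l2 bop"
  where "opmat M = (\<Sum>i<dim_row M. \<Sum>j<dim_col M. embed (M $$ (i, j)) i j)"

lemma entry_opmat: "entry (opmat M) i j = (if i < dim_row M \<and> j < dim_col M then M $$ (i, j) else 0)"
proof -
  have "entry (opmat M) i j = (\<Sum>k<dim_row M. if i = k then (\<Sum>l<dim_col M. if j = l then M $$ (k, l) else 0) else 0)"
    unfolding opmat_def entry_sum by (intro sum.cong refl) (auto intro!: sum.neutral sum.cong)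
  then show ?thesis
    by simp
qed

lemma coord_proj_opmat: "E m * T * E n = opmat (mat m n (\<lambda>(i, j). entry T i j))"
  by (rule entry_eqI) (simp add: entry_opmat entry_coord_proj_left entry_coord_proj_right)

lemma opmat_inject:
  assumes "opmat M = opmat N" "M \<in> carrier_mat m n" "N \<in> carrier_mat m n"
  shows "M = N"
proof (rule eq_matI)
  fix i j assume "i < dim_row N" "j < dim_col N"
  moreover have "entry (opmat M) i j = entry (opmat N) i j"
    by (simp only: assms(1))
  ultimately show "M $$ (i, j) = N $$ (i, j)"
    using assms(2,3) by (simp add: entry_opmat)
qed (use assms in auto)

text \<open>A finite operator matrix acts in the upper left corner of its format.\<close>

lemma opmat_absorb:
  assumes "M \<in> carrier_mat m n"
  shows "E m * opmat M = opmat M" "opmat M * E n = opmat M"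
  by (rule entry_eqI; use assms in \<open>auto simp: entry_opmat entry_coord_proj_left entry_coord_proj_right\<close>)+

lemma opmat_mult:
  assumes M: "M \<in> carrier_mat m n" and N: "N \<in> carrier_mat n l"
  shows "opmat (M * N) = opmat M * opmat N"
proof (rule entry_eqI)
  fix i j
  have "entry (opmat M * opmat N) i j = entry (opmat M * E n * opmat N) i j"
    by (simp add: opmat_absorb[OF M])
  also have "\<dots> = (\<Sum>k<n. entry (opmat M) i k * entry (opmat N) k j)"
    by (rule entry_mult_coord_proj)
  also have "\<dots> = entry (opmat (M * N)) i j"
    using M N by (auto simp: entry_opmat mult_mat_index[OF M N] simp del: index_mult_mat(1))
  finally show "entry (opmat (M * N)) i j = entry (opmat M * opmat N) i j" ..
qed

lemma opmat_star: "opmat (mat_star M) = star (opmat M)"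
  by (rule entry_eqI) (auto simp: entry_opmat entry_star)

lemma opmat_direct_sum:
  assumes "M \<in> carrier_mat m n" "N \<in> carrier_mat k l"
  shows "opmat (M \<oplus>\<^sub>m N) = opmat (M \<oplus>\<^sub>m 0\<^sub>m k l) + opmat (0\<^sub>m m n \<oplus>\<^sub>m N)"
  by (rule entry_eqI) (use assms in \<open>auto simp: entry_opmat direct_sum_index\<close>)

section \<open>The stabilization as an algebra of operator matrices\<close>

text \<open>The matrix picture of \<open>A \<otimes>\<^sub>s\<^sub>p \<K>\<close>: convergence of the corners is what remains of the second
  tensor factors being compact.\<close>

definition stab :: "'a::complex_hilbert bop set \<Rightarrow> 'a l2 bop set"
  where "stab A = {T. (\<forall>i j. entry T i j \<in> A) \<and> (\<lambda>n. E n * T * E n) \<longlonglongrightarrow> T}"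

lemma stabD:
  assumes "T \<in> stab A"
  shows "entry T i j \<in> A" "(\<lambda>n. E n * T * E n) \<longlonglongrightarrow> T"
  using assms by (auto simp: stab_def)

text \<open>In contrast to the truncations on both sides, the one-sided ones are compatible with products.
  All of them are contractive, which gives the estimates.\<close>

lemma truncation_tendsto_iff:
  fixes T :: "'a::complex_hilbert l2 bop"
  shows "(\<lambda>n. E n * T * E n) \<longlonglongrightarrow> T \<longleftrightarrow> (\<lambda>n. E n * T) \<longlonglongrightarrow> T \<and> (\<lambda>n. T * E n) \<longlonglongrightarrow> T"
proof -
  have lim: "X \<longlonglongrightarrow> T" if "Y \<longlonglongrightarrow> T" "Z \<longlonglongrightarrow> T" "\<And>n. norm (X n - T) \<le> norm (Y n - T) + norm (Z n - T)"
    for X Y Z :: "nat \<Rightarrow> 'a l2 bop"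
  proof (rule LIM_zero_cancel, rule Lim_null_comparison[OF always_eventually[OF allI]])
    show "norm (X n - T) \<le> norm (Y n - T) + norm (Z n - T)" for n by fact
    show "(\<lambda>n. norm (Y n - T) + norm (Z n - T)) \<longlonglongrightarrow> 0"
      using that(1,2) by (auto simp: LIM_zero_iff tendsto_norm_zero_iff intro!: tendsto_add_zero)
  qed
  have le: "norm (R + Y) \<le> norm Z + norm Y" if "norm R \<le> norm Z" for R Y Z :: "'a l2 bop"
    using norm_triangle_ineq[of R Y] that by linarith
  show ?thesis
  proof (intro iffI conjI)
    assume t: "(\<lambda>n. E n * T * E n) \<longlonglongrightarrow> T"
    have "norm (E n * T - T) \<le> norm (E n * T * E n - T) + norm (E n * T * E n - T)" for n
    proof -
      have eq: "E n * T - T = E n * (T - E n * T * E n) + (E n * T * E n - T)"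
        by (simp add: algebra_simps)
      show ?thesis
        unfolding eq using norm_coord_proj_mult_le(1)[of n "T - E n * T * E n"]
        by (intro le) (simp only: norm_minus_commute)
    qed
    then show "(\<lambda>n. E n * T) \<longlonglongrightarrow> T"
      by (rule lim[OF t t])
    have "norm (T * E n - T) \<le> norm (E n * T * E n - T) + norm (E n * T * E n - T)" for n
    proof -
      have eq: "T * E n - T = (T - E n * T * E n) * E n + (E n * T * E n - T)"
        by (simp add: algebra_simps)
      show ?thesis
        unfolding eq using norm_coord_proj_mult_le(2)[of "T - E n * T * E n" n]
        by (intro le) (simp only: norm_minus_commute)
    qed
    then show "(\<lambda>n. T * E n) \<longlonglongrightarrow> T"
      by (rule lim[OF t t])
  next
    assume t: "(\<lambda>n. E n * T) \<longlonglongrightarrow> T \<and> (\<lambda>n. T * E n) \<longlonglongrightarrow> T"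
    have "norm (E n * T * E n - T) \<le> norm (T * E n - T) + norm (E n * T - T)" for n
    proof -
      have eq: "E n * T * E n - T = E n * (T * E n - T) + (E n * T - T)"
        by (simp add: algebra_simps)
      show ?thesis
        unfolding eq by (intro le norm_coord_proj_mult_le)
    qed
    then show "(\<lambda>n. E n * T * E n) \<longlonglongrightarrow> T"
      by (rule lim[OF conjunct2[OF t] conjunct1[OF t]])
  qed
qed

lemma stab_tendsto:
  assumes "T \<in> stab A"
  shows "(\<lambda>n. E n * T) \<longlonglongrightarrow> T" "(\<lambda>n. T * E n) \<longlonglongrightarrow> T"
  using stabD(2)[OF assms] unfolding truncation_tendsto_iff by auto

lemma stab_mult:
  assumes A: "subalgebra A" "closed A" and S: "S \<in> stab A" and T: "T \<in> stab A"
  shows "S * T \<in> stab A"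
proof -
  have "(\<lambda>n. E n * (S * T)) \<longlonglongrightarrow> S * T"
    unfolding mult.assoc[symmetric] by (intro tendsto_intros stab_tendsto(1)[OF S])
  moreover have "(\<lambda>n. S * T * E n) \<longlonglongrightarrow> S * T"
    unfolding mult.assoc by (intro tendsto_intros stab_tendsto(2)[OF T])
  ultimately have "(\<lambda>n. E n * (S * T) * E n) \<longlonglongrightarrow> S * T"
    unfolding truncation_tendsto_iff by blast
  moreover have "entry (S * T) i j \<in> A" for i j
  proof (rule closed_sequentially[OF A(2)])
    show "(\<lambda>n. entry (S * E n * T) i j) \<longlonglongrightarrow> entry (S * T) i j"
      by (intro tendsto_intros stab_tendsto(2)[OF S])
    show "entry (S * E n * T) i j \<in> A" for n
      unfolding entry_mult_coord_proj
      using stabD(1)[OF S] stabD(1)[OF T] by (auto intro!: subalgebra_sum subalgebraD(3) A(1))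
  qed
  ultimately show ?thesis
    by (simp add: stab_def)
qed

lemma subalgebra_stab:
  assumes A: "subalgebra A" "closed A"
  shows "subalgebra (stab A)"
proof -
  have "0 \<in> stab A"
    by (simp add: stab_def subalgebraD(1)[OF A(1)])
  moreover have "S + T \<in> stab A" if S: "S \<in> stab A" and T: "T \<in> stab A" for S T
  proof -
    have "(\<lambda>n. E n * S * E n + E n * T * E n) \<longlonglongrightarrow> S + T"
      by (intro tendsto_add stabD(2)[OF S] stabD(2)[OF T])
    then show ?thesis
      using stabD(1)[OF S] stabD(1)[OF T] subalgebraD(2)[OF A(1)] by (simp add: stab_def algebra_simps)
  qed
  moreover have "c *\<^sub>C S \<in> stab A" if S: "S \<in> stab A" for c S
  proof -
    have "(\<lambda>n. c *\<^sub>C (E n * S * E n)) \<longlonglongrightarrow> c *\<^sub>C S"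
      by (rule bounded_linear.tendsto[OF bounded_linear_scaleC_bop stabD(2)[OF S]])
    then show ?thesis
      using stabD(1)[OF S] subalgebraD(4)[OF A(1)] by (simp add: stab_def mult_scaleC_left mult_scaleC_right)
  qed
  ultimately show ?thesis
    unfolding subalgebra_def using stab_mult[OF A] by blast
qed

text \<open>Truncation is contractive, so the limits in the number of coordinates and along the sequence
  can be interchanged.\<close>

lemma closed_stab:
  assumes A: "closed A"
  shows "closed (stab A)"
proof -
  have "T \<in> stab A" if X: "\<forall>k. X k \<in> stab A" and lim: "X \<longlonglongrightarrow> T" for X T
  proof -
  have "entry T i j \<in> A" for i j
    by (rule closed_sequentially[OF A _ tendsto_entry[OF lim]]) (use X stabD in blast)
  moreover have "(\<lambda>n. E n * T * E n) \<longlonglongrightarrow> T"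
  proof (rule metric_LIMSEQ_I)
    fix e :: real assume "e > 0"
    then have e: "e / 3 > 0" by simp
    obtain k where k: "norm (X k - T) < e / 3"
      using metric_LIMSEQ_D[OF lim e] by (auto simp: dist_norm)
    obtain N where N: "\<And>n. n \<ge> N \<Longrightarrow> norm (E n * X k * E n - X k) < e / 3"
      using metric_LIMSEQ_D[OF stabD(2)[OF X[rule_format, of k]] e] by (auto simp: dist_norm)
    have "dist (E n * T * E n) T < e" if "n \<ge> N" for n
    proof -
      have "norm (E n * T * E n - T)
          = norm (E n * (T - X k) * E n + (E n * X k * E n - X k) + (X k - T))"
        by (simp add: algebra_simps)
      also have "\<dots> \<le> norm (E n * (T - X k) * E n) + norm (E n * X k * E n - X k) + norm (X k - T)"
        by (rule norm_triangle_le, rule add_right_mono, rule norm_triangle_ineq)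
      finally have "norm (E n * T * E n - T)
          \<le> norm (E n * (T - X k) * E n) + norm (E n * X k * E n - X k) + norm (X k - T)" .
      moreover have "norm (E n * (T - X k) * E n) \<le> norm (T - X k)"
        using norm_coord_proj_mult_le(2)[of "E n * (T - X k)" n] norm_coord_proj_mult_le(1)[of n "T - X k"]
        by (rule order_trans)
      ultimately show ?thesis
        using N[OF that] k unfolding dist_norm norm_minus_commute[of T] by linarith
    qed
    then show "\<exists>N. \<forall>n\<ge>N. dist (E n * T * E n) T < e" by blast
  qed
  ultimately show ?thesis
    by (simp add: stab_def)
  qed
  then show ?thesis
    unfolding closed_sequential_limits by blast
qed

lemma stab_opmat:
  assumes A: "0 \<in> A" and M: "M \<in> matrices_over m n A"
  shows "opmat M \<in> stab A"
proof -
  note c = matrices_over_carrier[OF M]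
  have "entry (opmat M) i j \<in> A" for i j
    using M c A by (auto simp: entry_opmat matrices_over_iff)
  moreover have "\<forall>\<^sub>F k in sequentially. E k * opmat M * E k = opmat M"
  proof (rule eventually_sequentiallyI[of "max m n"])
    fix k assume k: "max m n \<le> k"
    have "E k * (E m * opmat M * E n) * E k = E (min k m) * opmat M * E (min n k)"
      by (simp add: mult.assoc flip: coord_proj_mult)
    then show "E k * opmat M * E k = opmat M"
      using k by (simp add: opmat_absorb[OF c] min_absorb1 min_absorb2)
  qed
  then have "(\<lambda>k. E k * opmat M * E k) \<longlonglongrightarrow> opmat M"
    by (rule tendsto_eventually)
  ultimately show ?thesis
    by (simp add: stab_def)
qed

lemma embed_conv_opmat: "embed a i j = E (Suc i) * embed a i j * E (Suc j)"
  by (rule entry_eqI) (auto simp: entry_coord_proj_left entry_coord_proj_right)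

lemma stab_embed:
  assumes "0 \<in> A" "a \<in> A"
  shows "embed a i j \<in> stab A"
  by (subst embed_conv_opmat, subst coord_proj_opmat, rule stab_opmat[OF assms(1), where m = "Suc i" and n = "Suc j"])
    (use assms in \<open>auto simp: matrices_over_iff\<close>)

lemma stab_coord_proj:
  assumes "subalgebra A" "closed A" "1 \<in> A"
  shows "E n \<in> stab A"
  unfolding coord_proj_def
  using subalgebraD(1)[OF assms(1)] assms(3)
  by (intro subalgebra_sum subalgebra_stab assms stab_embed)

lemma stab_star:
  assumes "star_subalgebra C" and T: "T \<in> stab C"
  shows "star T \<in> stab C"
proof -
  have "(\<lambda>n. star (E n * T * E n)) \<longlonglongrightarrow> star T"
    by (rule bounded_linear.tendsto[OF bounded_linear_star stabD(2)[OF T]])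
  then show ?thesis
    using stabD(1)[OF T] assms(1) by (simp add: stab_def star_subalgebra_def entry_star star_mult mult.assoc)
qed

lemma stab_subset_closed_subalgebra:
  assumes B: "subalgebra B" "closed B" and embed: "\<And>a i j. a \<in> A \<Longrightarrow> embed a i j \<in> B"
  shows "stab A \<subseteq> B"
proof
  fix T assume T: "T \<in> stab A"
  have "E n * T * E n \<in> B" for n
    unfolding coord_proj_opmat opmat_def
    by (intro subalgebra_sum B(1)) (simp add: embed stabD(1)[OF T])
  then show "T \<in> B"
    using closed_sequentially[OF B(2) _ stabD(2)[OF T]] by blast
qed

section \<open>Elementary tensors with compact operators\<close>

text \<open>The induction step is one step of the Gram-Schmidt process.\<close>

lemma gram_schmidt:
  fixes g :: "nat \<Rightarrow> 'a::complex_hilbert"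
  shows "\<exists>m (h :: nat \<Rightarrow> 'a) \<alpha>. (\<forall>r<m. \<forall>s<m. cinner (h r) (h s) = (if r = s then 1 else 0)) \<and>
    (\<forall>j<n. g j = (\<Sum>r<m. \<alpha> j r *\<^sub>C h r))"
proof (induction n)
  case 0
  show ?case by (rule exI[of _ 0]) auto
next
  case (Suc n)
  then obtain m \<alpha> and h :: "nat \<Rightarrow> 'a"
    where *: "\<forall>r<m. \<forall>s<m. cinner (h r) (h s) = (if r = s then 1 else 0)"
      "\<forall>j<n. g j = (\<Sum>r<m. \<alpha> j r *\<^sub>C h r)"
    by blast
  from * have orth: "\<And>r s. r < m \<Longrightarrow> s < m \<Longrightarrow> cinner (h r) (h s) = (if r = s then 1 else 0)"
    and \<alpha>: "\<And>j. j < n \<Longrightarrow> g j = (\<Sum>r<m. \<alpha> j r *\<^sub>C h r)"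
    by auto
  define c where "c r = cinner (g n) (h r)" for r
  define u where "u = g n - (\<Sum>r<m. c r *\<^sub>C h r)"
  have perp: "cinner u (h s) = 0" if "s < m" for s
  proof -
    have "cinner (\<Sum>r<m. c r *\<^sub>C h r) (h s) = (\<Sum>r<m. if r = s then c r else 0)"
      unfolding cinner_sum_left using orth that by (intro sum.cong) (auto simp: cinner_scaleC_left)
    then show ?thesis
      using that by (simp add: u_def cinner_diff_left c_def)
  qed
  then have perp': "cinner (h s) u = 0" if "s < m" for s
    by (metis cinner_commute complex_cnj_zero that)
  show ?case
  proof (cases "u = 0")
    case True
    then have "g n = (\<Sum>r<m. c r *\<^sub>C h r)"
      by (simp add: u_def)
    then show ?thesis
      using orth \<alpha> by (intro exI[of _ m] exI[of _ h] exI[of _ "\<alpha>(n := c)"]) (auto simp: less_Suc_eq)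
  next
    case False
    let ?d = "complex_of_real (norm u)"
    define h' where "h' = h(m := inverse ?d *\<^sub>C u)"
    define \<alpha>' where "\<alpha>' j r = (if j = n then if r = m then ?d else c r else if r = m then 0 else \<alpha> j r)" for j r
    have old: "(\<Sum>r<m. \<beta> r *\<^sub>C h' r) = (\<Sum>r<m. \<beta> r *\<^sub>C h r)" for \<beta>
      by (intro sum.cong) (auto simp: h'_def)
    have "cinner (h' r) (h' s) = (if r = s then 1 else 0)" if "r < Suc m" "s < Suc m" for r s
    proof -
      have "cinner (h' m) (h' m) = 1"
        using False by (simp add: h'_def cinner_self norm_scaleC norm_inverse)
      then show ?thesis
        using that orth perp perp'
        by (auto simp: less_Suc_eq h'_def cinner_scaleC_left cinner_scaleC_right)
    qed
    moreover have "g j = (\<Sum>r<Suc m. \<alpha>' j r *\<^sub>C h' r)" if "j < Suc n" for j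
    proof (cases "j = n")
      case True
      have "(\<Sum>r<m. \<alpha>' n r *\<^sub>C h' r) = (\<Sum>r<m. c r *\<^sub>C h r)"
        unfolding old by (intro sum.cong) (auto simp: \<alpha>'_def)
      moreover have "\<alpha>' n m *\<^sub>C h' m = u"
        using False by (simp add: \<alpha>'_def h'_def scaleC_scaleC)
      ultimately show ?thesis
        using True by (simp add: u_def)
    next
      case neq: False
      have "(\<Sum>r<m. \<alpha>' j r *\<^sub>C h' r) = (\<Sum>r<m. \<alpha> j r *\<^sub>C h r)"
        unfolding old using neq by (intro sum.cong) (auto simp: \<alpha>'_def)
      then show ?thesis
        using neq that by (simp add: \<alpha> \<alpha>'_def)
    qed
    ultimately show ?thesis by blast
  qed
qed

lemma norm_orthonormal_sum:
  fixes h :: "nat \<Rightarrow> 'a::complex_hilbert"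
  assumes "\<And>r s. r < m \<Longrightarrow> s < m \<Longrightarrow> cinner (h r) (h s) = (if r = s then 1 else 0)"
  shows "(norm (\<Sum>r<m. \<beta> r *\<^sub>C h r))\<^sup>2 = (\<Sum>r<m. (cmod (\<beta> r))\<^sup>2)"
proof -
  have "complex_of_real ((norm (\<Sum>r<m. \<beta> r *\<^sub>C h r))\<^sup>2) = cinner (\<Sum>r<m. \<beta> r *\<^sub>C h r) (\<Sum>s<m. \<beta> s *\<^sub>C h s)"
    by (rule cinner_self[symmetric])
  also have "\<dots> = (\<Sum>r<m. cinner (\<beta> r *\<^sub>C h r) (\<Sum>s<m. \<beta> s *\<^sub>C h s))"
    by (rule cinner_sum_left)
  also have "\<dots> = (\<Sum>r<m. \<Sum>s<m. \<beta> r * cnj (\<beta> s) * cinner (h r) (h s))"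
    by (simp only: cinner_sum_right cinner_scaleC_left cinner_scaleC_right mult_ac)
  also have "\<dots> = (\<Sum>r<m. \<Sum>s<m. if r = s then \<beta> r * cnj (\<beta> r) else 0)"
    by (intro sum.cong refl) (auto simp: assms)
  also have "\<dots> = complex_of_real (\<Sum>r<m. (cmod (\<beta> r))\<^sup>2)"
    by (simp flip: complex_norm_square)
  finally show ?thesis
    using of_real_eq_iff by blast
qed

definition scalar_entry :: "complex l2 bop \<Rightarrow> nat \<Rightarrow> nat \<Rightarrow> complex"
  where "scalar_entry k i j = l2_nth (bop_apply k (l2_single j 1)) i"

lemma scalar_entry_apply: "l2_nth (bop_apply k (l2_single j z)) i = z * scalar_entry k i j"
proof -
  have "l2_single j z = z *\<^sub>C l2_single j 1"
    by (simp add: scaleC_complex_def flip: l2_single_scaleC)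
  then show ?thesis
    by (simp add: scalar_entry_def bop_apply_scaleC_right scaleC_complex_def)
qed

lemma scalar_entry_diff: "scalar_entry (k - l) i j = scalar_entry k i j - scalar_entry l i j"
  by (simp add: scalar_entry_def)

lemma scalar_entry_truncation:
  "scalar_entry (E m * k * E m) i j = (if i < m \<and> j < m then scalar_entry k i j else 0)"
proof -
  have "bop_apply (E m) (l2_single j 1) = (if j < m then l2_single j (1 :: complex) else 0)"
    by (rule l2_eqI) auto
  then show ?thesis
    by (simp add: scalar_entry_def)
qed

text \<open>Replacing complex coordinates by vectors does not increase the norm of a matrix: expanding
  the vectors in an orthonormal system splits the estimate into scalar ones.\<close>

lemma scalar_matrix_bound:
  fixes g :: "nat \<Rightarrow> 'a::complex_hilbert"
  shows "(\<Sum>i<n. (norm (\<Sum>j<n. scalar_entry k i j *\<^sub>C g j))\<^sup>2) \<le> (norm k)\<^sup>2 * (\<Sum>j<n. (norm (g j))\<^sup>2)"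
proof -
  obtain m \<alpha> and h :: "nat \<Rightarrow> 'a"
    where *: "\<forall>r<m. \<forall>s<m. cinner (h r) (h s) = (if r = s then 1 else 0)"
      "\<forall>j<n. g j = (\<Sum>r<m. \<alpha> j r *\<^sub>C h r)"
    using gram_schmidt[of n g] by blast
  from * have orth: "\<And>r s. r < m \<Longrightarrow> s < m \<Longrightarrow> cinner (h r) (h s) = (if r = s then 1 else 0)"
    and \<alpha>: "\<And>j. j < n \<Longrightarrow> g j = (\<Sum>r<m. \<alpha> j r *\<^sub>C h r)"
    by auto
  define \<xi> where "\<xi> r = (\<Sum>j<n. l2_single j (\<alpha> j r))" for r
  have k\<xi>: "l2_nth (bop_apply k (\<xi> r)) i = (\<Sum>j<n. \<alpha> j r * scalar_entry k i j)" for r i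
    by (simp add: \<xi>_def bop_apply_sum_right scalar_entry_apply)
  have norm_\<xi>: "(norm (\<xi> r))\<^sup>2 = (\<Sum>j<n. (cmod (\<alpha> j r))\<^sup>2)" for r
    by (subst norm_l2_finite[of n]) (auto simp: \<xi>_def)
  have "(\<Sum>j<n. scalar_entry k i j *\<^sub>C g j) = (\<Sum>r<m. l2_nth (bop_apply k (\<xi> r)) i *\<^sub>C h r)" for i
  proof -
    have "(\<Sum>j<n. scalar_entry k i j *\<^sub>C g j) = (\<Sum>j<n. \<Sum>r<m. (\<alpha> j r * scalar_entry k i j) *\<^sub>C h r)"
      by (intro sum.cong) (auto simp: \<alpha> scaleC_sum_right scaleC_scaleC mult.commute)
    also have "\<dots> = (\<Sum>r<m. \<Sum>j<n. (\<alpha> j r * scalar_entry k i j) *\<^sub>C h r)"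
      by (rule sum.swap)
    finally show ?thesis
      by (simp add: k\<xi> scaleC_sum_left)
  qed
  then have "(\<Sum>i<n. (norm (\<Sum>j<n. scalar_entry k i j *\<^sub>C g j))\<^sup>2)
      = (\<Sum>i<n. \<Sum>r<m. (cmod (l2_nth (bop_apply k (\<xi> r)) i))\<^sup>2)"
    by (simp add: norm_orthonormal_sum[OF orth])
  also have "\<dots> = (\<Sum>r<m. \<Sum>i<n. (cmod (l2_nth (bop_apply k (\<xi> r)) i))\<^sup>2)"
    by (rule sum.swap)
  also have "\<dots> \<le> (\<Sum>r<m. (norm k)\<^sup>2 * (\<Sum>j<n. (cmod (\<alpha> j r))\<^sup>2))"
  proof (rule sum_mono)
    fix r
    have "(\<Sum>i<n. (cmod (l2_nth (bop_apply k (\<xi> r)) i))\<^sup>2) \<le> (norm (bop_apply k (\<xi> r)))\<^sup>2"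
      by (rule sum_norm_l2_le)
    also have "\<dots> \<le> (norm k * norm (\<xi> r))\<^sup>2"
      by (intro power_mono norm_bop_apply norm_ge_zero)
    finally show "(\<Sum>i<n. (cmod (l2_nth (bop_apply k (\<xi> r)) i))\<^sup>2) \<le> (norm k)\<^sup>2 * (\<Sum>j<n. (cmod (\<alpha> j r))\<^sup>2)"
      by (simp add: power_mult_distrib norm_\<xi>)
  qed
  also have "\<dots> = (norm k)\<^sup>2 * (\<Sum>j<n. \<Sum>r<m. (cmod (\<alpha> j r))\<^sup>2)"
    by (subst sum.swap) (simp add: sum_distrib_left)
  also have "(\<Sum>j<n. \<Sum>r<m. (cmod (\<alpha> j r))\<^sup>2) = (\<Sum>j<n. (norm (g j))\<^sup>2)"
    by (intro sum.cong) (auto simp: \<alpha> norm_orthonormal_sum[OF orth])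
  finally show ?thesis .
qed

text \<open>The elementary tensor of \<open>a\<close> with the corner of size \<open>n\<close> of \<open>k\<close>.\<close>

definition tensor_trunc :: "nat \<Rightarrow> 'a::complex_hilbert bop \<Rightarrow> complex l2 bop \<Rightarrow> 'a l2 bop"
  where "tensor_trunc n a k = (\<Sum>i<n. \<Sum>j<n. embed (scalar_entry k i j *\<^sub>C a) i j)"

lemma tensor_trunc_nth:
  "l2_nth (bop_apply (tensor_trunc n a k) f) i
    = (if i < n then \<Sum>j<n. scalar_entry k i j *\<^sub>C bop_apply a (l2_nth f j) else 0)"
proof -
  have "l2_nth (bop_apply (tensor_trunc n a k) f) i
      = (\<Sum>l<n. if i = l then (\<Sum>j<n. scalar_entry k l j *\<^sub>C bop_apply a (l2_nth f j)) else 0)"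
    unfolding tensor_trunc_def bop_apply_sum l2_nth_sum
    by (intro sum.cong refl) (auto intro!: sum.neutral sum.cong)
  then show ?thesis by simp
qed

lemma norm_tensor_trunc_le: "norm (tensor_trunc n a k) \<le> norm k * norm a"
proof (rule norm_bop_bound)
  fix f
  have "(norm (bop_apply (tensor_trunc n a k) f))\<^sup>2
      = (\<Sum>i<n. (norm (\<Sum>j<n. scalar_entry k i j *\<^sub>C bop_apply a (l2_nth f j)))\<^sup>2)"
    by (subst norm_l2_finite[of n]) (auto simp: tensor_trunc_nth)
  also have "\<dots> \<le> (norm k)\<^sup>2 * (\<Sum>j<n. (norm (bop_apply a (l2_nth f j)))\<^sup>2)"
    by (rule scalar_matrix_bound)
  also have "\<dots> \<le> (norm k)\<^sup>2 * (\<Sum>j<n. (norm a * norm (l2_nth f j))\<^sup>2)"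
    by (intro mult_left_mono sum_mono power_mono norm_bop_apply) auto
  also have "\<dots> = (norm k)\<^sup>2 * (norm a)\<^sup>2 * (\<Sum>j<n. (norm (l2_nth f j))\<^sup>2)"
    by (simp add: power_mult_distrib sum_distrib_left mult.assoc)
  also have "\<dots> \<le> (norm k)\<^sup>2 * (norm a)\<^sup>2 * (norm f)\<^sup>2"
    by (intro mult_left_mono sum_norm_l2_le) auto
  finally have "(norm (bop_apply (tensor_trunc n a k) f))\<^sup>2 \<le> (norm k * norm a * norm f)\<^sup>2"
    by (simp add: power_mult_distrib)
  then show "norm (bop_apply (tensor_trunc n a k) f) \<le> norm k * norm a * norm f"
    by (rule power2_le_imp_le) simp
qed simp

lemma l2_nth_tensor_vec [simp]: "l2_nth (tensor_vec x \<xi>) n = l2_nth \<xi> n *\<^sub>C x"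
  by transfer simp

lemma tensor_trunc_tensor_vec:
  "bop_apply (tensor_trunc n a k) (tensor_vec x \<xi>)
    = tensor_vec (bop_apply a x) (bop_apply (E n * k * E n) \<xi>)"
proof (rule l2_eqI)
  fix i
  have "l2_nth (bop_apply k (bop_apply (E n) \<xi>)) i = (\<Sum>j<n. l2_nth \<xi> j * scalar_entry k i j)"
    by (simp add: coord_proj_apply bop_apply_sum_right scalar_entry_apply)
  then show "l2_nth (bop_apply (tensor_trunc n a k) (tensor_vec x \<xi>)) i
      = l2_nth (tensor_vec (bop_apply a x) (bop_apply (E n * k * E n) \<xi>)) i"
    by (simp add: tensor_trunc_nth bop_apply_scaleC_right scaleC_scaleC scaleC_sum_left mult.commute)
qed

text \<open>Operators that agree on the elementary tensors agree on their closed span, which is everything.\<close>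

lemma tensor_op_eqI:
  fixes S :: "'a::complex_hilbert bop"
  assumes R: "\<And>x \<xi>. bop_apply R (tensor_vec x \<xi>) = tensor_vec (bop_apply S x) (bop_apply T \<xi>)"
  shows "tensor_op S T = R"
  unfolding tensor_op_def
proof (rule the_equality)
  fix R' assume R': "\<forall>x \<xi>. bop_apply R' (tensor_vec x \<xi>) = tensor_vec (bop_apply S x) (bop_apply T \<xi>)"
  define D where "D = R' - R"
  have lin: "linear (bop_apply D)"
    using bounded_linear_bop_apply by (rule bounded_linear.linear)
  have "closed (bop_apply D -` {0})"
    by (intro closed_vimage closed_singleton linear_continuous_on bounded_linear_bop_apply)
  moreover have "span {tensor_vec x \<xi> |x \<xi>. True} \<subseteq> bop_apply D -` {0}"
  proof
    fix f :: "'a l2" assume "f \<in> span {tensor_vec x \<xi> |x \<xi>. True}"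
    then have "bop_apply D f = 0"
      by (rule linear_eq_0_on_span[OF lin, rotated]) (use R R' in \<open>auto simp: D_def\<close>)
    then show "f \<in> bop_apply D -` {0}" by simp
  qed
  ultimately have "closure (span {tensor_vec x \<xi> |x \<xi>. True}) \<subseteq> bop_apply D -` {0}"
    by (intro closure_minimal)
  then have "bop_apply D f = 0" for f :: "'a l2"
    unfolding tensor_vec_total by auto
  then show "R' = R"
    by (intro bop_eqI) (simp add: D_def)
qed (use R in simp)

lemma norm_bop_bound_cball:
  assumes "\<And>x. norm x \<le> 1 \<Longrightarrow> norm (bop_apply T x) \<le> c" "0 \<le> c"
  shows "norm T \<le> c"
proof (rule norm_bop_bound)
  fix x
  show "norm (bop_apply T x) \<le> c * norm x"
  proof (cases "x = 0")
    case False
    have "norm (bop_apply T (inverse (norm x) *\<^sub>R x)) \<le> c"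
      using False by (intro assms) simp
    then show ?thesis
      using False by (simp add: bop_apply_scaleR_right field_simps)
  qed simp
qed (rule assms)

text \<open>On the compact closure of the image of the unit ball the contractions \<open>E n\<close> converge
  uniformly to the identity, as they do so pointwise.\<close>

lemma compact_truncation_left:
  assumes k: "k \<in> \<K>"
  shows "(\<lambda>n. E n * k) \<longlonglongrightarrow> k"
proof (rule metric_LIMSEQ_I)
  fix e :: real assume "e > 0"
  then have e: "e / 4 > 0" by simp
  let ?S = "closure (bop_apply k ` cball 0 1)"
  have "compact ?S" using k by (simp add: compact_operators_def)
  then obtain F where F: "finite F" "?S \<subseteq> (\<Union>y\<in>F. ball y (e / 4))"
    using e unfolding compact_eq_totally_bounded by blast
  have "\<forall>\<^sub>F n in sequentially. \<forall>y\<in>F. dist (bop_apply (E n) y) y < e / 4"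
    using F(1) tendstoD[OF tendsto_coord_proj e] by (intro eventually_ball_finite) auto
  then obtain N where N: "\<And>n y. n \<ge> N \<Longrightarrow> y \<in> F \<Longrightarrow> dist (bop_apply (E n) y) y < e / 4"
    by (auto simp: eventually_sequentially)
  have "dist (E n * k) k < e" if "n \<ge> N" for n
  proof -
    have "norm (E n * k - k) \<le> 3 * (e / 4)"
    proof (rule norm_bop_bound_cball)
      fix x :: "complex l2" assume "norm x \<le> 1"
      then have "bop_apply k x \<in> ?S"
        by (intro subsetD[OF closure_subset] imageI) simp
      then obtain y where y: "y \<in> F" "dist y (bop_apply k x) < e / 4"
        using F(2) by auto
      have eq: "bop_apply (E n * k - k) x
          = bop_apply (E n) (bop_apply k x - y) + (bop_apply (E n) y - y) + (y - bop_apply k x)"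
        by (simp add: bop_apply_diff_right)
      have "norm (bop_apply (E n) (bop_apply k x - y) + (bop_apply (E n) y - y) + (y - bop_apply k x))
          \<le> norm (bop_apply (E n) (bop_apply k x - y)) + norm (bop_apply (E n) y - y)
          + norm (y - bop_apply k x)"
        by (rule norm_triangle_le, rule add_right_mono, rule norm_triangle_ineq)
      moreover have "norm (bop_apply (E n) (bop_apply k x - y)) \<le> norm (y - bop_apply k x)"
        using norm_coord_proj_apply[of n "bop_apply k x - y"] by (simp only: norm_minus_commute)
      ultimately show "norm (bop_apply (E n * k - k) x) \<le> 3 * (e / 4)"
        using y(2) N[OF that y(1)] unfolding eq dist_norm by linarith
    qed (use e in simp)
    then show ?thesis
      using e by (simp add: dist_norm)
  qed
  then show "\<exists>N. \<forall>n\<ge>N. dist (E n * k) k < e" by blast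
qed

text \<open>The range of \<open>S * E m\<close> is spanned by the images of finitely many basis vectors.\<close>

lemma coord_proj_mult_finite:
  fixes S :: "complex l2 bop"
  shows "(\<lambda>n. E n * (S * E m)) \<longlonglongrightarrow> S * E m"
proof -
  let ?d = "\<lambda>n. \<Sum>i<m. norm (bop_apply (E n) (bop_apply S (l2_single i 1)) - bop_apply S (l2_single i 1))"
  have "norm (E n * (S * E m) - S * E m) \<le> ?d n" for n
  proof (rule norm_bop_bound)
    fix x :: "complex l2"
    have single: "l2_single i z = z *\<^sub>C l2_single i (1 :: complex)" for i z
      by (simp add: scaleC_complex_def flip: l2_single_scaleC)
    have "bop_apply (E n * (S * E m) - S * E m) x
        = (\<Sum>i<m. l2_nth x i *\<^sub>C (bop_apply (E n) (bop_apply S (l2_single i 1)) - bop_apply S (l2_single i 1)))"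
      by (simp add: coord_proj_apply[of m] bop_apply_sum_right single[of _ "l2_nth x _"]
          bop_apply_scaleC_right scaleC_diff_right sum_subtractf)
    also have "norm \<dots> \<le> (\<Sum>i<m. norm (l2_nth x i *\<^sub>C
        (bop_apply (E n) (bop_apply S (l2_single i 1)) - bop_apply S (l2_single i 1))))"
      by (rule norm_sum)
    also have "\<dots> \<le> (\<Sum>i<m. norm x * norm (bop_apply (E n) (bop_apply S (l2_single i 1)) - bop_apply S (l2_single i 1)))"
      by (intro sum_mono) (auto simp: norm_scaleC intro!: mult_right_mono norm_l2_nth_le)
    finally show "norm (bop_apply (E n * (S * E m) - S * E m) x) \<le> ?d n * norm x"
      by (simp add: sum_distrib_left mult.commute)
  qed (simp add: sum_nonneg)
  moreover have "?d \<longlonglongrightarrow> 0"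
    by (intro tendsto_null_sum tendsto_norm_zero LIM_zero tendsto_coord_proj)
  ultimately have "(\<lambda>n. E n * (S * E m) - S * E m) \<longlonglongrightarrow> 0"
    by (rule Lim_null_comparison[OF always_eventually[OF allI]])
  then show ?thesis
    by (rule LIM_zero_cancel)
qed

text \<open>Truncation on the right is adjoint to truncation on the left. The adjoint of \<open>k\<close> is only
  controlled after \<open>k\<close> has been replaced by \<open>E m * k\<close>, which is close to \<open>k\<close>.\<close>

lemma compact_truncation:
  assumes k: "k \<in> \<K>"
  shows "(\<lambda>n. E n * k * E n) \<longlonglongrightarrow> k"
proof -
  note left = compact_truncation_left[OF k]
  have "(\<lambda>n. k * E n) \<longlonglongrightarrow> k"
  proof (rule metric_LIMSEQ_I)
    fix e :: real assume "e > 0"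
    then have e: "e / 3 > 0" by simp
    obtain m where m: "norm (E m * k - k) < e / 3"
      using metric_LIMSEQ_D[OF left e] by (auto simp: dist_norm)
    have "(\<lambda>n. star (E n * (star k * E m))) \<longlonglongrightarrow> star (star k * E m)"
      by (rule bounded_linear.tendsto[OF bounded_linear_star coord_proj_mult_finite])
    then have "(\<lambda>n. E m * k * E n) \<longlonglongrightarrow> E m * k"
      by (simp add: star_mult)
    from metric_LIMSEQ_D[OF this e]
    obtain N where N: "\<And>n. n \<ge> N \<Longrightarrow> norm (E m * k * E n - E m * k) < e / 3"
      by (auto simp: dist_norm)
    have "dist (k * E n) k < e" if "n \<ge> N" for n
    proof -
      have eq: "k * E n - k = (k - E m * k) * E n + (E m * k * E n - E m * k) + (E m * k - k)"
        by (simp add: algebra_simps)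
      have "norm ((k - E m * k) * E n + (E m * k * E n - E m * k) + (E m * k - k))
          \<le> norm ((k - E m * k) * E n) + norm (E m * k * E n - E m * k) + norm (E m * k - k)"
        by (rule norm_triangle_le, rule add_right_mono, rule norm_triangle_ineq)
      moreover have "norm ((k - E m * k) * E n) \<le> norm (E m * k - k)"
        using norm_coord_proj_mult_le(2)[of "k - E m * k" n] by (simp only: norm_minus_commute)
      ultimately show ?thesis
        using m N[OF that] unfolding eq dist_norm by linarith
    qed
    then show "\<exists>N. \<forall>n\<ge>N. dist (k * E n) k < e" by blast
  qed
  with left show ?thesis
    unfolding truncation_tendsto_iff by blast
qed

lemma tensor_trunc_mono:
  assumes "m \<le> n"
  shows "tensor_trunc n a (E m * k * E m) = tensor_trunc m a k"
proof (rule bop_eqI, rule l2_eqI)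
  fix f i
  have "(\<Sum>j<n. scalar_entry (E m * k * E m) i j *\<^sub>C bop_apply a (l2_nth f j))
      = (\<Sum>j<m. scalar_entry k i j *\<^sub>C bop_apply a (l2_nth f j))" if "i < m"
    using assms that by (intro sum.mono_neutral_cong_right) (auto simp: scalar_entry_truncation)
  then show "l2_nth (bop_apply (tensor_trunc n a (E m * k * E m)) f) i = l2_nth (bop_apply (tensor_trunc m a k) f) i"
    using assms by (auto simp: tensor_trunc_nth scalar_entry_truncation)
qed

lemma tensor_trunc_diff: "tensor_trunc n a (k - l) = tensor_trunc n a k - tensor_trunc n a l"
proof -
  have "(c - d) *\<^sub>C a = c *\<^sub>C a - d *\<^sub>C a" for c d
    using scaleC_add_left[of "c - d" d a] by simp
  moreover have "embed (b - c) i j = embed b i j - embed c i j" for b c :: "'a bop" and i j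
    using embed_add[of "b - c" c i j] by simp
  ultimately show ?thesis
    by (simp add: tensor_trunc_def scalar_entry_diff sum_subtractf)
qed

text \<open>In particular the elementary tensor exists: the corners form a Cauchy sequence, because the
  scalar corners do and tensoring with \<open>a\<close> multiplies norms at most by \<open>norm a\<close>.\<close>

lemma tensor_op_tendsto:
  assumes k: "k \<in> \<K>"
  shows "(\<lambda>n. tensor_trunc n a k) \<longlonglongrightarrow> tensor_op a k"
proof -
  note lim = compact_truncation[OF k]
  have le: "norm (tensor_trunc n a k - tensor_trunc m a k) \<le> norm (E m * k * E m - k) * norm a"
    if "m \<le> n" for m n
  proof -
    have "tensor_trunc n a k - tensor_trunc m a k = tensor_trunc n a (k - E m * k * E m)"
      by (simp add: tensor_trunc_diff tensor_trunc_mono[OF that])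
    then show ?thesis
      using norm_tensor_trunc_le[of n a "k - E m * k * E m"] by (simp add: norm_minus_commute)
  qed
  have small: "(\<lambda>m. norm (E m * k * E m - k) * norm a) \<longlonglongrightarrow> 0"
    using lim by (auto simp: LIM_zero_iff tendsto_norm_zero_iff intro!: tendsto_mult_left_zero)
  obtain R where R: "(\<lambda>n. tensor_trunc n a k) \<longlonglongrightarrow> R"
    using convergent_of_tail_bound[OF le small] by (auto simp: convergent_def)
  have "tensor_op a k = R"
  proof (rule tensor_op_eqI)
    fix x \<xi>
    let ?b = "bop_apply a x"
    have "bounded_linear (tensor_vec ?b)"
    proof (rule bounded_linear_intro[where K = "norm ?b"])
      show "norm (tensor_vec ?b \<eta>) \<le> norm \<eta> * norm ?b" for \<eta>
      proof -
        have "complex_of_real ((norm (tensor_vec ?b \<eta>))\<^sup>2) = complex_of_real ((norm ?b)\<^sup>2 * (norm \<eta>)\<^sup>2)"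
          using cinner_tensor_vec[of ?b \<eta> ?b \<eta>] unfolding cinner_self by simp
        then have "(norm (tensor_vec ?b \<eta>))\<^sup>2 = (norm \<eta> * norm ?b)\<^sup>2"
          unfolding of_real_eq_iff by (simp add: power_mult_distrib)
        then show ?thesis
          by (simp add: power2_eq_iff_nonneg)
      qed
    qed (auto intro!: l2_eqI simp: scaleC_add_left scaleR_conv_of_real scaleC_of_real simp flip: scaleC_scaleC)
    from bounded_linear.tendsto[OF this tendsto_bop_apply[OF lim]]
    have "(\<lambda>n. bop_apply (tensor_trunc n a k) (tensor_vec x \<xi>)) \<longlonglongrightarrow> tensor_vec ?b (bop_apply k \<xi>)"
      by (simp add: tensor_trunc_tensor_vec)
    moreover have "(\<lambda>n. bop_apply (tensor_trunc n a k) (tensor_vec x \<xi>)) \<longlonglongrightarrow> bop_apply R (tensor_vec x \<xi>)"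
      by (intro tendsto_intros R)
    ultimately show "bop_apply R (tensor_vec x \<xi>) = tensor_vec ?b (bop_apply k \<xi>)"
      by (rule LIMSEQ_unique[rotated])
  qed
  with R show ?thesis by simp
qed

lemma embed_one_compact: "embed 1 i j \<in> \<K>"
proof -
  have "bounded_linear (l2_single i :: complex \<Rightarrow> complex l2)"
    by (rule bounded_linear_intro[where K = 1]) (auto simp: l2_single_add intro!: l2_eqI)
  then have "continuous_on (cball 0 1) (l2_single i :: complex \<Rightarrow> complex l2)"
    by (rule bounded_linear.continuous_on) (rule continuous_on_id)
  then have comp: "compact (l2_single i ` cball (0 :: complex) 1)"
    by (rule compact_continuous_image) simp
  have "norm (l2_nth f j) \<le> 1" if "norm f \<le> 1" for f :: "complex l2"
    using norm_l2_nth_le[of f j] that by linarith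
  then have "bop_apply (embed 1 i j) ` cball 0 1 \<subseteq> l2_single i ` cball (0 :: complex) 1"
    by auto
  then have sub: "closure (bop_apply (embed 1 i j) ` cball 0 1) \<subseteq> l2_single i ` cball (0 :: complex) 1"
    by (intro closure_minimal compact_imp_closed[OF comp])
  then have "closure (bop_apply (embed 1 i j) ` cball 0 1)
      = closure (bop_apply (embed 1 i j) ` cball 0 1) \<inter> l2_single i ` cball (0 :: complex) 1"
    by blast
  then have "compact (closure (bop_apply (embed 1 i j :: complex l2 bop) ` cball 0 1))"
    using closed_Int_compact[OF closed_closure comp] by metis
  then show ?thesis
    by (simp add: compact_operators_def)
qed

lemma tensor_op_embed: "tensor_op a (embed 1 i j) = embed a i j"
  by (rule tensor_op_eqI, rule l2_eqI) (simp add: bop_apply_scaleC_right)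

text \<open>Elementary tensors with compact operators are limits of their corners, and conversely corners
  are sums of elementary tensors with matrix units.\<close>

theorem spatial_tensor_compact:
  assumes A: "subalgebra A" "closed A"
  shows "A \<otimes>\<^sub>s\<^sub>p \<K> = stab A"
proof
  have "tensor_op a k \<in> stab A" if a: "a \<in> A" and k: "k \<in> \<K>" for a k
  proof (rule closed_sequentially[OF closed_stab[OF A(2)] _ tensor_op_tendsto[OF k]])
    show "tensor_trunc n a k \<in> stab A" for n
      unfolding tensor_trunc_def
      using A a by (auto intro!: subalgebra_sum subalgebra_stab stab_embed subalgebraD(1,4))
  qed
  then show "A \<otimes>\<^sub>s\<^sub>p \<K> \<subseteq> stab A"
    unfolding spatial_tensor_def closed_algebra_generated_def
    using subalgebra_stab[OF A] closed_stab[OF A(2)] by blast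
  show "stab A \<subseteq> A \<otimes>\<^sub>s\<^sub>p \<K>"
    unfolding spatial_tensor_def closed_algebra_generated_def
  proof (rule Inter_greatest)
    fix B assume B: "B \<in> {B. {tensor_op a b |a b. a \<in> A \<and> b \<in> \<K>} \<subseteq> B \<and> subalgebra B \<and> closed B}"
    have "tensor_op a (embed 1 i j) \<in> B" if "a \<in> A" for a i j
      using B embed_one_compact[of i j] that by blast
    then have "embed a i j \<in> B" if "a \<in> A" for a i j
      using that by (simp only: tensor_op_embed)
    then show "stab A \<subseteq> B"
      using B by (intro stab_subset_closed_subalgebra[of B A]) auto
  qed
qed

section \<open>Inverse square roots and approximation of projections\<close>

definition inv_sqrt_coeff :: "nat \<Rightarrow> real"
  where "inv_sqrt_coeff n = (- 1) ^ n * ((- (1 / 2)) gchoose n)"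

lemma inv_sqrt_coeff_0 [simp]: "inv_sqrt_coeff 0 = 1"
  by (simp add: inv_sqrt_coeff_def)

lemma inv_sqrt_coeff_Suc: "inv_sqrt_coeff (Suc n) = inv_sqrt_coeff n * ((real n + 1 / 2) / (real n + 1))"
proof -
  have "((- (1 / 2)) gchoose Suc n) = ((- (1 / 2)) gchoose n) * ((- (1 / 2) - real n) / (real n + 1))"
    using gbinomial_mult_1[of "- (1 / 2) :: real" n] by (simp add: field_simps)
  then show ?thesis
    unfolding inv_sqrt_coeff_def by (simp only: power_Suc) (simp add: field_simps)
qed

lemma inv_sqrt_coeff_bounds: "0 \<le> inv_sqrt_coeff n \<and> inv_sqrt_coeff n \<le> 1"
proof (induction n)
  case (Suc n)
  have r: "0 \<le> (real n + 1 / 2) / (real n + 1)" "(real n + 1 / 2) / (real n + 1) \<le> 1"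
    by (auto simp: field_simps)
  show ?case
    unfolding inv_sqrt_coeff_Suc
    by (intro conjI mult_nonneg_nonneg mult_le_one r conjunct1[OF Suc] conjunct2[OF Suc])
qed simp

text \<open>This says that the square of the binomial series of \<open>(1 - y)\<^sup>-\<^sup>1\<^sup>/\<^sup>2\<close> is the geometric series.\<close>

lemma inv_sqrt_coeff_convolution: "(\<Sum>k\<le>n. inv_sqrt_coeff k * inv_sqrt_coeff (n - k)) = 1"
proof -
  let ?a = "- (1 / 2) :: real"
  have "(\<Sum>k\<le>n. inv_sqrt_coeff k * inv_sqrt_coeff (n - k))
      = (\<Sum>k\<le>n. (- 1) ^ n * ((?a gchoose k) * (?a gchoose (n - k))))"
    by (intro sum.cong) (auto simp: inv_sqrt_coeff_def simp flip: power_add)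
  also have "\<dots> = (- 1) ^ n * ((?a + ?a) gchoose n)"
    by (simp only: gbinomial_Vandermonde flip: sum_distrib_left atLeast0AtMost)
  also have "((?a + ?a) gchoose n) = (- 1) ^ n"
    using gbinomial_minus[of "1 :: real" n] by (simp flip: binomial_gbinomial)
  finally show ?thesis
    by (simp flip: power_add)
qed

lemma norm_power_bop_le: "norm (y ^ n) \<le> norm y ^ n" for y :: "'a::complex_hilbert bop"
proof (induction n)
  case (Suc n)
  have "norm (y ^ Suc n) \<le> norm y * norm (y ^ n)"
    by (simp add: norm_mult_ineq)
  also have "\<dots> \<le> norm y * norm y ^ n"
    by (intro mult_left_mono Suc norm_ge_zero)
  finally show ?case by simp
qed (simp add: norm_bop_one_le)

text \<open>The operator \<open>h\<close> is \<open>(1 - y)\<^sup>-\<^sup>1\<^sup>/\<^sup>2\<close>, given by its binomial series. It need not belong to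
  a closed algebra \<open>A\<close> that contains \<open>y\<close>, as \<open>A\<close> may lack the unit, but its multiples by elements of \<open>A\<close> do.\<close>

lemma inverse_sqrt_exists:
  fixes y :: "'a::complex_hilbert bop"
  assumes y: "norm y < 1" and star: "star y = y"
  obtains h where "h * h * (1 - y) = 1" "star h = h"
    "\<And>q. q * y = y * q \<Longrightarrow> q * h = h * q"
    "\<And>q A. subalgebra A \<Longrightarrow> closed A \<Longrightarrow> y \<in> A \<Longrightarrow> q \<in> A \<Longrightarrow> q * h \<in> A"
proof -
  let ?f = "\<lambda>n. inv_sqrt_coeff n *\<^sub>R y ^ n"
  define h where "h = (\<Sum>n. ?f n)"
  have geo: "summable (\<lambda>n. norm y ^ n)"
    using y by (simp add: summable_geometric)
  have norm_summable: "summable (\<lambda>n. norm (?f n))"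
  proof (rule summable_comparison_test'[OF geo])
    fix n
    have "\<bar>inv_sqrt_coeff n\<bar> * norm (y ^ n) \<le> 1 * norm y ^ n"
      using inv_sqrt_coeff_bounds[of n] by (intro mult_mono norm_power_bop_le) auto
    then show "norm (norm (?f n)) \<le> norm y ^ n" by simp
  qed
  have sums: "?f sums h"
    unfolding h_def by (rule summable_sums[OF summable_norm_cancel[OF norm_summable]])
  have "(\<lambda>n. \<Sum>k\<le>n. ?f k * ?f (n - k)) sums (h * h)"
    unfolding h_def by (rule Cauchy_product_sums[OF norm_summable norm_summable])
  moreover have "(\<Sum>k\<le>n. ?f k * ?f (n - k)) = y ^ n" for n
  proof -
    have "(\<Sum>k\<le>n. ?f k * ?f (n - k)) = (\<Sum>k\<le>n. (inv_sqrt_coeff k * inv_sqrt_coeff (n - k)) *\<^sub>R y ^ n)"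
      by (intro sum.cong) (auto simp flip: power_add)
    then show ?thesis
      by (simp add: inv_sqrt_coeff_convolution flip: scaleR_sum_left)
  qed
  ultimately have hh: "(\<lambda>n. y ^ n) sums (h * h)"
    by simp
  then have "(\<lambda>n. y ^ n * y) sums (h * h * y)"
    by (rule sums_mult2)
  then have "(\<lambda>n. y ^ Suc n) sums (h * h * y)"
    by (simp add: power_commutes)
  then have "(\<lambda>n. y ^ n) sums (h * h * y + 1)"
    using sums_Suc_iff[of "\<lambda>n. y ^ n" "h * h * y"] by (simp del: power_Suc)
  with hh have "h * h = h * h * y + 1"
    by (rule sums_unique2)
  then have "h * h - h * h * y = 1"
    by (metis add_diff_cancel_left')
  then have 1: "h * h * (1 - y) = 1"
    by (simp add: right_diff_distrib)
  have star_pow: "star (y ^ n) = y ^ n" for n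
    by (induction n) (simp_all add: star_mult star power_commutes)
  have "(\<lambda>n. star (?f n)) sums star h"
    by (rule bounded_linear.sums[OF bounded_linear_star sums])
  moreover have "star (?f n) = ?f n" for n
    using star_scaleC[of "complex_of_real (inv_sqrt_coeff n)" "y ^ n"] by (simp add: scaleC_of_real star_pow)
  ultimately have 2: "star h = h"
    using sums sums_unique2 by auto
  have 3: "q * h = h * q" if "q * y = y * q" for q
  proof -
    have "q * y ^ n = y ^ n * q" for n
      by (induction n) (simp_all add: that power_Suc flip: mult.assoc, simp add: mult.assoc)
    then have "(\<lambda>n. q * ?f n) = (\<lambda>n. ?f n * q)"
      by (auto simp: fun_eq_iff)
    then show ?thesis
      using sums_mult[OF sums, of q] sums_mult2[OF sums, of q] sums_unique2 by metis
  qed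
  have 4: "q * h \<in> A" if A: "subalgebra A" "closed A" and "y \<in> A" "q \<in> A" for q and A :: "'a bop set"
  proof (rule closed_sequentially[OF A(2)])
    show "(\<lambda>n. \<Sum>k<n. q * ?f k) \<longlonglongrightarrow> q * h"
      using sums_mult[OF sums, of q] by (simp add: sums_def)
    have "q * y ^ n \<in> A" for n
    proof (induction n)
      case (Suc n)
      have "q * y ^ Suc n = q * y ^ n * y"
        by (simp only: power_Suc2 mult.assoc)
      then show ?case
        using subalgebraD(3)[OF A(1) Suc that(3)] by simp
    qed (simp add: that)
    then have "complex_of_real (inv_sqrt_coeff n) *\<^sub>C (q * y ^ n) \<in> A" for n
      by (rule subalgebraD(4)[OF A(1)])
    then show "(\<Sum>k<n. q * ?f k) \<in> A" for n
      by (intro subalgebra_sum A(1)) (simp add: scaleC_of_real)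
  qed
  from 1 2 3 4 show ?thesis by (rule that)
qed

text \<open>Murray-von Neumann equivalence of operators. As \<open>A\<close> may fail to be closed under adjoints, the
  partial isometry and its adjoint are both required to lie in it.\<close>

definition op_equiv :: "'a::complex_hilbert bop set \<Rightarrow> 'a bop \<Rightarrow> 'a bop \<Rightarrow> bool"
  where "op_equiv A p q \<longleftrightarrow> (\<exists>v\<in>A. star v \<in> A \<and> star v * v = p \<and> v * star v = q)"

definition op_projection :: "'a::complex_hilbert bop \<Rightarrow> bool"
  where "op_projection p \<longleftrightarrow> star p = p \<and> p * p = p"

text \<open>With \<open>p = star v * v\<close>, the product of \<open>v - v * p\<close> with its adjoint on the left is
  \<open>p - p\<^sup>2 - p\<^sup>2 + p\<^sup>3 = 0\<close>.\<close>

lemma partial_isometry: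
  assumes "op_projection (star v * v)"
  shows "v * star v * v = v" "star v * v * star v = star v" "op_projection (v * star v)"
proof -
  define p where "p = star v * v"
  have p: "p * p = p" "star p = p"
    using assms by (auto simp: op_projection_def p_def)
  have "star (v - v * p) * (v - v * p) = p - p * p - p * p + p * p * p"
    by (simp add: star_diff star_mult p(2) algebra_simps) (simp add: p_def algebra_simps)
  then have "v - v * p = 0"
    by - (rule star_mult_self_eq_0, simp add: p)
  then show 1: "v * star v * v = v"
    by (simp add: p_def mult.assoc)
  show 2: "star v * v * star v = star v"
    using arg_cong[OF 1, of star] by (simp add: star_mult mult.assoc)
  show "op_projection (v * star v)"
    using 1 by (simp add: op_projection_def star_mult flip: mult.assoc)
qed

lemma norm_op_projection_le:
  assumes "op_projection p"
  shows "norm p \<le> 1"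
proof (rule norm_bop_bound)
  fix x
  have "(norm (bop_apply p x))\<^sup>2 = cmod (complex_of_real ((norm (bop_apply p x))\<^sup>2))"
    by (simp only: norm_of_real abs_power2)
  also have "\<dots> = cmod (cinner x (bop_apply p x))"
    using assms unfolding norm_apply_sq by (simp add: op_projection_def)
  also have "\<dots> \<le> norm x * norm (bop_apply p x)"
    by (rule norm_cinner_le)
  finally show "norm (bop_apply p x) \<le> 1 * norm x"
    by (cases "bop_apply p x = 0") (auto simp: power2_eq_square)
qed simp

lemma norm_partial_isometry_le:
  assumes p: "op_projection (star v * v)"
  shows "norm v \<le> 1"
proof (rule norm_bop_bound)
  fix x
  let ?p = "star v * v"
  have "complex_of_real ((norm (bop_apply v x))\<^sup>2) = cinner x (bop_apply (star ?p * ?p) x)"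
    unfolding norm_apply_sq using p by (simp only: op_projection_def)
  then have "complex_of_real ((norm (bop_apply v x))\<^sup>2) = complex_of_real ((norm (bop_apply ?p x))\<^sup>2)"
    by (simp only: norm_apply_sq)
  then have "norm (bop_apply v x) = norm (bop_apply ?p x)"
    unfolding of_real_eq_iff by (simp add: power2_eq_iff_nonneg)
  also have "\<dots> \<le> norm ?p * norm x"
    by (rule norm_bop_apply)
  also have "\<dots> \<le> 1 * norm x"
    by (intro mult_right_mono norm_op_projection_le p) simp
  finally show "norm (bop_apply v x) \<le> 1 * norm x" .
qed simp

lemma op_equiv_projection: "op_equiv A p q \<Longrightarrow> op_projection p \<Longrightarrow> op_projection q"
  unfolding op_equiv_def using partial_isometry(3) by blast

lemma op_equiv_refl: "p \<in> A \<Longrightarrow> op_projection p \<Longrightarrow> op_equiv A p p"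
  unfolding op_equiv_def op_projection_def by (rule bexI[of _ p]) auto

lemma op_equiv_sym: "op_equiv A p q \<Longrightarrow> op_equiv A q p"
  unfolding op_equiv_def by (metis star_star)

lemma op_equiv_trans:
  assumes A: "subalgebra A" and p: "op_projection p" and pq: "op_equiv A p q" and qr: "op_equiv A q r"
  shows "op_equiv A p r"
proof -
  obtain v where v: "v \<in> A" "star v \<in> A" "star v * v = p" "v * star v = q"
    using pq by (auto simp: op_equiv_def)
  obtain w where w: "w \<in> A" "star w \<in> A" "star w * w = q" "w * star w = r"
    using qr by (auto simp: op_equiv_def)
  have qv: "q * v = v"
    using partial_isometry(1)[of v] v p by simp
  have "op_projection q"
    by (rule op_equiv_projection[OF pq p])
  then have wq: "w * q = w"
    using partial_isometry(1)[of w] unfolding w(3) by (simp only: mult.assoc w(3))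
  have "star (w * v) * (w * v) = star v * (star w * w * v)"
    by (simp add: star_mult mult.assoc)
  then have 1: "star (w * v) * (w * v) = p"
    by (simp add: w qv v)
  have "(w * v) * star (w * v) = w * (v * star v) * star w"
    by (simp add: star_mult mult.assoc)
  then have 2: "(w * v) * star (w * v) = r"
    by (simp add: v wq w)
  show ?thesis
    unfolding op_equiv_def using 1 2 v w
    by (intro bexI[of _ "w * v"]) (auto simp: star_mult intro!: subalgebraD(3)[OF A])
qed

text \<open>If the initial and the final projections of two partial isometries are orthogonal, then their sum
  is a partial isometry.\<close>

lemma op_equiv_add:
  assumes A: "subalgebra A" and pq: "op_equiv A p q" and pq': "op_equiv A p' q'"
    and proj: "op_projection p" "op_projection p'"
    and orth: "p * p' = 0" "q * q' = 0"
  shows "op_equiv A (p + p') (q + q')"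
proof -
  obtain v where v: "v \<in> A" "star v \<in> A" "star v * v = p" "v * star v = q"
    using pq by (auto simp: op_equiv_def)
  obtain w where w: "w \<in> A" "star w \<in> A" "star w * w = p'" "w * star w = q'"
    using pq' by (auto simp: op_equiv_def)
  have v3: "v * star v * v = v" "star v * v * star v = star v"
    using partial_isometry(1,2)[of v] v proj by auto
  have w3: "w * star w * w = w" "star w * w * star w = star w"
    using partial_isometry(1,2)[of w] w proj by auto
  have "star v * w = (star v * v * star v) * (w * star w * w)"
    by (simp add: v3 w3)
  also have "\<dots> = star v * (q * q') * w"
    by (simp add: mult.assoc flip: v(4) w(4))
  finally have vw: "star v * w = 0"
    by (simp add: orth)
  have wv: "star w * v = 0"
    using arg_cong[OF vw, of star] by (simp only: star_mult star_star star_zero)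
  have "v * star w = (v * star v * v) * (star w * w * star w)"
    by (simp add: v3 w3)
  also have "\<dots> = v * (p * p') * star w"
    by (simp add: mult.assoc flip: v(3) w(3))
  finally have vw': "v * star w = 0"
    by (simp add: orth)
  have wv': "w * star v = 0"
    using arg_cong[OF vw', of star] by (simp only: star_mult star_star star_zero)
  show ?thesis
    unfolding op_equiv_def
    using v w vw wv vw' wv'
    by (intro bexI[of _ "v + w"]) (auto simp: star_add algebra_simps intro!: subalgebraD(2)[OF A])
qed

lemma op_equiv_mono: "op_equiv A p q \<Longrightarrow> A \<subseteq> B \<Longrightarrow> op_equiv B p q"
  unfolding op_equiv_def by blast

lemma op_projection_opmat:
  assumes "p \<in> mat_projections C"
  shows "op_projection (opmat p)"
proof -
  obtain n where n: "p \<in> carrier_mat n n"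
    using assms by (rule mat_projectionsE)
  show ?thesis
    using opmat_mult[OF n n] mat_projectionsD[OF assms] opmat_star[of p] by (simp add: op_projection_def)
qed

lemma mvn_imp_op_equiv:
  assumes C: "star_subalgebra C" and pq: "(p, q) \<in> murray_von_neumann C"
  shows "op_equiv (stab C) (opmat p) (opmat q)"
proof -
  obtain m n v where v: "v \<in> matrices_over m n C" "mat_star v * v = p" "v * mat_star v = q"
    using pq by (rule mvnE)
  note cv = matrices_over_carrier[OF v(1)]
  have 0: "0 \<in> C"
    using C by (auto simp: star_subalgebra_def subalgebra_def)
  show ?thesis
    unfolding op_equiv_def
  proof (intro bexI conjI)
    show "opmat v \<in> stab C"
      by (rule stab_opmat[OF 0 v(1)])
    then show "star (opmat v) \<in> stab C"
      by (rule stab_star[OF C])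
    show "star (opmat v) * opmat v = opmat p" "opmat v * star (opmat v) = opmat q"
      using opmat_mult[OF mat_star_carrier[OF cv] cv] opmat_mult[OF cv mat_star_carrier[OF cv]] v(2,3)
      by (simp_all add: opmat_star)
  qed
qed

text \<open>A partial isometry between projections that live in finite corners lives in a finite corner.\<close>

lemma op_equiv_imp_mvn:
  assumes p: "p \<in> mat_projections C" and q: "q \<in> mat_projections C"
    and pq: "op_equiv (stab C) (opmat p) (opmat q)"
  shows "(p, q) \<in> murray_von_neumann C"
proof -
  obtain v where v: "v \<in> stab C" "star v * v = opmat p" "v * star v = opmat q"
    using pq by (auto simp: op_equiv_def)
  obtain n where n: "p \<in> carrier_mat n n"
    using p by (rule mat_projectionsE)
  obtain m where m: "q \<in> carrier_mat m m"
    using q by (rule mat_projectionsE)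
  have v3: "v * star v * v = v"
    using partial_isometry(1)[of v] op_projection_opmat[OF p] v(2) by simp
  define w where "w = mat m n (\<lambda>(i, j). entry v i j)"
  have w: "w \<in> matrices_over m n C"
    using stabD(1)[OF v(1)] by (auto simp: w_def matrices_over_iff)
  have "opmat w = E m * v * E n"
    by (simp add: w_def coord_proj_opmat)
  also have "\<dots> = E m * (v * star v * (v * (star v * v))) * E n"
    using v3 by (metis mult.assoc)
  also have "\<dots> = E m * opmat q * (v * (opmat p * E n))"
    by (simp add: v mult.assoc)
  also have "\<dots> = v * star v * (v * (star v * v))"
    by (simp add: opmat_absorb[OF n] opmat_absorb[OF m] v)
  also have "\<dots> = v"
    using v3 by (metis mult.assoc)
  finally have wv: "opmat w = v" .
  note cw = matrices_over_carrier[OF w]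
  show ?thesis
  proof (rule mvnI[OF p q w])
    have "opmat (mat_star w * w) = opmat p"
      using opmat_mult[OF mat_star_carrier[OF cw] cw] by (simp add: opmat_star wv v)
    then show "mat_star w * w = p"
      by (rule opmat_inject[OF _ _ n]) (use cw in auto)
    have "opmat (w * mat_star w) = opmat q"
      using opmat_mult[OF cw mat_star_carrier[OF cw]] by (simp add: opmat_star wv v)
    then show "w * mat_star w = q"
      by (rule opmat_inject[OF _ _ m]) (use cw in auto)
  qed
qed

text \<open>If \<open>x = E n * p\<close> is close to \<open>p\<close> then \<open>star x * x\<close> is invertible in the corner of \<open>p\<close>,
  and the polar part of \<open>x\<close> implements an equivalence of \<open>p\<close> with a projection below \<open>E n\<close>.\<close>

lemma stab_projection_equiv_matrix:
  fixes C :: "'a::complex_hilbert bop set"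
  assumes C: "star_subalgebra C" "closed C" "1 \<in> C" and p: "p \<in> stab C" "op_projection p"
  obtains q where "q \<in> mat_projections C" "op_equiv (stab C) p (opmat q)"
proof -
  have sC: "subalgebra C"
    using C by (auto simp: star_subalgebra_def)
  note S = subalgebra_stab[OF sC C(2)] closed_stab[OF C(2)]
  have pp: "p * p = p" "star p = p"
    using p(2) by (auto simp: op_projection_def)
  obtain n where n: "norm (E n * p - p) < 1"
    using metric_LIMSEQ_D[OF stab_tendsto(1)[OF p(1)], of 1] by (auto simp: dist_norm)
  define y where "y = p - p * E n * p"
  have "y = p * (p - E n * p)"
    by (simp add: y_def algebra_simps pp)
  then have "norm y \<le> norm p * norm (E n * p - p)"
    using norm_mult_ineq[of p "p - E n * p"] by (simp add: norm_minus_commute)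
  also have "\<dots> \<le> 1 * norm (E n * p - p)"
    by (intro mult_right_mono norm_op_projection_le p(2) norm_ge_zero)
  finally have y1: "norm y < 1"
    using n by simp
  have star_y: "star y = y"
    by (simp add: y_def star_diff star_mult pp mult.assoc)
  have En: "E n \<in> stab C"
    by (rule stab_coord_proj[OF sC C(2,3)])
  have y: "y \<in> stab C"
    unfolding y_def by (intro subalgebra_diff[OF S(1)] subalgebraD(3)[OF S(1)] p(1) En)
  have py: "p * y = y" "y * p = y"
    by (simp_all add: y_def algebra_simps pp) (simp_all add: pp flip: mult.assoc)
  obtain h where h: "h * h * (1 - y) = 1" "star h = h" and comm: "\<And>q. q * y = y * q \<Longrightarrow> q * h = h * q"
    and mem: "\<And>q. q \<in> stab C \<Longrightarrow> q * h \<in> stab C"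
    using inverse_sqrt_exists[OF y1 star_y] S y by metis
  have ph: "p * h = h * p"
    by (rule comm) (simp add: py)
  have yh: "y * h = h * y"
    by (rule comm) simp
  define v where "v = E n * (p * h)"
  have v: "v \<in> stab C"
    unfolding v_def by (intro subalgebraD(3)[OF S(1)] En mem p(1))
  have vp: "v * p = v"
    by (simp add: v_def ph mult.assoc pp)
  have "star v * v = h * (p * E n * p) * h"
    by (simp add: v_def star_mult h pp mult.assoc)
  also have "p * E n * p = p * (1 - y)"
    by (simp add: y_def algebra_simps pp) (simp add: pp flip: mult.assoc)
  also have "h * (p * (1 - y)) * h = (h * p) * ((1 - y) * h)"
    by (simp only: mult.assoc)
  also have "(1 - y) * h = h * (1 - y)"
    by (simp add: algebra_simps yh)
  also have "(h * p) * (h * (1 - y)) = p * (h * h * (1 - y))"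
    unfolding ph[symmetric] by (simp only: mult.assoc)
  finally have v1: "star v * v = p"
    by (simp add: h)
  have proj: "op_projection (v * star v)"
    by (rule partial_isometry(3)) (simp add: v1 p)
  define q where "q = mat n n (\<lambda>(i, j). entry (v * star v) i j)"
  have "v * star v \<in> stab C"
    by (intro subalgebraD(3)[OF S(1)] v stab_star[OF C(1)])
  then have q: "q \<in> matrices_over n n C"
    using stabD(1) by (auto simp: q_def matrices_over_iff)
  have "opmat q = E n * (v * star v) * E n"
    by (simp add: q_def coord_proj_opmat)
  also have "\<dots> = v * star v"
    by (simp add: v_def star_mult mult.assoc)
  finally have qv: "opmat q = v * star v" .
  note cq = matrices_over_carrier[OF q]
  have "opmat (mat_star q) = opmat q" "opmat (q * q) = opmat q"
    using proj by (simp_all add: opmat_star opmat_mult[OF cq cq] qv op_projection_def)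
  note eq = this
  have "mat_star q = q"
    by (rule opmat_inject[OF eq(1) mat_star_carrier[OF cq] cq])
  moreover have "q * q = q"
    by (rule opmat_inject[OF eq(2) mult_carrier_mat[OF cq cq] cq])
  ultimately have "q \<in> mat_projections C"
    using q by (auto simp: mat_projections_def)
  moreover have "op_equiv (stab C) p (opmat q)"
    unfolding op_equiv_def qv using v v1 stab_star[OF C(1) v] by blast
  ultimately show ?thesis
    by (rule that)
qed

section \<open>Norms of operator matrices\<close>

definition sq_norm :: "nat \<Rightarrow> (nat \<Rightarrow> 'a::real_normed_vector) \<Rightarrow> real"
  where "sq_norm n x = (\<Sum>j<n. (norm (x j))\<^sup>2)"

definition opmat_image :: "'a::complex_hilbert bop mat \<Rightarrow> (nat \<Rightarrow> 'a) \<Rightarrow> nat \<Rightarrow> 'a"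
  where "opmat_image M x i = (\<Sum>j<dim_col M. bop_apply (M $$ (i, j)) (x j))"

definition opmat_bdd :: "'a::complex_hilbert bop mat \<Rightarrow> real \<Rightarrow> bool"
  where "opmat_bdd M c \<longleftrightarrow>
    (\<forall>x. sq_norm (dim_row M) (opmat_image M x) \<le> c\<^sup>2 * sq_norm (dim_col M) x)"

lemma sq_norm_mono: "(\<And>j. j < n \<Longrightarrow> norm (x j) \<le> norm (y j)) \<Longrightarrow> sq_norm n x \<le> sq_norm n y"
  unfolding sq_norm_def by (intro sum_mono power_mono) auto

text \<open>A rescaling of the column \<open>x\<close> passes from the supremum over the unit ball to an estimate for all columns.\<close>

lemma opmat_norm_facts:
  fixes M :: "'a::complex_hilbert bop mat"
  shows opmat_norm_nonneg: "0 \<le> opmat_norm M"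
    and opmat_norm_le_iff: "0 \<le> c \<Longrightarrow> opmat_norm M \<le> c \<longleftrightarrow> opmat_bdd M c"
proof -
  let ?s = "sq_norm (dim_col M) :: (nat \<Rightarrow> 'a) \<Rightarrow> real"
  define N where "N x = sq_norm (dim_row M) (opmat_image M x)" for x
  have norm_def: "opmat_norm M = (SUP x\<in>{x. ?s x \<le> 1}. sqrt (N x))"
    by (simp add: opmat_norm_def sq_norm_def opmat_image_def N_def)
  have ne: "(\<lambda>_. 0) \<in> {x. ?s x \<le> 1}" and N0: "N (\<lambda>_. 0) = 0"
    by (simp_all add: sq_norm_def opmat_image_def N_def)
  have bdd: "bdd_above ((\<lambda>x. sqrt (N x)) ` {x. ?s x \<le> 1})"
  proof (rule bdd_aboveI2)
    fix x assume "x \<in> {x. ?s x \<le> 1}"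
    then have sx: "?s x \<le> 1" by simp
    have "norm (x j) \<le> 1" if "j < dim_col M" for j
    proof -
      have "(norm (x j))\<^sup>2 \<le> ?s x"
        unfolding sq_norm_def using that by (intro member_le_sum) auto
      then have "(norm (x j))\<^sup>2 \<le> 1\<^sup>2" using sx by simp
      then show ?thesis by (rule power2_le_imp_le) simp
    qed
    then have "norm (bop_apply (M $$ (i, j)) (x j)) \<le> norm (M $$ (i, j))" if "j < dim_col M" for i j
      using norm_bop_apply[of "M $$ (i, j)" "x j"] mult_left_mono[of "norm (x j)" 1 "norm (M $$ (i, j))"] that
      by fastforce
    then have "norm (opmat_image M x i) \<le> (\<Sum>j<dim_col M. norm (M $$ (i, j)))" for i
      unfolding opmat_image_def by (intro sum_norm_le) auto
    then have "N x \<le> sq_norm (dim_row M) (\<lambda>i. \<Sum>j<dim_col M. norm (M $$ (i, j)))"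
      unfolding N_def by (intro sq_norm_mono) (simp add: sum_nonneg)
    then show "sqrt (N x) \<le> sqrt (sq_norm (dim_row M) (\<lambda>i. \<Sum>j<dim_col M. norm (M $$ (i, j))))"
      by simp
  qed
  have upper: "sqrt (N x) \<le> opmat_norm M" if "?s x \<le> 1" for x
    unfolding norm_def using that by (intro cSUP_upper bdd) simp
  from upper[of "\<lambda>_. 0"] ne N0 show "0 \<le> opmat_norm M" by simp
  assume c: "0 \<le> c"
  show "opmat_norm M \<le> c \<longleftrightarrow> opmat_bdd M c"
  proof
    assume le: "opmat_norm M \<le> c"
    have "N x \<le> c\<^sup>2 * ?s x" for x
    proof (cases "?s x = 0")
      case True
      then have "x j = 0" if "j < dim_col M" for j
        using that by (auto simp: sq_norm_def sum_nonneg_eq_0_iff)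
      then show ?thesis
        by (simp add: N_def sq_norm_def opmat_image_def)
    next
      case False
      moreover have "0 \<le> ?s x" by (simp add: sq_norm_def sum_nonneg)
      ultimately have pos: "0 < ?s x" by simp
      define t where "t = inverse (sqrt (?s x))"
      have t2: "t\<^sup>2 = inverse (?s x)"
        using pos by (simp add: t_def power_inverse)
      have "?s (\<lambda>j. t *\<^sub>R x j) = t\<^sup>2 * ?s x"
        by (simp add: sq_norm_def power_mult_distrib sum_distrib_left)
      then have "sqrt (N (\<lambda>j. t *\<^sub>R x j)) \<le> c"
        using upper[of "\<lambda>j. t *\<^sub>R x j"] le pos by (simp add: t2)
      then have "N (\<lambda>j. t *\<^sub>R x j) \<le> c\<^sup>2"
        by (metis real_sqrt_le_iff real_sqrt_abs abs_of_nonneg c)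
      moreover have "N (\<lambda>j. t *\<^sub>R x j) = t\<^sup>2 * N x"
        by (simp add: N_def sq_norm_def opmat_image_def bop_apply_scaleR_right power_mult_distrib
            sum_distrib_left flip: scaleR_sum_right)
      ultimately show ?thesis
        using pos by (simp add: t2 field_simps)
    qed
    then show "opmat_bdd M c"
      by (simp add: opmat_bdd_def N_def)
  next
    assume b: "opmat_bdd M c"
    show "opmat_norm M \<le> c"
      unfolding norm_def
    proof (rule cSUP_least)
      fix x assume "x \<in> {x. ?s x \<le> 1}"
      then have sx: "?s x \<le> 1" by simp
      have "N x \<le> c\<^sup>2 * ?s x"
        using b by (simp add: opmat_bdd_def N_def)
      also have "\<dots> \<le> c\<^sup>2 * 1"
        using sx by (intro mult_left_mono) auto
      finally show "sqrt (N x) \<le> c"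
        using c by (intro real_le_lsqrt) auto
    qed (use ne in auto)
  qed
qed

lemma opmat_norm_leI:
  assumes "\<And>c. 0 \<le> c \<Longrightarrow> opmat_bdd M c \<Longrightarrow> opmat_bdd N c"
  shows "opmat_norm N \<le> opmat_norm M"
  using assms[OF opmat_norm_nonneg, OF opmat_norm_le_iff[THEN iffD1, OF opmat_norm_nonneg order_refl]]
  by (rule opmat_norm_le_iff[THEN iffD2, OF opmat_norm_nonneg])

lemma norm_le_iff_square: "0 \<le> c \<Longrightarrow> norm T \<le> c \<longleftrightarrow> (\<forall>x. (norm (bop_apply T x))\<^sup>2 \<le> c\<^sup>2 * (norm x)\<^sup>2)"
proof
  assume c: "0 \<le> c" and le: "norm T \<le> c"
  show "\<forall>x. (norm (bop_apply T x))\<^sup>2 \<le> c\<^sup>2 * (norm x)\<^sup>2"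
  proof
    fix x
    have "norm (bop_apply T x) \<le> c * norm x"
      using norm_bop_apply[of T x] mult_right_mono[OF le, of "norm x"] by simp
    then show "(norm (bop_apply T x))\<^sup>2 \<le> c\<^sup>2 * (norm x)\<^sup>2"
      unfolding power_mult_distrib[symmetric] by (rule power_mono) simp
  qed
next
  assume c: "0 \<le> c" and le: "\<forall>x. (norm (bop_apply T x))\<^sup>2 \<le> c\<^sup>2 * (norm x)\<^sup>2"
  show "norm T \<le> c"
  proof (rule norm_bop_bound)
    fix x
    have "(norm (bop_apply T x))\<^sup>2 \<le> (c * norm x)\<^sup>2"
      using le by (simp add: power_mult_distrib)
    then show "norm (bop_apply T x) \<le> c * norm x"
      by (rule power2_le_imp_le) (use c in simp)
  qed (rule c)
qed

lemma opmat_norm_single: "opmat_norm (mat 1 1 (\<lambda>_. T)) = norm T"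
proof (rule antisym)
  have bdd: "opmat_bdd (mat 1 1 (\<lambda>_. T)) c \<longleftrightarrow> norm T \<le> c" if "0 \<le> c" for c
  proof -
    have "opmat_bdd (mat 1 1 (\<lambda>_. T)) c
        \<longleftrightarrow> (\<forall>x :: nat \<Rightarrow> _. (norm (bop_apply T (x 0)))\<^sup>2 \<le> c\<^sup>2 * (norm (x 0))\<^sup>2)"
      by (simp add: opmat_bdd_def sq_norm_def opmat_image_def)
    also have "\<dots> \<longleftrightarrow> (\<forall>x. (norm (bop_apply T x))\<^sup>2 \<le> c\<^sup>2 * (norm x)\<^sup>2)"
    proof
      assume all: "\<forall>x :: nat \<Rightarrow> _. (norm (bop_apply T (x 0)))\<^sup>2 \<le> c\<^sup>2 * (norm (x 0))\<^sup>2"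
      show "\<forall>x. (norm (bop_apply T x))\<^sup>2 \<le> c\<^sup>2 * (norm x)\<^sup>2"
        using all[rule_format, of "\<lambda>_. y" for y] by simp
    qed simp
    finally show ?thesis
      using norm_le_iff_square[OF that, of T] by simp
  qed
  show "opmat_norm (mat 1 1 (\<lambda>_. T)) \<le> norm T"
    by (simp only: opmat_norm_le_iff[OF norm_ge_zero] bdd[OF norm_ge_zero] order_refl)
  show "norm T \<le> opmat_norm (mat 1 1 (\<lambda>_. T))"
    using bdd[OF opmat_norm_nonneg] opmat_norm_le_iff[OF opmat_norm_nonneg] order_refl by blast
qed

lemma completely_isometric_norm:
  assumes "completely_isometric_on A \<phi>" "a \<in> A"
  shows "norm (\<phi> a) = norm a"
proof -
  have "mat 1 1 (\<lambda>_. a) \<in> matrices_over 1 1 A"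
    using assms(2) by (simp add: matrices_over_iff)
  then have "opmat_norm (map_mat \<phi> (mat 1 1 (\<lambda>_. a))) = opmat_norm (mat 1 1 (\<lambda>_. a))"
    using assms(1) by (simp add: completely_isometric_on_def)
  moreover have "map_mat \<phi> (mat 1 1 (\<lambda>_. a)) = mat 1 1 (\<lambda>_. \<phi> a)"
    by (rule eq_matI) auto
  ultimately show ?thesis
    by (simp only: opmat_norm_single)
qed

lemma opmat_bdd_compress:
  fixes M :: "'a::complex_hilbert bop mat"
  assumes b: "opmat_bdd M c" and S: "norm S \<le> 1" and T: "norm T \<le> 1"
  shows "opmat_bdd (map_mat (\<lambda>X. S * X * T) M) c"
  unfolding opmat_bdd_def
proof
  fix x :: "nat \<Rightarrow> 'a"
  let ?M = "map_mat (\<lambda>X. S * X * T) M" and ?y = "\<lambda>j. bop_apply T (x j)"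
  have contr: "norm (bop_apply R y) \<le> norm y" if "norm R \<le> 1" for R y
    using norm_bop_apply[of R y] mult_right_mono[OF that, of "norm y"] by simp
  have "sq_norm (dim_row ?M) (opmat_image ?M x) = sq_norm (dim_row M) (\<lambda>i. bop_apply S (opmat_image M ?y i))"
    by (simp add: sq_norm_def opmat_image_def bop_apply_sum_right)
  also have "\<dots> \<le> sq_norm (dim_row M) (opmat_image M ?y)"
    by (intro sq_norm_mono contr S)
  also have "\<dots> \<le> c\<^sup>2 * sq_norm (dim_col M) ?y"
    using b unfolding opmat_bdd_def by blast
  also have "\<dots> \<le> c\<^sup>2 * sq_norm (dim_col M) x"
    by (intro mult_left_mono sq_norm_mono contr T) simp
  finally show "sq_norm (dim_row ?M) (opmat_image ?M x) \<le> c\<^sup>2 * sq_norm (dim_col ?M) x"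
    by simp
qed

text \<open>Only the coordinate \<open>0\<close> of the vectors matters on the left hand side.\<close>

lemma opmat_norm_embed: "opmat_norm (map_mat (\<lambda>a. embed a 0 0) M) = opmat_norm M"
proof -
  let ?e = "map_mat (\<lambda>a. embed a 0 0) M"
  have single_sum: "(\<Sum>j\<in>J. l2_single 0 (f j)) = l2_single 0 (sum f J)" for f :: "nat \<Rightarrow> 'a" and J
    by (induction J rule: infinite_finite_induct) (auto simp: l2_single_add)
  have e: "sq_norm (dim_row ?e) (opmat_image ?e x) = sq_norm (dim_row M) (opmat_image M (\<lambda>j. l2_nth (x j) 0))" for x
    by (simp add: sq_norm_def opmat_image_def single_sum)
  have "opmat_bdd ?e c \<longleftrightarrow> opmat_bdd M c" for c
  proof
    assume b: "opmat_bdd ?e c"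
    show "opmat_bdd M c"
      unfolding opmat_bdd_def
    proof
      fix x
      show "sq_norm (dim_row M) (opmat_image M x) \<le> c\<^sup>2 * sq_norm (dim_col M) x"
        using b[unfolded opmat_bdd_def e, rule_format, of "\<lambda>j. l2_single 0 (x j)"]
        by (simp add: sq_norm_def[of "dim_col M"])
    qed
  next
    assume b: "opmat_bdd M c"
    show "opmat_bdd ?e c"
      unfolding opmat_bdd_def e
    proof
      fix x
      have "sq_norm (dim_row M) (opmat_image M (\<lambda>j. l2_nth (x j) 0))
          \<le> c\<^sup>2 * sq_norm (dim_col M) (\<lambda>j. l2_nth (x j) 0)"
        using b unfolding opmat_bdd_def by blast
      also have "\<dots> \<le> c\<^sup>2 * sq_norm (dim_col ?e) x"
        by (simp add: mult_left_mono sq_norm_mono norm_l2_nth_le)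
      finally show "sq_norm (dim_row M) (opmat_image M (\<lambda>j. l2_nth (x j) 0)) \<le> c\<^sup>2 * sq_norm (dim_col ?e) x" .
    qed
  qed
  then show ?thesis
    by (intro antisym opmat_norm_leI) auto
qed

lemma map_mat_eqI:
  assumes "M \<in> matrices_over m n A" "\<And>a. a \<in> A \<Longrightarrow> f a = g a"
  shows "map_mat f M = map_mat g M"
  using assms by (intro eq_matI) (auto simp: matrices_over_iff)

lemma map_mat_map_mat: "map_mat f (map_mat g M) = map_mat (\<lambda>a. f (g a)) M"
  by (rule eq_matI) auto

lemma algebra_isoD:
  assumes "algebra_iso A B \<phi>"
  shows "a \<in> A \<Longrightarrow> \<phi> a \<in> B" "bij_betw \<phi> A B"
    "a \<in> A \<Longrightarrow> b \<in> A \<Longrightarrow> \<phi> (a + b) = \<phi> a + \<phi> b" "a \<in> A \<Longrightarrow> b \<in> A \<Longrightarrow> \<phi> (a * b) = \<phi> a * \<phi> b"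
    "a \<in> A \<Longrightarrow> \<phi> (c *\<^sub>C a) = c *\<^sub>C \<phi> a"
  using assms by (auto simp: algebra_iso_def bij_betw_def)

lemma algebra_iso_zero: "algebra_iso A B \<phi> \<Longrightarrow> subalgebra A \<Longrightarrow> \<phi> 0 = 0"
  using algebra_isoD(3)[of A B \<phi> 0 0] by (simp add: subalgebraD(1))

lemma algebra_iso_inverse:
  assumes \<phi>: "algebra_iso A B \<phi>" and A: "subalgebra A"
  shows "algebra_iso B A (inv_into A \<phi>)"
proof -
  let ?\<psi> = "inv_into A \<phi>"
  note bij = algebra_isoD(2)[OF \<phi>]
  have mem: "?\<psi> b \<in> A" and inv: "\<phi> (?\<psi> b) = b" if "b \<in> B" for b
    using bij that by (auto simp: bij_betw_def inv_into_into f_inv_into_f)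
  have eq: "?\<psi> b = a" if "a \<in> A" "\<phi> a = b" for a b
    using bij that by (auto simp: bij_betw_def)
  show ?thesis
    unfolding algebra_iso_def
  proof (intro conjI ballI allI)
    show "bij_betw ?\<psi> B A" by (rule bij_betw_inv_into[OF bij])
  next
    fix a b assume "a \<in> B" "b \<in> B"
    then show "?\<psi> (a + b) = ?\<psi> a + ?\<psi> b" "?\<psi> (a * b) = ?\<psi> a * ?\<psi> b"
      by (intro eq; simp add: mem inv algebra_isoD[OF \<phi>] subalgebraD[OF A])+
  next
    fix c a assume "a \<in> B"
    then show "?\<psi> (c *\<^sub>C a) = c *\<^sub>C ?\<psi> a"
      by (intro eq; simp add: mem inv algebra_isoD[OF \<phi>] subalgebraD[OF A])
  qed
qed

lemma completely_isometric_inverse: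
  assumes \<phi>: "algebra_iso A B \<phi>" and ci: "completely_isometric_on A \<phi>"
  shows "completely_isometric_on B (inv_into A \<phi>)"
  unfolding completely_isometric_on_def
proof (intro allI ballI)
  fix n M assume M: "M \<in> matrices_over n n B"
  let ?N = "map_mat (inv_into A \<phi>) M"
  note bij = algebra_isoD(2)[OF \<phi>]
  have "inv_into A \<phi> b \<in> A" "\<phi> (inv_into A \<phi> b) = b" if "b \<in> B" for b
    using bij that by (auto simp: bij_betw_def inv_into_into f_inv_into_f)
  then have "?N \<in> matrices_over n n A" "map_mat \<phi> ?N = M"
    using M by (auto simp: matrices_over_iff intro!: eq_matI)
  then show "opmat_norm ?N = opmat_norm M"
    using ci unfolding completely_isometric_on_def by metis
qed

section \<open>Isometric isomorphisms and the diagonal\<close>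

lemma diag_algebra_iff: "a \<in> diag_algebra A \<longleftrightarrow> a \<in> A \<and> star a \<in> A" for a :: "'a::involutive_algebra"
  unfolding diag_algebra_def by (metis IntD1 IntD2 IntI image_iff star_star)

lemma star_subalgebra_diag:
  assumes A: "subalgebra (A :: 'a::involutive_algebra set)"
  shows "star_subalgebra (diag_algebra A)"
  using subalgebraD[OF A]
  by (auto simp: star_subalgebra_def subalgebra_def diag_algebra_iff star_add star_mult star_scaleC)

lemma closed_diag:
  assumes "closed (A :: 'a::complex_hilbert bop set)"
  shows "closed (diag_algebra A)"
proof -
  have "closed (star -` A)"
    by (intro closed_vimage assms linear_continuous_on bounded_linear_star)
  moreover have "diag_algebra A = A \<inter> star -` A"
    by (auto simp: diag_algebra_iff)
  ultimately show ?thesis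
    using assms by (simp add: closed_Int)
qed

lemma stab_diag:
  assumes "T \<in> stab A" "star T \<in> stab A"
  shows "T \<in> stab (diag_algebra A)"
proof -
  have "star (entry T i j) \<in> A" for i j
    using stabD(1)[OF assms(2), of j i] by (simp add: entry_star)
  then show ?thesis
    using assms(1) by (auto simp: stab_def diag_algebra_iff)
qed

lemma stab_diag_subset: "stab (diag_algebra A) \<subseteq> stab A" for A :: "'a::complex_hilbert bop set"
  by (auto simp: stab_def diag_algebra_iff)

text \<open>The unit acts as the identity on the vectors \<open>a x\<close>, which span a dense subspace.\<close>

lemma unital_operator_algebra_one:
  assumes A: "operator_algebra A" and e: "is_unit_of e A"
  shows "e = 1"
proof -
  have "closed (bop_apply (e - 1) -` {0})"
    by (intro closed_vimage closed_singleton linear_continuous_on bounded_linear_bop_apply)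
  then have "closed {x. bop_apply (e - 1) x = 0}"
    by (simp add: vimage_def)
  moreover have "span {bop_apply a x |a x. a \<in> A} \<subseteq> {x. bop_apply (e - 1) x = 0}"
  proof
    fix y assume "y \<in> span {bop_apply a x |a x. a \<in> A}"
    then have "bop_apply (e - 1) y = 0"
    proof (rule linear_eq_0_on_span[OF bounded_linear.linear[OF bounded_linear_bop_apply], rotated])
      fix z assume "z \<in> {bop_apply a x |a x. a \<in> A}"
      then obtain a x where "z = bop_apply a x" "a \<in> A" by blast
      moreover have "bop_apply (e * a) x = bop_apply a x"
        using e \<open>a \<in> A\<close> by (simp only: is_unit_of_def)
      ultimately show "bop_apply (e - 1) z = 0"
        by simp
    qed
    then show "y \<in> {x. bop_apply (e - 1) x = 0}" by simp
  qed
  ultimately have "closure (span {bop_apply a x |a x. a \<in> A}) \<subseteq> {x. bop_apply (e - 1) x = 0}"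
    by (rule closure_minimal[rotated])
  then have "bop_apply (e - 1) x = 0" for x
    using A unfolding operator_algebra_def nondegenerate_def by auto
  then show ?thesis
    by (intro bop_eqI) simp
qed

text \<open>For a contractive idempotent, a vector of the range has minimal norm in its coset modulo the
  kernel, hence is orthogonal to the kernel.\<close>

lemma contractive_idempotent:
  fixes p :: "'a::complex_hilbert bop"
  assumes idem: "p * p = p" and le: "norm p \<le> 1"
  shows "op_projection p"
proof -
  have real_orth: "inner (bop_apply p x) z = 0" if z: "bop_apply p z = 0" for x z
  proof (rule ccontr)
    let ?w = "bop_apply p x"
    assume a: "inner ?w z \<noteq> 0"
    then have n: "inner z z > 0" by auto
    \<comment> \<open>The multiple of \<open>z\<close> that makes the norm of the sum minimal.\<close>
    define t where "t = - inner ?w z / inner z z"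
    have "bop_apply p (?w + t *\<^sub>R z) = ?w"
      using idem z by (simp add: bop_apply_add_right bop_apply_scaleR_right flip: bop_apply_mult)
    then have "norm ?w \<le> norm (?w + t *\<^sub>R z)"
      using norm_bop_apply[of p "?w + t *\<^sub>R z"] mult_right_mono[OF le, of "norm (?w + t *\<^sub>R z)"] by simp
    then have "inner ?w ?w \<le> inner (?w + t *\<^sub>R z) (?w + t *\<^sub>R z)"
      by (simp add: norm_eq_sqrt_inner)
    also have "\<dots> = inner ?w ?w + 2 * t * inner ?w z + t * t * inner z z"
      by (simp add: inner_add_left inner_add_right inner_commute algebra_simps)
    finally have "0 \<le> 2 * t * inner ?w z + t * t * inner z z"
      by simp
    moreover have "2 * t * inner ?w z + t * t * inner z z = - ((inner ?w z)\<^sup>2 / inner z z)"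
      using n by (simp add: t_def power2_eq_square field_simps)
    moreover have "(inner ?w z)\<^sup>2 / inner z z > 0"
      using a n by simp
    ultimately show False by linarith
  qed
  have "cinner (bop_apply p x) (y - bop_apply p y) = cinner (0 :: 'a) 0" for x y
  proof (rule cinner_eq_of_inner)
    have ker: "bop_apply p (y - bop_apply p y) = 0"
      using idem by (simp add: bop_apply_diff_right flip: bop_apply_mult)
    show "inner (bop_apply p x) (y - bop_apply p y) = inner (0 :: 'a) 0"
      using real_orth[OF ker] by simp
    show "inner (\<i> *\<^sub>C bop_apply p x) (y - bop_apply p y) = inner (\<i> *\<^sub>C (0 :: 'a)) 0"
      using real_orth[OF ker, of "\<i> *\<^sub>C x"] by (simp add: bop_apply_scaleC_right)
  qed
  then have "cinner (bop_apply p x) y = cinner (bop_apply p x) (bop_apply p y)" for x y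
    by (simp add: cinner_diff_right)
  then have "star p = star p * p"
    by (intro star_eqI) (simp add: cinner_star)
  then have "star p = p"
    by (metis star_mult star_star)
  then show ?thesis
    using idem by (simp add: op_projection_def)
qed

text \<open>Between the ranges of \<open>P\<close> and \<open>Q\<close> the contractions \<open>w\<close> and \<open>w'\<close> are inverse to each other, so
  both of them are isometric there, and the inverse of a unitary is its adjoint.\<close>

lemma contractive_inverse_adjoint:
  assumes P: "op_projection P" and wP: "w * P = w" and w'Q: "w' * Q = w'"
    and w'w: "w' * w = P" and ww': "w * w' = Q" and Q: "op_projection Q"
    and le: "norm w \<le> 1" "norm w' \<le> 1"
  shows "star w = w'"
proof -
  have contr: "norm (bop_apply T y) \<le> norm y" if "norm T \<le> 1" for T :: "'a bop" and y
    using norm_bop_apply[of T y] mult_right_mono[OF that, of "norm y"] by simp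
  have "norm (bop_apply w x) = norm (bop_apply P x)" for x
  proof (rule antisym)
    show "norm (bop_apply w x) \<le> norm (bop_apply P x)"
      using contr[OF le(1), of "bop_apply P x"] wP by (simp flip: bop_apply_mult)
    show "norm (bop_apply P x) \<le> norm (bop_apply w x)"
      using contr[OF le(2), of "bop_apply w x"] w'w by (simp flip: bop_apply_mult)
  qed
  then have "star w * w = star P * P"
    by (rule star_mult_self_eqI)
  then have ww: "star w * w = P"
    using P by (simp add: op_projection_def)
  have Qw: "Q * w = w"
    using wP by (simp add: w'w mult.assoc flip: ww')
  have "star w = star (Q * w)"
    by (simp add: Qw)
  also have "\<dots> = star w * w * w'"
    using Q by (simp add: star_mult op_projection_def mult.assoc ww')
  also have "\<dots> = w' * (w * w')"
    by (simp only: ww w'w[symmetric] mult.assoc)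
  also have "\<dots> = w'"
    by (simp add: ww' w'Q)
  finally show ?thesis .
qed

text \<open>An isometric isomorphism of algebras of operators is not required to respect adjoints, but it
  does so for projections and for partial isometries whose adjoints belong to the algebra.\<close>

locale isometric_iso =
  fixes A :: "'a::complex_hilbert bop set" and B :: "'b::complex_hilbert bop set" and \<phi>
  assumes A: "subalgebra A" and B: "subalgebra B" and iso: "algebra_iso A B \<phi>"
    and isometric: "a \<in> A \<Longrightarrow> norm (\<phi> a) = norm a"
begin

lemma projection: "p \<in> A \<Longrightarrow> op_projection p \<Longrightarrow> op_projection (\<phi> p)"
  using norm_op_projection_le[of p]
  by (intro contractive_idempotent) (auto simp: isometric op_projection_def simp flip: algebra_isoD(4)[OF iso])

lemma equiv:
  assumes pq: "op_equiv A p q" and p: "op_projection p"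
  shows "op_equiv B (\<phi> p) (\<phi> q)"
proof -
  obtain v where v: "v \<in> A" "star v \<in> A" "star v * v = p" "v * star v = q"
    using pq by (auto simp: op_equiv_def)
  have q: "op_projection q"
    by (rule op_equiv_projection[OF pq p])
  have pqA: "p \<in> A" "q \<in> A"
    using subalgebraD(3)[OF A] v by auto
  have v3: "v * p = v" "star v * q = star v"
    using partial_isometry(1,2)[of v] v p by (auto simp: mult.assoc)
  note mult = algebra_isoD(4)[OF iso]
  have "star (\<phi> v) = \<phi> (star v)"
  proof (rule contractive_inverse_adjoint)
    show "op_projection (\<phi> p)" "op_projection (\<phi> q)"
      using projection pqA p q by auto
    show "\<phi> v * \<phi> p = \<phi> v" "\<phi> (star v) * \<phi> q = \<phi> (star v)" "\<phi> (star v) * \<phi> v = \<phi> p" "\<phi> v * \<phi> (star v) = \<phi> q"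
      using v v3 pqA by (simp_all flip: mult)
    show "norm (\<phi> v) \<le> 1" "norm (\<phi> (star v)) \<le> 1"
      using norm_partial_isometry_le[of v] v p by (simp_all add: isometric)
  qed
  then show ?thesis
    unfolding op_equiv_def
    using v algebra_isoD(1)[OF iso] by (intro bexI[of _ "\<phi> v"]) (auto simp flip: mult)
qed

end

lemma isometric_iso_inverse:
  assumes "isometric_iso A B \<phi>"
  shows "isometric_iso B A (inv_into A \<phi>)"
proof -
  interpret isometric_iso A B \<phi> by (rule assms)
  let ?\<psi> = "inv_into A \<phi>"
  have inv: "algebra_iso B A ?\<psi>"
    by (rule algebra_iso_inverse[OF iso A])
  have "inv_into A \<phi> b \<in> A" "\<phi> (inv_into A \<phi> b) = b" if "b \<in> B" for b
    using algebra_isoD(2)[OF iso] that by (auto simp: bij_betw_def inv_into_into f_inv_into_f)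
  note \<psi> = this
  show ?thesis
    by standard (use A B inv \<psi> isometric in \<open>auto simp flip: isometric\<close>)
qed

section \<open>Stable isomorphisms and the dimension of projections\<close>

lemma op_equiv_stab_diag: "op_equiv (stab A) p q \<Longrightarrow> op_equiv (stab (diag_algebra A)) p q"
  unfolding op_equiv_def by (metis stab_diag star_star)

lemma opmat_empty: "opmat (0\<^sub>m 0 0) = 0"
  by (simp add: opmat_def)

lemma opmat_direct_sum_orthogonal:
  assumes p: "p \<in> carrier_mat n n" and q: "q \<in> carrier_mat m m"
  shows "opmat (p \<oplus>\<^sub>m 0\<^sub>m m m) * opmat (0\<^sub>m n n \<oplus>\<^sub>m q) = 0"
proof -
  have "(p \<oplus>\<^sub>m 0\<^sub>m m m) \<in> carrier_mat (n + m) (n + m)" "(0\<^sub>m n n \<oplus>\<^sub>m q) \<in> carrier_mat (n + m) (n + m)"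
    using p q by auto
  from opmat_mult[OF this]
  have "opmat (p \<oplus>\<^sub>m 0\<^sub>m m m) * opmat (0\<^sub>m n n \<oplus>\<^sub>m q) = opmat (p * 0\<^sub>m n n \<oplus>\<^sub>m 0\<^sub>m m m * q)"
    using p q by (simp add: direct_sum_mult[of p n n "0\<^sub>m m m" m m "0\<^sub>m n n" n q m])
  also have "\<dots> = opmat (0\<^sub>m n n \<oplus>\<^sub>m 0\<^sub>m m m)"
    using p q by simp
  also have "\<dots> = 0"
    by (rule entry_eqI) (auto simp: entry_opmat direct_sum_index)
  finally show ?thesis .
qed

primrec direct_multiple :: "nat \<Rightarrow> 'a::zero mat \<Rightarrow> 'a mat" where
  "direct_multiple 0 p = 0\<^sub>m 0 0"
| "direct_multiple (Suc k) p = p \<oplus>\<^sub>m direct_multiple k p"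

lemma direct_multiple_projection:
  "subalgebra C \<Longrightarrow> p \<in> mat_projections C \<Longrightarrow> direct_multiple k p \<in> mat_projections C"
  for C :: "'a::involutive_algebra set"
  by (induction k) (auto simp: zero_projection direct_sum_projection)

lemma dimension_direct_multiple:
  fixes C :: "'a::involutive_algebra set"
  assumes C: "star_subalgebra C" "has_cancellation C" "\<theta> \<in> K0_identifications C" and p: "p \<in> mat_projections C"
  shows "\<theta> (K0_class C (direct_multiple k p)) = int k * \<theta> (K0_class C p)"
proof (induction k)
  case 0
  have "0\<^sub>m 0 0 \<in> mat_projections C"
    using C by (simp add: star_subalgebra_def zero_projection)
  from dimension_add[OF C p this] show ?case by simp
next
  case (Suc k)
  have "direct_multiple k p \<in> mat_projections C"
    using C p by (simp add: star_subalgebra_def direct_multiple_projection)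
  from dimension_add[OF C p this] Suc show ?case by (simp add: algebra_simps)
qed

locale stab_iso =
  fixes A :: "'a::complex_hilbert bop set" and B :: "'b::complex_hilbert bop set"
    and \<phi> :: "'a l2 bop \<Rightarrow> 'b l2 bop"
  assumes A: "subalgebra A" "closed A" "1 \<in> A" and B: "subalgebra B" "closed B" "1 \<in> B"
    and isometric_iso: "isometric_iso (stab A) (stab B) \<phi>"
begin

sublocale stable: isometric_iso "stab A" "stab B" \<phi>
  by (rule isometric_iso)

lemma inverse: "stab_iso B A (inv_into (stab A) \<phi>)"
  by (simp add: stab_iso_def A B isometric_iso_inverse[OF isometric_iso])

lemma subalgebra_stab_B: "subalgebra (stab B)"
  by (rule subalgebra_stab[OF B(1,2)])

lemma diag:
  "star_subalgebra (diag_algebra A)" "subalgebra (diag_algebra A)" "closed (diag_algebra A)" "1 \<in> diag_algebra A"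
  "star_subalgebra (diag_algebra B)" "subalgebra (diag_algebra B)" "closed (diag_algebra B)" "1 \<in> diag_algebra B"
  using star_subalgebra_diag[OF A(1)] star_subalgebra_diag[OF B(1)] closed_diag[OF A(2)] closed_diag[OF B(2)] A(3) B(3)
  by (auto simp: diag_algebra_iff star_subalgebra_def)

lemma opmat_projection_stab:
  assumes "p \<in> mat_projections (diag_algebra A)"
  shows "opmat p \<in> stab A" "op_projection (\<phi> (opmat p))"
proof -
  obtain n where n: "p \<in> matrices_over n n (diag_algebra A)"
    using assms by (rule mat_projectionsE)
  show "opmat p \<in> stab A"
    using stab_opmat[OF subalgebraD(1)[OF diag(2)] n] stab_diag_subset by blast
  then show "op_projection (\<phi> (opmat p))"
    by (rule stable.projection[OF _ op_projection_opmat[OF assms]])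
qed

lemma mvn_image:
  assumes "(p, q) \<in> murray_von_neumann (diag_algebra A)"
  shows "op_equiv (stab B) (\<phi> (opmat p)) (\<phi> (opmat q))"
proof -
  have "p \<in> mat_projections (diag_algebra A)"
    using assms by (rule mvnE)
  then show ?thesis
    using op_equiv_mono[OF mvn_imp_op_equiv[OF diag(1) assms] stab_diag_subset]
    by (intro stable.equiv op_projection_opmat)
qed

text \<open>The relation that \<open>\<phi>\<close> induces between projections over the two diagonals. It is a bijection of
  equivalence classes that respects direct sums.\<close>

definition corresponds :: "'a bop mat \<Rightarrow> 'b bop mat \<Rightarrow> bool"
  where "corresponds p q \<longleftrightarrow> p \<in> mat_projections (diag_algebra A) \<and> q \<in> mat_projections (diag_algebra B) \<and>
    op_equiv (stab B) (\<phi> (opmat p)) (opmat q)"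

lemma corresponds_exists:
  assumes p: "p \<in> mat_projections (diag_algebra A)"
  shows "\<exists>q. corresponds p q"
proof -
  have proj: "op_projection (\<phi> (opmat p))" and mem: "\<phi> (opmat p) \<in> stab B"
    using opmat_projection_stab[OF p] algebra_isoD(1)[OF stable.iso] by auto
  have "\<phi> (opmat p) \<in> stab (diag_algebra B)"
    by (rule stab_diag) (use proj mem in \<open>auto simp: op_projection_def\<close>)
  from stab_projection_equiv_matrix[OF diag(5,7,8) this proj]
  obtain q where "q \<in> mat_projections (diag_algebra B)" "op_equiv (stab (diag_algebra B)) (\<phi> (opmat p)) (opmat q)"
    by blast
  then show ?thesis
    using p op_equiv_mono[OF _ stab_diag_subset] unfolding corresponds_def by blast
qed

text \<open>This is the existence of corresponding projections for the inverse of \<open>\<phi>\<close>.\<close>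

lemma corresponds_surj:
  assumes q: "q \<in> mat_projections (diag_algebra B)"
  shows "\<exists>p. corresponds p q"
proof -
  let ?\<psi> = "inv_into (stab A) \<phi>"
  interpret inv: stab_iso B A ?\<psi>
    by (rule inverse)
  obtain p where p: "p \<in> mat_projections (diag_algebra A)" and eq: "op_equiv (stab A) (?\<psi> (opmat q)) (opmat p)"
    using inv.corresponds_exists[OF q] unfolding inv.corresponds_def by blast
  have "op_equiv (stab B) (\<phi> (?\<psi> (opmat q))) (\<phi> (opmat p))"
    by (rule stable.equiv[OF eq inv.opmat_projection_stab(2)[OF q]])
  moreover have "\<phi> (?\<psi> (opmat q)) = opmat q"
    using algebra_isoD(2)[OF stable.iso] inv.opmat_projection_stab(1)[OF q]
    by (auto simp: bij_betw_def f_inv_into_f)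
  ultimately have "op_equiv (stab B) (\<phi> (opmat p)) (opmat q)"
    by (simp add: op_equiv_sym)
  then show ?thesis
    unfolding corresponds_def using p q by blast
qed

lemma corresponds_mvn:
  assumes pq: "corresponds p q" and pq': "corresponds p' q'"
    and pp': "(p, p') \<in> murray_von_neumann (diag_algebra A)"
  shows "(q, q') \<in> murray_von_neumann (diag_algebra B)"
proof -
  have p: "p \<in> mat_projections (diag_algebra A)" "p' \<in> mat_projections (diag_algebra A)"
    and q: "q \<in> mat_projections (diag_algebra B)" "q' \<in> mat_projections (diag_algebra B)"
    and eq: "op_equiv (stab B) (\<phi> (opmat p)) (opmat q)" "op_equiv (stab B) (\<phi> (opmat p')) (opmat q')"
    using pq pq' by (auto simp: corresponds_def)
  note trans = op_equiv_trans[OF subalgebra_stab_B]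
  have "op_equiv (stab B) (\<phi> (opmat p)) (opmat q')"
    by (rule trans[OF opmat_projection_stab(2)[OF p(1)] mvn_image[OF pp'] eq(2)])
  then have "op_equiv (stab B) (opmat q) (opmat q')"
    by (rule trans[OF op_projection_opmat[OF q(1)] op_equiv_sym[OF eq(1)]])
  then show ?thesis
    by (rule op_equiv_imp_mvn[OF q op_equiv_stab_diag])
qed

text \<open>The two summands are moved to orthogonal positions of the block diagonal, where equivalences
  can be added.\<close>

lemma corresponds_direct_sum:
  assumes pq: "corresponds p q" and pq': "corresponds p' q'"
  shows "corresponds (p \<oplus>\<^sub>m p') (q \<oplus>\<^sub>m q')"
proof -
  let ?C = "diag_algebra A" and ?D = "diag_algebra B"
  have p: "p \<in> mat_projections ?C" "p' \<in> mat_projections ?C"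
    and q: "q \<in> mat_projections ?D" "q' \<in> mat_projections ?D"
    and eq: "op_equiv (stab B) (\<phi> (opmat p)) (opmat q)" "op_equiv (stab B) (\<phi> (opmat p')) (opmat q')"
    using pq pq' by (auto simp: corresponds_def)
  obtain n where n: "p \<in> carrier_mat n n" using p(1) by (rule mat_projectionsE)
  obtain n' where n': "p' \<in> carrier_mat n' n'" using p(2) by (rule mat_projectionsE)
  obtain m where m: "q \<in> carrier_mat m m" using q(1) by (rule mat_projectionsE)
  obtain m' where m': "q' \<in> carrier_mat m' m'" using q(2) by (rule mat_projectionsE)
  let ?p = "p \<oplus>\<^sub>m 0\<^sub>m n' n'" and ?p' = "0\<^sub>m n n \<oplus>\<^sub>m p'"
  let ?q = "q \<oplus>\<^sub>m 0\<^sub>m m' m'" and ?q' = "0\<^sub>m m m \<oplus>\<^sub>m q'"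
  have proj: "?p \<in> mat_projections ?C" "?p' \<in> mat_projections ?C"
    by (intro direct_sum_projection zero_projection diag p)+
  note trans = op_equiv_trans[OF subalgebra_stab_B]
  have move: "op_equiv (stab B) (\<phi> (opmat r)) (opmat t')"
    if "(r, s) \<in> murray_von_neumann ?C" "op_equiv (stab B) (\<phi> (opmat s)) (opmat t)"
      "(t', t) \<in> murray_von_neumann ?D" for r s t t'
  proof -
    have r: "r \<in> mat_projections ?C" and t: "t \<in> mat_projections ?D"
      using that by (auto elim: mvnE)
    have "op_equiv (stab B) (opmat t') (opmat t)"
      by (rule op_equiv_mono[OF mvn_imp_op_equiv[OF diag(5) that(3)] stab_diag_subset])
    moreover have "op_equiv (stab B) (\<phi> (opmat r)) (opmat t)"
      by (rule trans[OF opmat_projection_stab(2)[OF r] mvn_image[OF that(1)] that(2)])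
    ultimately show ?thesis
      using trans[OF opmat_projection_stab(2)[OF r]] op_equiv_sym by blast
  qed
  have "op_equiv (stab B) (\<phi> (opmat ?p) + \<phi> (opmat ?p')) (opmat ?q + opmat ?q')"
  proof (rule op_equiv_add[OF subalgebra_stab_B])
    show "op_equiv (stab B) (\<phi> (opmat ?p)) (opmat ?q)"
      by (rule move[OF mvn_direct_sum_zero(1)[OF diag(1) p(1)] eq(1) mvn_direct_sum_zero(1)[OF diag(5) q(1)]])
    show "op_equiv (stab B) (\<phi> (opmat ?p')) (opmat ?q')"
      by (rule move[OF mvn_direct_sum_zero(2)[OF diag(1) p(2)] eq(2) mvn_direct_sum_zero(2)[OF diag(5) q(2)]])
    show "op_projection (\<phi> (opmat ?p))" "op_projection (\<phi> (opmat ?p'))"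
      using opmat_projection_stab(2) proj by auto
    show "\<phi> (opmat ?p) * \<phi> (opmat ?p') = 0"
      using algebra_isoD(4)[OF stable.iso opmat_projection_stab(1)[OF proj(1)] opmat_projection_stab(1)[OF proj(2)]]
      by (simp add: opmat_direct_sum_orthogonal[OF n n'] algebra_iso_zero[OF stable.iso stable.A])
    show "opmat ?q * opmat ?q' = 0"
      by (rule opmat_direct_sum_orthogonal[OF m m'])
  qed
  then have "op_equiv (stab B) (\<phi> (opmat (p \<oplus>\<^sub>m p'))) (opmat (q \<oplus>\<^sub>m q'))"
    by (simp add: opmat_direct_sum[OF n n'] opmat_direct_sum[OF m m']
        algebra_isoD(3)[OF stable.iso opmat_projection_stab(1)[OF proj(1)] opmat_projection_stab(1)[OF proj(2)]])
  then show ?thesis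
    unfolding corresponds_def using p q by (simp add: direct_sum_projection diag)
qed

lemma corresponds_zero: "corresponds (0\<^sub>m 0 0) (0\<^sub>m 0 0)"
proof -
  have "op_equiv (stab B) 0 0"
    by (rule op_equiv_refl[OF subalgebraD(1)[OF subalgebra_stab_B]]) (simp add: op_projection_def)
  then show ?thesis
    by (simp add: corresponds_def opmat_empty zero_projection diag algebra_iso_zero[OF stable.iso stable.A])
qed

lemma corresponds_direct_multiple:
  "corresponds p q \<Longrightarrow> corresponds (direct_multiple k p) (direct_multiple k q)"
  by (induction k) (auto simp: corresponds_zero corresponds_direct_sum)

text \<open>The dimension function of \<open>B\<close>, transported to projections over \<open>A\<close>, is additive and
  invariant, hence proportional to that of \<open>A\<close>. Both functions are nonnegative and have
  differences equal to one, so the factor is one.\<close>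

lemma dimension_preserved:
  assumes canc: "has_cancellation (diag_algebra A)" "has_cancellation (diag_algebra B)"
    and \<theta>: "\<theta>\<^sub>A \<in> K0_identifications (diag_algebra A)" "\<theta>\<^sub>B \<in> K0_identifications (diag_algebra B)"
    and pq: "corresponds p q"
  shows "\<theta>\<^sub>B (K0_class (diag_algebra B) q) = \<theta>\<^sub>A (K0_class (diag_algebra A) p)"
proof -
  let ?C = "diag_algebra A" and ?D = "diag_algebra B"
  define dA where "dA p = \<theta>\<^sub>A (K0_class ?C p)" for p
  define dB where "dB q = \<theta>\<^sub>B (K0_class ?D q)" for q
  note C = diag(1) canc(1) \<theta>(1) and D = diag(5) canc(2) \<theta>(2)
  \<comment> \<open>The \<open>dA p'\<close>-fold multiple of \<open>p\<close> and the \<open>dA p\<close>-fold multiple of \<open>p'\<close> have equal dimension, so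
    they are equivalent, and so are the corresponding multiples over \<open>B\<close>.\<close>
  have proportional: "dA p' * dB q = dA p * dB q'" if "corresponds p q" "corresponds p' q'" for p q p' q'
  proof -
    have P: "p \<in> mat_projections ?C" "p' \<in> mat_projections ?C" "q \<in> mat_projections ?D" "q' \<in> mat_projections ?D"
      using that by (auto simp: corresponds_def)
    define k where "k = nat (dA p)"
    define k' where "k' = nat (dA p')"
    have k: "int k = dA p" "int k' = dA p'"
      using dimension_nonneg[OF C] P by (simp_all add: k_def k'_def dA_def)
    let ?m = "direct_multiple k' p" and ?m' = "direct_multiple k p'"
    have "dA ?m = dA ?m'"
      using dimension_direct_multiple[OF C] P k by (simp add: dA_def mult.commute)
    then have "(?m, ?m') \<in> murray_von_neumann ?C"
      using dimension_eq_iff[OF C] direct_multiple_projection[OF diag(2)] P by (simp add: dA_def)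
    then have "(direct_multiple k' q, direct_multiple k q') \<in> murray_von_neumann ?D"
      by (rule corresponds_mvn[OF corresponds_direct_multiple[OF that(1)] corresponds_direct_multiple[OF that(2)]])
    then have "dB (direct_multiple k' q) = dB (direct_multiple k q')"
      using dimension_eq_iff[OF D] direct_multiple_projection[OF diag(6)] P by (simp add: dB_def)
    then show ?thesis
      using dimension_direct_multiple[OF D] P k by (simp add: dB_def)
  qed
  obtain p1 p0 where p10: "p1 \<in> mat_projections ?C" "p0 \<in> mat_projections ?C" "dA p1 - dA p0 = 1"
    using dimension_generates[OF C] by (auto simp: dA_def)
  obtain q1 q0 where pq1: "corresponds p1 q1" and pq0: "corresponds p0 q0"
    using corresponds_exists p10 by meson
  \<comment> \<open>The factor of proportionality, which is an integer because it is the difference of the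
    transported dimensions of two projections whose own dimensions differ by one.\<close>
  define r where "r = dB q1 - dB q0"
  have r: "dB q = r * dA p" if "corresponds p q" for p q
  proof -
    have "dB q = (dA p1 - dA p0) * dB q"
      by (simp add: p10)
    also have "\<dots> = dA p * dB q1 - dA p * dB q0"
      using proportional[OF that pq1] proportional[OF that pq0] by (simp add: left_diff_distrib)
    finally show ?thesis
      by (simp add: r_def algebra_simps)
  qed
  obtain t1 t0 where t: "t1 \<in> mat_projections ?D" "t0 \<in> mat_projections ?D" "dB t1 - dB t0 = 1"
    using dimension_generates[OF D] by (auto simp: dB_def)
  obtain s1 s0 where "corresponds s1 t1" "corresponds s0 t0"
    using corresponds_surj t by meson
  then have "r * (dA s1 - dA s0) = 1"
    using t(3) r by (simp add: right_diff_distrib)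
  then have "r = 1 \<or> r = - 1"
    by (metis dvd_triv_left zdvd1_eq abs_eq_iff' abs_one)
  moreover have "r \<noteq> - 1"
  proof
    assume "r = - 1"
    then have "dB q1 = - dA p1"
      using r[OF pq1] by simp
    moreover have "0 \<le> dB q1"
      using dimension_nonneg[OF D] pq1 by (simp add: dB_def corresponds_def)
    moreover have "0 \<le> dA p0"
      using dimension_nonneg[OF C] p10 by (simp add: dA_def)
    ultimately show False
      using p10(3) by simp
  qed
  ultimately show ?thesis
    using r[OF pq] by (simp add: dA_def dB_def)
qed

end

lemma opmat_unit: "opmat (mat 1 1 (\<lambda>_. a)) = embed a 0 0"
  by (rule entry_eqI) (auto simp: entry_opmat)

lemma embed_inject: "embed a i j = embed b i j \<Longrightarrow> a = b"
  using entry_embed[of a i j i j] by simp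

lemma embed_entry: "embed 1 0 0 * T * embed 1 0 0 = embed (entry T 0 0) 0 0"
  by (rule bop_eqI) simp

text \<open>The compression of the stable isomorphism to the corners of \<open>1 \<otimes> e\<^sub>0\<^sub>0\<close>, after it has been
  corrected by a partial isometry that carries one corner to the other.\<close>

lemma (in stab_iso) corner_isomorphism:
  assumes ci: "completely_isometric_on (stab A) \<phi>"
    and eq: "op_equiv (stab B) (\<phi> (embed 1 0 0)) (embed 1 0 0)"
  shows "completely_isometrically_isomorphic A B"
proof -
  obtain v where v: "v \<in> stab B" "star v \<in> stab B" "star v * v = \<phi> (embed 1 0 0)" "v * star v = embed 1 0 0"
    using eq by (auto simp: op_equiv_def)
  have e: "embed a 0 0 \<in> stab A" if "a \<in> A" for a
    by (rule stab_embed[OF subalgebraD(1)[OF A(1)] that])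
  have eB: "embed b 0 0 \<in> stab B" if "b \<in> B" for b
    by (rule stab_embed[OF subalgebraD(1)[OF B(1)] that])
  have one: "op_projection (embed 1 0 0 :: 'a l2 bop)"
    by (simp add: op_projection_def embed_star embed_mult)
  then have P: "op_projection (star v * v)"
    unfolding v(3) by (rule stable.projection[OF e[OF A(3)]])
  note v3 = partial_isometry(1,2)[OF P]
  have norm_v: "norm v \<le> 1" "norm (star v) \<le> 1"
    using norm_partial_isometry_le[OF P] by simp_all
  \<comment> \<open>The partial isometry \<open>v\<close> starts from the range of \<open>\<phi> (embed 1 0 0)\<close>, the unit of the corner
    that \<open>\<phi>\<close> assigns to \<open>A\<close>.\<close>
  have corner: "star v * v * \<phi> (embed a 0 0) = \<phi> (embed a 0 0)" "\<phi> (embed a 0 0) * (star v * v) = \<phi> (embed a 0 0)"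
    if "a \<in> A" for a
    using e[OF that] e[OF A(3)] by (simp_all add: v(3) embed_mult flip: algebra_isoD(4)[OF stable.iso])
  define \<psi> where "\<psi> a = entry (v * \<phi> (embed a 0 0) * star v) 0 0" for a
  have \<psi>: "embed (\<psi> a) 0 0 = v * \<phi> (embed a 0 0) * star v" for a
  proof -
    have "embed (\<psi> a) 0 0 = (v * star v * v) * \<phi> (embed a 0 0) * (star v * v * star v)"
      unfolding \<psi>_def by (simp add: mult.assoc v(4) flip: embed_entry)
    then show ?thesis
      by (simp only: v3)
  qed
  have recover: "\<phi> (embed a 0 0) = star v * embed (\<psi> a) 0 0 * v" if "a \<in> A" for a
    using corner[OF that] by (simp add: \<psi> mult.assoc)
  have mem: "\<psi> a \<in> B" if "a \<in> A" for a
    unfolding \<psi>_def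
    by (intro stabD(1)[of _ B] subalgebraD(3)[OF subalgebra_stab_B] v algebra_isoD(1)[OF stable.iso] e that)
  have "bij_betw \<psi> A B"
    unfolding bij_betw_def
  proof
    show "inj_on \<psi> A"
    proof (rule inj_onI)
      fix a b assume ab: "a \<in> A" "b \<in> A" "\<psi> a = \<psi> b"
      then have "\<phi> (embed a 0 0) = \<phi> (embed b 0 0)"
        by (simp add: recover)
      then have "embed a 0 0 = embed b 0 0"
        using algebra_isoD(2)[OF stable.iso] e ab by (auto simp: bij_betw_def inj_on_def)
      then show "a = b"
        by (rule embed_inject)
    qed
    show "\<psi> ` A = B"
    proof
      show "\<psi> ` A \<subseteq> B" using mem by blast
      show "B \<subseteq> \<psi> ` A"
      proof
        fix b assume b: "b \<in> B"
        have "star v * embed b 0 0 * v \<in> stab B"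
          by (intro subalgebraD(3)[OF subalgebra_stab_B] v eB b)
        then obtain S where S: "S \<in> stab A" "\<phi> S = star v * embed b 0 0 * v"
          using algebra_isoD(2)[OF stable.iso] by (auto simp: bij_betw_def image_iff) (metis image_iff)
        define a where "a = entry S 0 0"
        have a: "a \<in> A"
          using stabD(1)[OF S(1)] by (simp add: a_def)
        have "\<phi> (embed a 0 0) = \<phi> (embed 1 0 0) * \<phi> S * \<phi> (embed 1 0 0)"
          using e[OF A(3)] S(1)
          by (simp add: a_def subalgebraD(3)[OF stable.A] flip: embed_entry algebra_isoD(4)[OF stable.iso])
        also have "\<dots> = (star v * v * star v) * embed b 0 0 * (v * star v * v)"
          by (simp add: S(2) mult.assoc flip: v(3))
        finally have "\<phi> (embed a 0 0) = star v * embed b 0 0 * v"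
          by (simp only: v3)
        then have "v * \<phi> (embed a 0 0) * star v = (v * star v) * embed b 0 0 * (v * star v)"
          by (simp only: mult.assoc)
        then have "embed (\<psi> a) 0 0 = embed b 0 0"
          by (simp add: \<psi> v(4) embed_mult)
        then have "\<psi> a = b"
          by (rule embed_inject)
        with a show "b \<in> \<psi> ` A" by blast
      qed
    qed
  qed
  moreover have "\<psi> (a + b) = \<psi> a + \<psi> b" "\<psi> (a * b) = \<psi> a * \<psi> b" if "a \<in> A" "b \<in> A" for a b
  proof -
    have "embed (\<psi> (a + b)) 0 0 = embed (\<psi> a + \<psi> b) 0 0"
      unfolding \<psi> embed_add using e that by (simp add: \<psi> algebra_isoD(3)[OF stable.iso] algebra_simps)
    then show "\<psi> (a + b) = \<psi> a + \<psi> b" by (rule embed_inject)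
    have "embed (a * b) 0 0 = embed a 0 0 * embed b 0 0"
      by (simp add: embed_mult)
    then have "embed (\<psi> (a * b)) 0 0 = v * (\<phi> (embed a 0 0) * (star v * v) * \<phi> (embed b 0 0)) * star v"
      unfolding \<psi> using e that by (simp add: corner algebra_isoD(4)[OF stable.iso])
    also have "\<dots> = embed (\<psi> a) 0 0 * embed (\<psi> b) 0 0"
      by (simp add: \<psi> mult.assoc)
    finally have "embed (\<psi> (a * b)) 0 0 = embed (\<psi> a * \<psi> b) 0 0"
      by (simp add: embed_mult)
    then show "\<psi> (a * b) = \<psi> a * \<psi> b" by (rule embed_inject)
  qed
  moreover have "\<psi> (c *\<^sub>C a) = c *\<^sub>C \<psi> a" if "a \<in> A" for c a
  proof -
    have "embed (\<psi> (c *\<^sub>C a)) 0 0 = embed (c *\<^sub>C \<psi> a) 0 0"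
      unfolding \<psi> embed_scaleC using e that
      by (simp add: \<psi> algebra_isoD(5)[OF stable.iso] mult_scaleC_left mult_scaleC_right)
    then show ?thesis by (rule embed_inject)
  qed
  ultimately have "algebra_iso A B \<psi>"
    by (simp add: algebra_iso_def)
  moreover have "completely_isometric_on A \<psi>"
    unfolding completely_isometric_on_def
  proof (intro allI ballI)
    fix n M assume M: "M \<in> matrices_over n n A"
    let ?e = "map_mat (\<lambda>a. embed a 0 0) M"
    let ?\<phi> = "map_mat \<phi> ?e"
    let ?\<psi> = "map_mat (\<lambda>a. embed a 0 0) (map_mat \<psi> M)"
    have "?\<psi> = map_mat (\<lambda>X. v * X * star v) ?\<phi>"
      by (simp add: map_mat_map_mat \<psi>)
    then have le: "opmat_norm ?\<psi> \<le> opmat_norm ?\<phi>"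
      using opmat_bdd_compress[OF _ norm_v] by (metis opmat_norm_leI)
    have "?\<phi> = map_mat (\<lambda>X. star v * X * v) ?\<psi>"
      unfolding map_mat_map_mat by (rule map_mat_eqI[OF M recover])
    then have "opmat_norm ?\<phi> \<le> opmat_norm ?\<psi>"
      using opmat_bdd_compress[OF _ norm_v(2,1)] by (metis opmat_norm_leI)
    with le have "opmat_norm (map_mat \<psi> M) = opmat_norm ?\<phi>"
      by (simp add: opmat_norm_embed)
    moreover have "?e \<in> matrices_over n n (stab A)"
      using M e by (auto simp: matrices_over_iff)
    ultimately show "opmat_norm (map_mat \<psi> M) = opmat_norm M"
      using ci by (simp add: completely_isometric_on_def opmat_norm_embed)
  qed
  ultimately show ?thesis
    unfolding completely_isometrically_isomorphic_def by blast
qed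

section \<open>Amplification of complete isometries\<close>

lemma sum_div_mod: "(\<Sum>s<k * n. f (s div n) (s mod n)) = (\<Sum>j<k. \<Sum>q<n. f j q)"
  for n :: nat and f :: "nat \<Rightarrow> nat \<Rightarrow> 'x::comm_monoid_add"
proof (cases "n = 0")
  case False
  have "(\<Sum>s<k * n. f (s div n) (s mod n)) = (\<Sum>j<k. sum (\<lambda>s. f (s div n) (s mod n)) {j * n..<j * n + n})"
    by (rule sum.nat_group[symmetric])
  also have "\<dots> = (\<Sum>j<k. \<Sum>q<n. f j q)"
  proof (rule sum.cong[OF refl])
    fix j
    have "sum (\<lambda>s. f (s div n) (s mod n)) {j * n..<j * n + n} = sum (\<lambda>s. f (s div n) (s mod n)) {0 + j * n..<n + j * n}"
      by (simp add: add.commute)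
    also have "\<dots> = (\<Sum>q\<in>{0..<n}. f ((q + j * n) div n) ((q + j * n) mod n))"
      by (rule sum.shift_bounds_nat_ivl)
    also have "\<dots> = (\<Sum>q<n. f j q)"
      using False by (intro sum.cong) auto
    finally show "sum (\<lambda>s. f (s div n) (s mod n)) {j * n..<j * n + n} = (\<Sum>q<n. f j q)" .
  qed
  finally show ?thesis .
qed simp

text \<open>A matrix of operator matrices has the norm of the operator matrix with the blocks merged.\<close>

lemma opmat_bdd_blocks:
  fixes \<alpha> :: "nat \<Rightarrow> nat \<Rightarrow> nat \<Rightarrow> nat \<Rightarrow> 'a::complex_hilbert bop"
  shows "opmat_bdd (mat k k (\<lambda>(i, j). opmat (mat n n (\<lambda>(p, q). \<alpha> i j p q)))) c
    \<longleftrightarrow> opmat_bdd (mat (k * n) (k * n) (\<lambda>(r, s). \<alpha> (r div n) (s div n) (r mod n) (s mod n))) c"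
    (is "opmat_bdd ?X c \<longleftrightarrow> opmat_bdd ?Y c")
proof -
  define N where "N y = (\<Sum>i<k. \<Sum>p<n. (norm (\<Sum>j<k. \<Sum>q<n. bop_apply (\<alpha> i j p q) (y j q)))\<^sup>2)" for y
  have X: "sq_norm (dim_row ?X) (opmat_image ?X x) = N (\<lambda>j q. l2_nth (x j) q)" for x
  proof -
    have nth: "l2_nth (bop_apply (opmat (mat n n (\<lambda>(p, q). \<alpha> i j p q))) f) p
        = (if p < n then \<Sum>q<n. bop_apply (\<alpha> i j p q) (l2_nth f q) else 0)" for i j p f
    proof -
      have "l2_nth (bop_apply (opmat (mat n n (\<lambda>(p, q). \<alpha> i j p q))) f) p
          = (\<Sum>l<n. if p = l then (\<Sum>q<n. bop_apply (\<alpha> i j l q) (l2_nth f q)) else 0)"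
        unfolding opmat_def bop_apply_sum l2_nth_sum dim_row_mat dim_col_mat
        by (intro sum.cong refl) (auto intro!: sum.neutral sum.cong)
      then show ?thesis by simp
    qed
    have "(norm (\<Sum>j<k. bop_apply (opmat (mat n n (\<lambda>(p, q). \<alpha> i j p q))) (x j)))\<^sup>2
        = (\<Sum>p<n. (norm (\<Sum>j<k. \<Sum>q<n. bop_apply (\<alpha> i j p q) (l2_nth (x j) q)))\<^sup>2)" for i
      by (subst norm_l2_finite[of n]) (auto simp: nth)
    then show ?thesis by (simp add: N_def sq_norm_def opmat_image_def)
  qed
  have Y: "sq_norm (dim_row ?Y) (opmat_image ?Y (\<lambda>s. y (s div n) (s mod n))) = N y" for y
  proof -
    have "(\<Sum>s<k * n. bop_apply (?Y $$ (r, s)) (y (s div n) (s mod n)))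
        = (\<Sum>j<k. \<Sum>q<n. bop_apply (\<alpha> (r div n) j (r mod n) q) (y j q))" if "r < k * n" for r
      using that by (subst sum_div_mod[symmetric]) (intro sum.cong; simp)
    then show ?thesis
      unfolding N_def by (subst sum_div_mod[symmetric]) (simp add: sq_norm_def opmat_image_def)
  qed
  show ?thesis
  proof
    assume b: "opmat_bdd ?X c"
    show "opmat_bdd ?Y c"
      unfolding opmat_bdd_def
    proof
      fix z :: "nat \<Rightarrow> 'a"
      define y where "y j q = z (j * n + q)" for j q
      have z: "z = (\<lambda>s. y (s div n) (s mod n))"
        by (simp add: y_def)
      define x where "x j = (\<Sum>q<n. l2_single q (y j q))" for j
      have xn: "l2_nth (x j) q = (if q < n then y j q else 0)" for j q
        by (simp add: x_def)
      have "(norm (x j))\<^sup>2 = (\<Sum>q<n. (norm (y j q))\<^sup>2)" for j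
        by (subst norm_l2_finite[of n]) (auto simp: xn)
      then have "sq_norm k x = sq_norm (k * n) z"
        by (simp add: z sq_norm_def sum_div_mod[of "\<lambda>j q. (norm (y j q))\<^sup>2"])
      moreover have "N y \<le> c\<^sup>2 * sq_norm k x"
        using b[unfolded opmat_bdd_def X, rule_format, of x] by (simp add: N_def xn)
      ultimately show "sq_norm (dim_row ?Y) (opmat_image ?Y z) \<le> c\<^sup>2 * sq_norm (dim_col ?Y) z"
        using Y[of y] by (simp flip: z)
    qed
  next
    assume b: "opmat_bdd ?Y c"
    show "opmat_bdd ?X c"
      unfolding opmat_bdd_def X
    proof
      fix x :: "nat \<Rightarrow> 'a l2"
      have "N (\<lambda>j q. l2_nth (x j) q) \<le> c\<^sup>2 * sq_norm (k * n) (\<lambda>s. l2_nth (x (s div n)) (s mod n))"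
        using b[unfolded opmat_bdd_def, rule_format, of "\<lambda>s. l2_nth (x (s div n)) (s mod n)"]
          Y[of "\<lambda>j q. l2_nth (x j) q"] by simp
      also have "sq_norm (k * n) (\<lambda>s. l2_nth (x (s div n)) (s mod n)) = (\<Sum>j<k. \<Sum>q<n. (norm (l2_nth (x j) q))\<^sup>2)"
        unfolding sq_norm_def by (rule sum_div_mod)
      also have "c\<^sup>2 * \<dots> \<le> c\<^sup>2 * sq_norm k x"
        unfolding sq_norm_def by (intro mult_left_mono sum_mono sum_norm_l2_le) auto
      finally show "N (\<lambda>j q. l2_nth (x j) q) \<le> c\<^sup>2 * sq_norm (dim_col ?X) x"
        by simp
    qed
  qed
qed

locale complete_isometry =
  fixes A :: "'a::complex_hilbert bop set" and B :: "'b::complex_hilbert bop set"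
    and \<psi> :: "'a bop \<Rightarrow> 'b bop"
  assumes A: "subalgebra A" "closed A" and B: "subalgebra B" "closed B"
    and iso: "algebra_iso A B \<psi>" and ci: "completely_isometric_on A \<psi>"
begin

text \<open>The map \<open>\<psi>\<close> applied to the entries of the corner of size \<open>n\<close>.\<close>

definition amp :: "nat \<Rightarrow> 'a l2 bop \<Rightarrow> 'b l2 bop"
  where "amp n T = opmat (mat n n (\<lambda>(p, q). \<psi> (entry T p q)))"

text \<open>A matrix of corners is a larger matrix over \<open>A\<close> in disguise, and \<open>\<psi>\<close> preserves the norm of that.\<close>

lemma amp_bdd:
  assumes M: "M \<in> matrices_over k k (stab A)" and c: "0 \<le> c" and b: "opmat_bdd M c"
  shows "opmat_bdd (map_mat (amp n) M) c"
proof -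
  define \<alpha> where "\<alpha> i j p q = entry (M $$ (i, j)) p q" for i j p q
  define big where "big = mat (k * n) (k * n) (\<lambda>(r, s). \<alpha> (r div n) (s div n) (r mod n) (s mod n))"
  note cM = matrices_over_carrier[OF M]
  have "opmat_bdd (map_mat (\<lambda>X. E n * X * E n) M) c"
    by (rule opmat_bdd_compress[OF b norm_coord_proj_le norm_coord_proj_le])
  moreover have "map_mat (\<lambda>X. E n * X * E n) M = mat k k (\<lambda>(i, j). opmat (mat n n (\<lambda>(p, q). \<alpha> i j p q)))"
    using cM by (intro eq_matI) (auto simp: \<alpha>_def coord_proj_opmat)
  ultimately have "opmat_bdd big c"
    unfolding big_def by (simp only: opmat_bdd_blocks)
  moreover have "big \<in> matrices_over (k * n) (k * n) A"
  proof -
    have "s div n < k" if "s < k * n" for s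
      using that by (metis less_mult_imp_div_less)
    then show ?thesis
      using M by (auto simp: matrices_over_iff big_def \<alpha>_def intro!: stabD(1))
  qed
  ultimately have "opmat_norm (map_mat \<psi> big) \<le> c"
    using ci c by (simp add: completely_isometric_on_def opmat_norm_le_iff)
  then have "opmat_bdd (map_mat \<psi> big) c"
    using c by (simp add: opmat_norm_le_iff)
  moreover have "map_mat \<psi> big = mat (k * n) (k * n) (\<lambda>(r, s). \<psi> (\<alpha> (r div n) (s div n) (r mod n) (s mod n)))"
    by (rule eq_matI) (auto simp: big_def)
  ultimately have "opmat_bdd (mat k k (\<lambda>(i, j). opmat (mat n n (\<lambda>(p, q). \<psi> (\<alpha> i j p q))))) c"
    using opmat_bdd_blocks[of k n "\<lambda>i j p q. \<psi> (\<alpha> i j p q)" c] by simp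
  moreover have "map_mat (amp n) M = mat k k (\<lambda>(i, j). opmat (mat n n (\<lambda>(p, q). \<psi> (\<alpha> i j p q))))"
    using cM by (intro eq_matI) (auto simp: \<alpha>_def amp_def)
  ultimately show ?thesis by simp
qed

lemma norm_amp_le:
  assumes T: "T \<in> stab A"
  shows "norm (amp n T) \<le> norm T"
proof -
  have M: "mat 1 1 (\<lambda>_. T) \<in> matrices_over 1 1 (stab A)"
    using T by (simp add: matrices_over_iff)
  have "opmat_norm (map_mat (amp n) (mat 1 1 (\<lambda>_. T))) \<le> opmat_norm (mat 1 1 (\<lambda>_. T))"
    by (rule opmat_norm_leI) (rule amp_bdd[OF M])
  moreover have "map_mat (amp n) (mat 1 1 (\<lambda>_. T)) = mat 1 1 (\<lambda>_. amp n T)"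
    by (rule eq_matI) auto
  ultimately show ?thesis
    by (simp only: opmat_norm_single)
qed

lemma norm_\<psi>: "a \<in> A \<Longrightarrow> norm (\<psi> a) = norm a"
  by (rule completely_isometric_norm[OF ci])

lemma \<psi>_diff: "a \<in> A \<Longrightarrow> b \<in> A \<Longrightarrow> \<psi> (a - b) = \<psi> a - \<psi> b"
  using algebra_isoD(3)[OF iso, of "a - b" b] subalgebra_diff[OF A(1)] by simp

lemma \<psi>_sum: "(\<And>i. i \<in> I \<Longrightarrow> f i \<in> A) \<Longrightarrow> \<psi> (sum f I) = (\<Sum>i\<in>I. \<psi> (f i))"
  by (induction I rule: infinite_finite_induct)
    (auto simp: algebra_iso_zero[OF iso A(1)] algebra_isoD(3)[OF iso] subalgebra_sum[OF A(1)])

lemma tendsto_\<psi>: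
  assumes "\<And>n. x n \<in> A" "a \<in> A" "x \<longlonglongrightarrow> a"
  shows "(\<lambda>n. \<psi> (x n)) \<longlonglongrightarrow> \<psi> a"
proof -
  have "norm (\<psi> (x n) - \<psi> a) = norm (x n - a)" for n
    using assms by (simp add: norm_\<psi> subalgebra_diff[OF A(1)] flip: \<psi>_diff)
  then show ?thesis
    using assms(3) by (simp add: tendsto_iff dist_norm)
qed

lemma entry_amp: "entry (amp n T) i j = (if i < n \<and> j < n then \<psi> (entry T i j) else 0)"
  by (simp add: amp_def entry_opmat)

lemma amp_stab: "T \<in> stab A \<Longrightarrow> amp n T \<in> stab B"
  unfolding amp_def
  by (rule stab_opmat[OF subalgebraD(1)[OF B(1)], of _ n n])
    (auto simp: matrices_over_iff stabD(1) algebra_isoD(1)[OF iso])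

lemma amp_truncation:
  assumes "m \<le> n"
  shows "amp m T = amp n (E m * T * E m)"
  by (rule entry_eqI)
    (use assms in \<open>auto simp: entry_amp entry_coord_proj_left entry_coord_proj_right algebra_iso_zero[OF iso A(1)]\<close>)

lemma amp_diff: "S \<in> stab A \<Longrightarrow> T \<in> stab A \<Longrightarrow> amp n (S - T) = amp n S - amp n T"
  by (rule entry_eqI) (simp add: entry_amp \<psi>_diff stabD(1))

lemma truncation_stab:
  assumes "T \<in> stab A"
  shows "E m * T * E m \<in> stab A"
  unfolding coord_proj_opmat
  by (rule stab_opmat[OF subalgebraD(1)[OF A(1)], of _ m m]) (use stabD(1)[OF assms] in \<open>auto simp: matrices_over_iff\<close>)

lemma amp_convergent:
  assumes T: "T \<in> stab A"
  shows "convergent (\<lambda>n. amp n T)"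
proof -
  have le: "norm (amp n T - amp m T) \<le> norm (E m * T * E m - T)" if "m \<le> n" for m n
  proof -
    have "amp n T - amp m T = amp n (T - E m * T * E m)"
      by (simp add: amp_diff[OF T truncation_stab[OF T]] amp_truncation[OF that])
    then show ?thesis
      using norm_amp_le[OF subalgebra_diff[OF subalgebra_stab[OF A] T truncation_stab[OF T]], of n m]
      by (simp add: norm_minus_commute)
  qed
  have "(\<lambda>m. norm (E m * T * E m - T)) \<longlonglongrightarrow> 0"
    using stabD(2)[OF T] by (simp add: LIM_zero_iff tendsto_norm_zero_iff)
  then show ?thesis
    by (rule convergent_of_tail_bound[rotated]) (rule le)
qed

definition amplify :: "'a l2 bop \<Rightarrow> 'b l2 bop"
  where "amplify T = lim (\<lambda>n. amp n T)"

lemma amp_tendsto: "T \<in> stab A \<Longrightarrow> (\<lambda>n. amp n T) \<longlonglongrightarrow> amplify T"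
  unfolding amplify_def by (rule convergent_LIMSEQ_iff[THEN iffD1, OF amp_convergent])

lemma amplify_stab: "T \<in> stab A \<Longrightarrow> amplify T \<in> stab B"
  by (rule closed_sequentially[OF closed_stab[OF B(2)] amp_stab amp_tendsto])

lemma entry_amplify:
  assumes "T \<in> stab A"
  shows "entry (amplify T) i j = \<psi> (entry T i j)"
proof (rule LIMSEQ_unique)
  show "(\<lambda>n. entry (amp n T) i j) \<longlonglongrightarrow> entry (amplify T) i j"
    by (intro tendsto_intros amp_tendsto assms)
  have "\<forall>\<^sub>F n in sequentially. entry (amp n T) i j = \<psi> (entry T i j)"
    by (rule eventually_sequentiallyI[of "Suc (max i j)"]) (auto simp: entry_amp)
  then show "(\<lambda>n. entry (amp n T) i j) \<longlonglongrightarrow> \<psi> (entry T i j)"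
    by (rule tendsto_eventually)
qed

text \<open>The entries of a product are norm convergent infinite sums, which \<open>\<psi>\<close> respects as an isometry.\<close>

lemma amplify_mult:
  assumes S: "S \<in> stab A" and T: "T \<in> stab A"
  shows "amplify (S * T) = amplify S * amplify T"
proof (rule entry_eqI)
  fix i j
  have ST: "S * T \<in> stab A"
    by (rule stab_mult[OF A S T])
  have mem: "(\<Sum>k<n. entry S i k * entry T k j) \<in> A" for n
    by (intro subalgebra_sum subalgebraD(3) A(1) stabD(1) S T)
  have "(\<lambda>n. entry (S * E n * T) i j) \<longlonglongrightarrow> entry (S * T) i j"
    by (intro tendsto_intros stab_tendsto(2)[OF S])
  then have "(\<lambda>n. \<psi> (\<Sum>k<n. entry S i k * entry T k j)) \<longlonglongrightarrow> \<psi> (entry (S * T) i j)"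
    unfolding entry_mult_coord_proj by (intro tendsto_\<psi> mem stabD(1)[OF ST])
  moreover have "\<psi> (\<Sum>k<n. entry S i k * entry T k j) = entry (amplify S * E n * amplify T) i j" for n
    unfolding entry_mult_coord_proj
    using stabD(1)[OF S] stabD(1)[OF T]
    by (simp add: \<psi>_sum subalgebraD(3)[OF A(1)] algebra_isoD(4)[OF iso] entry_amplify S T)
  moreover have "(\<lambda>n. entry (amplify S * E n * amplify T) i j) \<longlonglongrightarrow> entry (amplify S * amplify T) i j"
    by (intro tendsto_intros stab_tendsto(2)[OF amplify_stab[OF S]])
  ultimately show "entry (amplify (S * T)) i j = entry (amplify S * amplify T) i j"
    unfolding entry_amplify[OF ST] using LIMSEQ_unique by fastforce
qed

lemma amplify_bdd:
  assumes M: "M \<in> matrices_over k k (stab A)" and c: "0 \<le> c" and b: "opmat_bdd M c"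
  shows "opmat_bdd (map_mat amplify M) c"
  unfolding opmat_bdd_def
proof
  fix x :: "nat \<Rightarrow> 'b l2"
  let ?N = "\<lambda>f. sq_norm k (opmat_image (map_mat f M) x)"
  note cM = matrices_over_carrier[OF M]
  have "?N amplify \<le> c\<^sup>2 * sq_norm k x"
  proof (rule tendsto_upperbound)
    have "(\<lambda>n. \<Sum>i<k. (norm (\<Sum>j<k. bop_apply (amp n (M $$ (i, j))) (x j)))\<^sup>2)
        \<longlonglongrightarrow> (\<Sum>i<k. (norm (\<Sum>j<k. bop_apply (amplify (M $$ (i, j))) (x j)))\<^sup>2)"
      by (intro tendsto_intros amp_tendsto) (use M in \<open>auto simp: matrices_over_iff\<close>)
    then show "(\<lambda>n. ?N (amp n)) \<longlonglongrightarrow> ?N amplify"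
      using cM by (simp add: sq_norm_def opmat_image_def)
    show "\<forall>\<^sub>F n in sequentially. ?N (amp n) \<le> c\<^sup>2 * sq_norm k x"
    proof (intro always_eventually allI)
      fix n
      show "?N (amp n) \<le> c\<^sup>2 * sq_norm k x"
        using amp_bdd[OF M c b, of n, unfolded opmat_bdd_def, rule_format, of x] cM by simp
    qed
  qed simp
  then show "sq_norm (dim_row (map_mat amplify M)) (opmat_image (map_mat amplify M) x)
      \<le> c\<^sup>2 * sq_norm (dim_col (map_mat amplify M)) x"
    using cM by simp
qed

lemma inverse: "complete_isometry B A (inv_into A \<psi>)"
  by (simp add: complete_isometry_def A B algebra_iso_inverse[OF iso A(1)] completely_isometric_inverse[OF iso ci])

text \<open>The amplification of the inverse is an inverse of the amplification, by comparison of entries,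
  and both are completely contractive.\<close>

lemma amplify_iso: "completely_isometrically_isomorphic (stab A) (stab B)"
proof -
  interpret inv: complete_isometry B A "inv_into A \<psi>"
    by (rule inverse)
  have left: "inv.amplify (amplify T) = T" if "T \<in> stab A" for T
    using algebra_isoD(2)[OF iso] stabD(1)[OF that]
    by (intro entry_eqI) (simp add: inv.entry_amplify entry_amplify amplify_stab that bij_betw_def)
  have right: "amplify (inv.amplify S) = S" if "S \<in> stab B" for S
    using algebra_isoD(2)[OF iso] stabD(1)[OF that]
    by (intro entry_eqI) (simp add: inv.entry_amplify entry_amplify inv.amplify_stab that bij_betw_def f_inv_into_f)
  note sA = subalgebraD[OF subalgebra_stab[OF A]]
  have "bij_betw amplify (stab A) (stab B)"
    by (rule bij_betw_byWitness[where f' = inv.amplify]) (auto simp: left right amplify_stab inv.amplify_stab)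
  moreover have "amplify (S + T) = amplify S + amplify T" if "S \<in> stab A" "T \<in> stab A" for S T
    by (rule entry_eqI) (simp add: entry_amplify that sA algebra_isoD(3)[OF iso] stabD(1))
  moreover have "amplify (c *\<^sub>C S) = c *\<^sub>C amplify S" if "S \<in> stab A" for c S
    by (rule entry_eqI) (simp add: entry_amplify that sA algebra_isoD(5)[OF iso] stabD(1))
  ultimately have "algebra_iso (stab A) (stab B) amplify"
    by (simp add: algebra_iso_def amplify_mult)
  moreover have "completely_isometric_on (stab A) amplify"
    unfolding completely_isometric_on_def
  proof (intro allI ballI antisym)
    fix k M assume M: "M \<in> matrices_over k k (stab A)"
    show "opmat_norm (map_mat amplify M) \<le> opmat_norm M"
      by (rule opmat_norm_leI) (rule amplify_bdd[OF M])
    have M': "map_mat amplify M \<in> matrices_over k k (stab B)"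
      using M amplify_stab by (auto simp: matrices_over_iff)
    have "map_mat inv.amplify (map_mat amplify M) = M"
      using M left by (intro eq_matI) (auto simp: matrices_over_iff)
    moreover have "opmat_norm (map_mat inv.amplify (map_mat amplify M)) \<le> opmat_norm (map_mat amplify M)"
      by (rule opmat_norm_leI) (rule inv.amplify_bdd[OF M'])
    ultimately show "opmat_norm M \<le> opmat_norm (map_mat amplify M)" by simp
  qed
  ultimately show ?thesis
    unfolding completely_isometrically_isomorphic_def by blast
qed

end

section \<open>The stable isomorphism theorem\<close>

theorem theorem3p1:
  fixes A :: "'a::complex_hilbert bop set" and B :: "'b::complex_hilbert bop set"
  assumes "operator_algebra A" and "unital A"
    and "operator_algebra B" and "unital B"
    and "has_cancellation (diag_algebra A)" and "has_cancellation (diag_algebra B)"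
    and "K0 (diag_algebra A) \<cong> integer_group" and "K0 (diag_algebra B) \<cong> integer_group"
    and "\<theta>\<^sub>A \<in> K0_identifications (diag_algebra A)"
    and "\<theta>\<^sub>B \<in> K0_identifications (diag_algebra B)"
    and "\<theta>\<^sub>A (K0_unit (diag_algebra A)) = \<theta>\<^sub>B (K0_unit (diag_algebra B))"
  shows "completely_isometrically_isomorphic (A \<otimes>\<^sub>s\<^sub>p \<K>) (B \<otimes>\<^sub>s\<^sub>p \<K>)
    \<longleftrightarrow> completely_isometrically_isomorphic A B"
proof -
  have A: "subalgebra A" "closed A" and B: "subalgebra B" "closed B"
    using assms(1,3) by (auto simp: operator_algebra_def)
  have 1: "1 \<in> A" "1 \<in> B"
    using unital_operator_algebra_one assms(1-4) unfolding unital_def is_unit_of_def by metis+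
  show ?thesis
    unfolding spatial_tensor_compact[OF A] spatial_tensor_compact[OF B]
  proof
    assume "completely_isometrically_isomorphic (stab A) (stab B)"
    then obtain \<phi> where \<phi>: "algebra_iso (stab A) (stab B) \<phi>" and ci: "completely_isometric_on (stab A) \<phi>"
      by (auto simp: completely_isometrically_isomorphic_def)
    interpret stab_iso A B \<phi>
      by standard (use A B 1 \<phi> completely_isometric_norm[OF ci] subalgebra_stab[OF A] subalgebra_stab[OF B]
          in \<open>auto simp: isometric_iso_def\<close>)
    have unit: "is_unit_of 1 (diag_algebra A)" "is_unit_of 1 (diag_algebra B)"
      using diag by (auto simp: is_unit_of_def)
    let ?u = "mat 1 1 (\<lambda>_. 1) :: 'a bop mat" and ?w = "mat 1 1 (\<lambda>_. 1) :: 'b bop mat"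
    have proj: "mat 1 1 (\<lambda>_. 1) \<in> mat_projections C" if "1 \<in> C" for C :: "'c::complex_hilbert bop set"
    proof -
      have "mat_star (mat 1 1 (\<lambda>_. 1)) = (mat 1 1 (\<lambda>_. 1) :: 'c bop mat)"
        "mat 1 1 (\<lambda>_. 1) * mat 1 1 (\<lambda>_. 1) = (mat 1 1 (\<lambda>_. 1) :: 'c bop mat)"
        by (rule eq_matI; simp add: scalar_prod_def)+
      then show ?thesis
        using that by (auto simp: mat_projections_def matrices_over_iff intro!: exI[of _ 1])
    qed
    obtain q where q: "corresponds ?u q"
      using corresponds_exists[OF proj[OF diag(4)]] by blast
    then have qD: "q \<in> mat_projections (diag_algebra B)" and \<phi>q: "op_equiv (stab B) (\<phi> (opmat ?u)) (opmat q)"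
      by (auto simp: corresponds_def)
    \<comment> \<open>The units have equal dimension, so \<open>q\<close>, which stands for the image of one of them under \<open>\<phi>\<close>, is
      equivalent to the other by cancellation.\<close>
    have "\<theta>\<^sub>B (K0_class (diag_algebra B) q) = \<theta>\<^sub>A (K0_class (diag_algebra A) ?u)"
      by (rule dimension_preserved[OF assms(5,6,9,10) q])
    also have "\<dots> = \<theta>\<^sub>B (K0_class (diag_algebra B) ?w)"
      using assms(11) by (simp add: K0_unit_def unit_of_eq[OF unit(1)] unit_of_eq[OF unit(2)])
    finally have "(q, ?w) \<in> murray_von_neumann (diag_algebra B)"
      using dimension_eq_iff[OF diag(5) assms(6,10) qD proj[OF diag(8)]] by blast
    then have "op_equiv (stab B) (opmat q) (opmat ?w)"
      using op_equiv_mono[OF mvn_imp_op_equiv[OF diag(5)] stab_diag_subset] by blast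
    then have "op_equiv (stab B) (\<phi> (embed 1 0 0)) (embed 1 0 0)"
      using op_equiv_trans[OF subalgebra_stab_B opmat_projection_stab(2)[OF proj[OF diag(4)]] \<phi>q]
      by (simp only: opmat_unit)
    then show "completely_isometrically_isomorphic A B"
      by (rule corner_isomorphism[OF ci])
  next
    assume "completely_isometrically_isomorphic A B"
    then obtain \<psi> where "algebra_iso A B \<psi>" "completely_isometric_on A \<psi>"
      by (auto simp: completely_isometrically_isomorphic_def)
    then interpret complete_isometry A B \<psi>
      by unfold_locales (use A B in auto)
    show "completely_isometrically_isomorphic (stab A) (stab B)"
      by (rule amplify_iso)
  qed
qed

end
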